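(* Let $\eta\in\{\mathbf{i},\mathbf{j},\mathbf{k}\}$ and let $A=A^{\eta*}\in\mathbb{H}^{m\times m}$, $B\in\mathbb{H}^{m\times p_1}$, $C\in\mathbb{H}^{m\times p_2}$, $D\in\mathbb{H}^{m\times p_3}$ be given. Then there exist $P\in GL_m(\mathbb{H})$, $T_1\in GL_{p_1}(\mathbb{H})$, $T_2\in GL_{p_2}(\mathbb{H})$, $T_3\in GL_{p_3}(\mathbb{H})$ such that $$PAP^{\eta*}=S_A,\qquad PBT_1=S_B,\qquad PCT_2=S_C,\qquad PDT_3=S_D,$$ where $$S_A=S_A^{\eta*}=\begin{pmatrix} A_{11}&\cdots&A_{19}&A_{1,10}&0\\ \vdots&\ddots&\vdots&\vdots&\vdots\\ A_{19}^{\eta*}&\cdots&A_{99}&A_{9,10}&0\\ A_{1,10}^{\eta*}&\cdots&A_{9,10}^{\eta*}&0&0\\ 0&\cdots&0&0&\Sigma\end{pmatrix},$$ $$S_B=\begin{pmatrix} I_{m_1}&0&0&0&0&0\\ 0&I_{m_2}&0&0&0&0\\ 0&0&I_{m_3}&0&0&0\\ 0&0&0&I_{m_4}&0&0\\ 0&0&0&0&I_{m_5}&0\\ 0&0&0&0&0&0\\ 0&0&0&0&0&0\\ 0&0&0&0&0&0\\ 0&0&0&0&0&0\\ 0&0&0&0&0&0\\ 0&0&0&0&0&0\end{pmatrix},\quad S_C=\begin{pmatrix} 0&0&0&I_{m_1}&0&0\\ 0&0&0&0&I_{m_2}&0\\ 0&0&0&0&0&0\\ 0&0&0&0&0&0\\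 0&0&0&0&0&0\\ I_{m_4}&0&0&0&0&0\\ 0&I_{m_6}&0&0&0&0\\ 0&0&I_{m_7}&0&0&0\\ 0&0&0&0&0&0\\ 0&0&0&0&0&0\\ 0&0&0&0&0&0\end{pmatrix},\quad S_D=\begin{pmatrix} 0&0&0&0&I_{m_1}&0\\ 0&0&0&0&0&0\\ 0&0&0&I_{m_3}&0&0\\ 0&I_{m_4}&0&0&0&0\\ 0&0&0&0&0&0\\ 0&I_{m_4}&0&0&0&0\\ 0&0&I_{m_6}&0&0&0\\ 0&0&0&0&0&0\\ I_{m_8}&0&0&0&0&0\\ 0&0&0&0&0&0\\ 0&0&0&0&0&0\end{pmatrix},$$ the matrix $\Sigma$ is diagonal and nonsingular with $$r(\Sigma)=r\begin{pmatrix} A&B&C&D\\ B^{\eta*}&0&0&0\\ C^{\eta*}&0&0&0\\ D^{\eta*}&0&0&0\end{pmatrix}-2r(B,C,D),$$ and $$m_1=r(D)+r(B)+r(C)-r\begin{pmatrix} D&B&0\\ D&0&C\end{pmatrix},$$ $$m_2=r\begin{pmatrix} D&B&0\\ D&0&C\end{pmatrix}-r(B,C)-r(D),\qquad m_3=r\begin{pmatrix} D&B&0\\ D&0&C\end{pmatrix}-r(B,D)-r(C),$$ $$m_4=r(B,C)+r(C,D)+r(B,D)-r(B,C,D)-r\begin{pmatrix} D&B&0\\ D&0&C\end{pmatrix},$$ $$m_5=r(B,C,D)-r(C,D),\qquad m_6=r\begin{pmatrix} D&B&0\\ D&0&C\end{pmatrix}-r(C,D)-r(B),$$ $$m_7=r(B,C,D)-r(B,D),\qquad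 m_8=r(B,C,D)-r(B,C).$$ Here all four matrices $S_A,S_B,S_C,S_D$ have their rows partitioned into 11 blocks of sizes $m_1,m_2,m_3,m_4,m_5,m_4,m_6,m_7,m_8,\ m-r(B,C,D)-r(\Sigma),\ r(\Sigma)$ (the columns of $S_A$ are partitioned in the same way), and the column block sizes are $m_1,m_2,m_3,m_4,m_5,p_1-r(B)$ for $S_B$; $m_4,m_6,m_7,m_1,m_2,p_2-r(C)$ for $S_C$; $m_8,m_4,m_6,m_3,m_1,p_3-r(D)$ for $S_D$.
   Context: $\mathbb{H}$ is the real quaternion algebra with imaginary units $\mathbf{i},\mathbf{j},\mathbf{k}$ ($\mathbf{i}^2=\mathbf{j}^2=\mathbf{k}^2=\mathbf{ijk}=-1$); $\mathbb{H}^{m\times n}$ is the set of $m\times n$ matrices over $\mathbb{H}$; $GL_n(\mathbb{H})$ is the set of invertible $n\times n$ matrices over $\mathbb{H}$. For a quaternion matrix $M$ (of any size), $M^*$ is its conjugate transpose and $M^{\eta*}:=-\eta M^*\eta$. A square $M$ is $\eta$-Hermitian if $M^{\eta*}=M$. $r(M)$ is the rank of the quaternion matrix $M$; $(B,C)$, $(B,C,D)$, etc. denote matrices formed by horizontal juxtaposition. Blocks of size zero are allowed (absent). $I_n$ is the $n\times n$ identity matrix. *)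

theory Defs
  imports Complex_Main "Jordan_Normal_Form.Matrix"
begin

section \<open>Quaternions\<close>

datatype quat = Quat (qRe: real) (qI: real) (qJ: real) (qK: real)

lemma quat_eq_iff:
  "x = y \<longleftrightarrow> qRe x = qRe y \<and> qI x = qI y \<and> qJ x = qJ y \<and> qK x = qK y"
  by (auto intro: quat.expand)

instantiation quat :: ring_1
begin

definition zero_quat :: quat where "0 = Quat 0 0 0 0"
definition one_quat :: quat where "1 = Quat 1 0 0 0"
definition plus_quat :: "quat \<Rightarrow> quat \<Rightarrow> quat" where
  "x + y = Quat (qRe x + qRe y) (qI x + qI y) (qJ x + qJ y) (qK x + qK y)"
definition uminus_quat :: "quat \<Rightarrow> quat" where
  "- x = Quat (- qRe x) (- qI x) (- qJ x) (- qK x)"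
definition minus_quat :: "quat \<Rightarrow> quat \<Rightarrow> quat" where
  "x - y = Quat (qRe x - qRe y) (qI x - qI y) (qJ x - qJ y) (qK x - qK y)"
definition times_quat :: "quat \<Rightarrow> quat \<Rightarrow> quat" where
  "x * y = Quat
     (qRe x * qRe y - qI x * qI y - qJ x * qJ y - qK x * qK y)
     (qRe x * qI y + qI x * qRe y + qJ x * qK y - qK x * qJ y)
     (qRe x * qJ y - qI x * qK y + qJ x * qRe y + qK x * qI y)
     (qRe x * qK y + qI x * qJ y - qJ x * qI y + qK x * qRe y)"

instance
  by standard
    (auto simp: quat_eq_iff zero_quat_def one_quat_def plus_quat_def uminus_quat_def
      minus_quat_def times_quat_def algebra_simps)

end

instantiation quat :: real_div_algebra
begin

definition scaleR_quat :: "real \<Rightarrow> quat \<Rightarrow> quat" where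
  "scaleR a x = Quat (a * qRe x) (a * qI x) (a * qJ x) (a * qK x)"
definition inverse_quat :: "quat \<Rightarrow> quat" where
  "inverse x = scaleR (1 / ((qRe x)\<^sup>2 + (qI x)\<^sup>2 + (qJ x)\<^sup>2 + (qK x)\<^sup>2))
     (Quat (qRe x) (- qI x) (- qJ x) (- qK x))"
definition divide_quat :: "quat \<Rightarrow> quat \<Rightarrow> quat" where
  "x div y = x * inverse (y :: quat)"

lemma quat_norm_pos:
  fixes x :: quat
  assumes "x \<noteq> 0"
  shows "(qRe x)\<^sup>2 + (qI x)\<^sup>2 + (qJ x)\<^sup>2 + (qK x)\<^sup>2 > 0"
proof -
  have "qRe x \<noteq> 0 \<or> qI x \<noteq> 0 \<or> qJ x \<noteq> 0 \<or> qK x \<noteq> 0"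
    using assms by (auto simp: quat_eq_iff zero_quat_def)
  then show ?thesis
    by (metis add_nonneg_nonneg add_nonneg_pos add_pos_nonneg zero_le_power2
        zero_less_power2)
qed

instance
proof
  fix x y :: quat and a b :: real
  show "a *\<^sub>R (x + y) = a *\<^sub>R x + a *\<^sub>R y" "(a + b) *\<^sub>R x = a *\<^sub>R x + b *\<^sub>R x"
    "a *\<^sub>R b *\<^sub>R x = (a * b) *\<^sub>R x" "1 *\<^sub>R x = x"
    "a *\<^sub>R x * y = a *\<^sub>R (x * y)" "x * a *\<^sub>R y = a *\<^sub>R (x * y)"
    by (auto simp: quat_eq_iff plus_quat_def times_quat_def scaleR_quat_def algebra_simps)
  show "inverse (0 :: quat) = 0"
    by (simp add: inverse_quat_def scaleR_quat_def zero_quat_def)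
  show "x div y = x * inverse y"
    by (rule divide_quat_def)
  assume "x \<noteq> 0"
  note pos = quat_norm_pos[OF this]
  let ?n = "(qRe x)\<^sup>2 + (qI x)\<^sup>2 + (qJ x)\<^sup>2 + (qK x)\<^sup>2"
  let ?c = "Quat (qRe x) (- qI x) (- qJ x) (- qK x)"
  have n: "x * ?c = Quat ?n 0 0 0" "?c * x = Quat ?n 0 0 0"
    by (auto simp: quat_eq_iff times_quat_def power2_eq_square algebra_simps)
  have sc: "x * a *\<^sub>R y = a *\<^sub>R (x * y)" "a *\<^sub>R y * x = a *\<^sub>R (y * x)" for a y
    by (auto simp: quat_eq_iff times_quat_def scaleR_quat_def algebra_simps)
  show "inverse x * x = 1" "x * inverse x = 1"
    unfolding inverse_quat_def sc n using pos
    by (auto simp: one_quat_def scaleR_quat_def)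
qed

end

definition quat_i :: quat where "quat_i = Quat 0 1 0 0"
definition quat_j :: quat where "quat_j = Quat 0 0 1 0"
definition quat_k :: quat where "quat_k = Quat 0 0 0 1"

lemma quat_units:
  "quat_i * quat_i = -1" "quat_j * quat_j = -1" "quat_k * quat_k = -1"
  "quat_i * quat_j * quat_k = -1"
  by (auto simp: quat_i_def quat_j_def quat_k_def times_quat_def one_quat_def uminus_quat_def)

definition qcnj :: "quat \<Rightarrow> quat" where
  "qcnj x = Quat (qRe x) (- qI x) (- qJ x) (- qK x)"


section \<open>Quaternion matrices\<close>

definition conj_transpose :: "quat mat \<Rightarrow> quat mat" where
  "conj_transpose M = map_mat qcnj (transpose_mat M)"

definition eta_star :: "quat \<Rightarrow> quat mat \<Rightarrow> quat mat" where
  "eta_star \<eta> M = map_mat (\<lambda>x. - \<eta> * x * \<eta>) (conj_transpose M)"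

definition GL :: "nat \<Rightarrow> quat mat set" where
  "GL n = {M \<in> carrier_mat n n. invertible_mat M}"

text \<open>The rank is the maximal number of right linearly independent columns; columns are
  addressed by their indices, so that equal columns count as dependent.\<close>

definition right_indep_cols :: "quat mat \<Rightarrow> nat set \<Rightarrow> bool" where
  "right_indep_cols M J \<longleftrightarrow>
     (\<forall>c :: nat \<Rightarrow> quat. (\<forall>i < dim_row M. (\<Sum>j\<in>J. M $$ (i, j) * c j) = 0) \<longrightarrow> (\<forall>j\<in>J. c j = 0))"

definition qrank :: "quat mat \<Rightarrow> nat" where
  "qrank M = Max (card ` {J. J \<subseteq> {..<dim_col M} \<and> right_indep_cols M J})"


section \<open>Block matrices\<close>

fun hcat :: "'a :: zero mat list \<Rightarrow> 'a mat" where
  "hcat [] = 0\<^sub>m 0 0"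
| "hcat [M] = M"
| "hcat (M # N # Ms) = (let R = hcat (N # Ms) in
     four_block_mat M R (0\<^sub>m 0 (dim_col M)) (0\<^sub>m 0 (dim_col R)))"

fun vcat :: "'a :: zero mat list \<Rightarrow> 'a mat" where
  "vcat [] = 0\<^sub>m 0 0"
| "vcat [M] = M"
| "vcat (M # N # Ms) = M @\<^sub>r vcat (N # Ms)"

definition block_mat :: "'a :: zero mat list list \<Rightarrow> 'a mat" where
  "block_mat Mss = vcat (map hcat Mss)"

text \<open>Here the blocks are given as functions of their numbers of rows and columns, which are
  taken from the lists \<open>rs\<close> and \<open>cs\<close> of block row and block column sizes.\<close>

definition sized_block_mat ::
  "nat list \<Rightarrow> nat list \<Rightarrow> (nat \<Rightarrow> nat \<Rightarrow> 'a :: zero mat) list list \<Rightarrow> 'a mat" where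
  "sized_block_mat rs cs Fss =
     block_mat (map2 (\<lambda>r Fs. map2 (\<lambda>c F. F r c) cs Fs) rs Fss)"


section \<open>The canonical forms\<close>

text \<open>Block indices in \<open>form_A\<close> run from 1 to 11, and \<open>F k l\<close> (used for \<open>k \<le> l\<close> only) is the
  block \<open>A\<^sub>k\<^sub>l\<close>; \<open>ns\<close> lists the eleven block sizes.\<close>

definition form_A ::
  "quat \<Rightarrow> nat list \<Rightarrow> (nat \<Rightarrow> nat \<Rightarrow> quat mat) \<Rightarrow> quat mat \<Rightarrow> quat mat" where
  "form_A \<eta> ns F \<Sigma> = block_mat (map (\<lambda>k. map (\<lambda>l.
     if k = 11 \<and> l = 11 then \<Sigma>
     else if k = 11 \<or> l = 11 \<or> k = 10 \<and> l = 10 then 0\<^sub>m (ns ! (k - 1)) (ns ! (l - 1))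
     else if k \<le> l then F k l
     else eta_star \<eta> (F l k)) [1..<12]) [1..<12])"

definition form_B :: "nat list \<Rightarrow> nat list \<Rightarrow> quat mat" where
  "form_B rs cs = (let Z = 0\<^sub>m; E = (\<lambda>r c. 1\<^sub>m r) in sized_block_mat rs cs
    [[E, Z, Z, Z, Z, Z],
     [Z, E, Z, Z, Z, Z],
     [Z, Z, E, Z, Z, Z],
     [Z, Z, Z, E, Z, Z],
     [Z, Z, Z, Z, E, Z],
     [Z, Z, Z, Z, Z, Z],
     [Z, Z, Z, Z, Z, Z],
     [Z, Z, Z, Z, Z, Z],
     [Z, Z, Z, Z, Z, Z],
     [Z, Z, Z, Z, Z, Z],
     [Z, Z, Z, Z, Z, Z]])"

definition form_C :: "nat list \<Rightarrow> nat list \<Rightarrow> quat mat" where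
  "form_C rs cs = (let Z = 0\<^sub>m; E = (\<lambda>r c. 1\<^sub>m r) in sized_block_mat rs cs
    [[Z, Z, Z, E, Z, Z],
     [Z, Z, Z, Z, E, Z],
     [Z, Z, Z, Z, Z, Z],
     [Z, Z, Z, Z, Z, Z],
     [Z, Z, Z, Z, Z, Z],
     [E, Z, Z, Z, Z, Z],
     [Z, E, Z, Z, Z, Z],
     [Z, Z, E, Z, Z, Z],
     [Z, Z, Z, Z, Z, Z],
     [Z, Z, Z, Z, Z, Z],
     [Z, Z, Z, Z, Z, Z]])"

definition form_D :: "nat list \<Rightarrow> nat list \<Rightarrow> quat mat" where
  "form_D rs cs = (let Z = 0\<^sub>m; E = (\<lambda>r c. 1\<^sub>m r) in sized_block_mat rs cs
    [[Z, Z, Z, Z, E, Z],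
     [Z, Z, Z, Z, Z, Z],
     [Z, Z, Z, E, Z, Z],
     [Z, E, Z, Z, Z, Z],
     [Z, Z, Z, Z, Z, Z],
     [Z, E, Z, Z, Z, Z],
     [Z, Z, E, Z, Z, Z],
     [Z, Z, Z, Z, Z, Z],
     [E, Z, Z, Z, Z, Z],
     [Z, Z, Z, Z, Z, Z],
     [Z, Z, Z, Z, Z, Z]])"

end

theory Submission
  imports Defs "HOL-Library.Function_Algebras" "HOL-Library.Set_Algebras"
begin

text \<open>Everything happens for the column spaces \<open>U\<close>, \<open>V\<close>, \<open>W\<close> of \<open>B\<close>, \<open>C\<close>, \<open>D\<close>. Bases of
  the quotients in the lattice generated by three subspaces, concatenated along chains such as
  \<open>0 \<subseteq> U \<inter> V \<inter> W \<subseteq> U \<inter> V \<subseteq> U \<inter> V + U \<inter> W \<subseteq> U \<inter> (V + W) \<subseteq> U\<close>, give one basis of the whole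
  space which is adapted to all three; its inverse matrix reduces \<open>B\<close>, \<open>C\<close>, \<open>D\<close>, and the column
  operations exist because a basis of a column space extends, through preimages, by a basis of the
  kernel. What is left is the freedom to add the last rows of \<open>P\<close>, where the three reduced matrices
  vanish, to other rows: a maximal orthogonal family for the form \<open>A\<close> on the corresponding subspace
  splits off \<open>\<Sigma>\<close>. Every rank in the statement is the dimension of a column space, counted along
  such chains.\<close>

section \<open>Right linear algebra over a division ring\<close>

text \<open>Three subspaces generate a lattice that is modular but not distributive, and this shapes
  the proof: \<open>U \<inter> (V + W)\<close> may exceed
  \<open>U \<inter> V + U \<inter> W\<close>, and then no basis of the whole space contains bases of
  all three. The defect appears once inside each subspace, always with dimension m4. Writing u = v +
  w with u in U, v in V, w in W couples the three appearances: if u and -v are basis vectors, then w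
  is their sum. This is the origin of the two identity blocks in one block column of
  \<open>form_D\<close>, and of the two block rows of size m4. The other constraint is that P also
  acts on A, from both sides. Once B, C, D are reduced, left factors whose leading r columns are
  those of the identity, r being the rank of (B, C, D), leave them alone; this is the freedom spent
  on A. Multiplication does not commute, so scalars act on the right of vectors and matrices on the
  left.\<close>

definition scl :: "(nat \<Rightarrow> 'k::division_ring) \<Rightarrow> 'k \<Rightarrow> nat \<Rightarrow> 'k" where
  "scl x c = (\<lambda>k. x k * c)"

definition lincomb :: "'i set \<Rightarrow> ('i \<Rightarrow> nat \<Rightarrow> 'k::division_ring) \<Rightarrow> ('i \<Rightarrow> 'k) \<Rightarrow> nat \<Rightarrow> 'k" where
  "lincomb I b c = (\<Sum>i\<in>I. scl (b i) (c i))"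

definition rsubspace :: "(nat \<Rightarrow> 'k::division_ring) set \<Rightarrow> bool" where
  "rsubspace V \<longleftrightarrow> 0 \<in> V \<and> (\<forall>x\<in>V. \<forall>y\<in>V. x + y \<in> V) \<and> (\<forall>x\<in>V. \<forall>c. scl x c \<in> V)"

text \<open>Vectors of every length share the type of functions on the naturals; having length
  \<open>n\<close> means vanishing from index \<open>n\<close> on. Spaces of different dimensions
  can thus be compared and stacked without casts.\<close>

definition coord_space :: "nat \<Rightarrow> (nat \<Rightarrow> 'k::division_ring) set" where
  "coord_space n = {x. \<forall>i\<ge>n. x i = 0}"

text \<open>The family \<open>b\<close> represents a basis of the quotient \<open>Y / X\<close>.\<close>

definition rel_basis ::
  "(nat \<Rightarrow> 'k::division_ring) set \<Rightarrow> (nat \<Rightarrow> 'k) set \<Rightarrow> 'i set \<Rightarrow> ('i \<Rightarrow> nat \<Rightarrow> 'k) \<Rightarrow> bool" where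
  "rel_basis X Y I b \<longleftrightarrow> finite I \<and> b ` I \<subseteq> Y \<and> (\<forall>y\<in>Y. \<exists>c. y - lincomb I b c \<in> X)
     \<and> (\<forall>c. lincomb I b c \<in> X \<longrightarrow> (\<forall>i\<in>I. c i = 0))"

lemma rel_basis_finite: "rel_basis X Y I b \<Longrightarrow> finite I"
  and rel_basis_subset: "rel_basis X Y I b \<Longrightarrow> b ` I \<subseteq> Y"
  and rel_basis_mem: "rel_basis X Y I b \<Longrightarrow> i \<in> I \<Longrightarrow> b i \<in> Y"
  and rel_basis_span: "rel_basis X Y I b \<Longrightarrow> y \<in> Y \<Longrightarrow> \<exists>c. y - lincomb I b c \<in> X"
  and rel_basis_indep: "rel_basis X Y I b \<Longrightarrow> lincomb I b c \<in> X \<Longrightarrow> i \<in> I \<Longrightarrow> c i = 0"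
  by (auto simp: rel_basis_def)

lemma sum_fun_apply: "(\<Sum>i\<in>I. f i) k = (\<Sum>i\<in>I. f i k)"
  by (induction I rule: infinite_finite_induct) auto

lemma scl_apply [simp]: "scl x c k = x k * c"
  by (simp add: scl_def)

lemma lincomb_apply: "lincomb I b c k = (\<Sum>i\<in>I. b i k * c i)"
  by (simp add: lincomb_def sum_fun_apply)

lemma rsubspace_0: "rsubspace V \<Longrightarrow> 0 \<in> V"
  and rsubspace_add: "rsubspace V \<Longrightarrow> x \<in> V \<Longrightarrow> y \<in> V \<Longrightarrow> x + y \<in> V"
  and rsubspace_scl: "rsubspace V \<Longrightarrow> x \<in> V \<Longrightarrow> scl x c \<in> V"
  by (auto simp: rsubspace_def)

lemma scl_minus_one: "scl x (- 1) = - x"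
  by (simp add: fun_eq_iff)

lemma rsubspace_neg: "rsubspace V \<Longrightarrow> x \<in> V \<Longrightarrow> - x \<in> V"
  by (metis scl_minus_one rsubspace_scl)

lemma rsubspace_diff: "rsubspace V \<Longrightarrow> x \<in> V \<Longrightarrow> y \<in> V \<Longrightarrow> x - y \<in> V"
  by (metis diff_conv_add_uminus rsubspace_add rsubspace_neg)

lemma rsubspace_sum: "rsubspace V \<Longrightarrow> (\<And>i. i \<in> I \<Longrightarrow> f i \<in> V) \<Longrightarrow> (\<Sum>i\<in>I. f i) \<in> V"
  by (induction I rule: infinite_finite_induct) (auto simp: rsubspace_0 rsubspace_add)

lemma rsubspace_lincomb: "rsubspace V \<Longrightarrow> b ` I \<subseteq> V \<Longrightarrow> lincomb I b c \<in> V"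
  unfolding lincomb_def by (intro rsubspace_sum rsubspace_scl) auto

lemma rsubspace_zero: "rsubspace {0}"
  by (auto simp: rsubspace_def fun_eq_iff)

lemma rsubspace_Int: "rsubspace U \<Longrightarrow> rsubspace V \<Longrightarrow> rsubspace (U \<inter> V)"
  by (auto simp: rsubspace_def)

lemma scl_add: "scl (x + y) c = scl x c + scl y c"
  by (simp add: fun_eq_iff algebra_simps)

lemma rsubspace_plus:
  assumes "rsubspace U" "rsubspace V"
  shows "rsubspace (U + V)"
  unfolding rsubspace_def
proof (intro conjI ballI allI)
  show "0 \<in> U + V"
    using set_plus_intro[OF assms[THEN rsubspace_0]] by simp
next
  fix x y assume "x \<in> U + V" "y \<in> U + V"
  then obtain u v u' v' where *: "x = u + v" "u \<in> U" "v \<in> V" "y = u' + v'" "u' \<in> U" "v' \<in> V"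
    by (elim set_plus_elim)
  then have "x + y = (u + u') + (v + v')"
    by (simp add: algebra_simps)
  also have "\<dots> \<in> U + V"
    using * assms by (intro set_plus_intro rsubspace_add)
  finally show "x + y \<in> U + V" .
next
  fix x c assume "x \<in> U + V"
  then show "scl x c \<in> U + V"
    by (elim set_plus_elim) (auto simp: scl_add intro!: set_plus_intro rsubspace_scl assms)
qed

lemma subset_plus_left: "rsubspace V \<Longrightarrow> U \<subseteq> U + V"
  by (metis add.right_neutral set_plus_intro subsetI rsubspace_0)

lemma subset_plus_right: "rsubspace U \<Longrightarrow> V \<subseteq> U + V"
  by (metis add.left_neutral set_plus_intro subsetI rsubspace_0)

lemma rsubspace_coord_space: "rsubspace (coord_space n)"
  by (auto simp: rsubspace_def coord_space_def)

lemma lincomb_zero_coeff: "(\<And>i. i \<in> I \<Longrightarrow> c i = 0) \<Longrightarrow> lincomb I b c = 0"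
  by (auto simp: lincomb_apply fun_eq_iff)

lemma lincomb_cong:
  "(\<And>i. i \<in> I \<Longrightarrow> b i = b' i) \<Longrightarrow> (\<And>i. i \<in> I \<Longrightarrow> c i = c' i) \<Longrightarrow> lincomb I b c = lincomb I b' c'"
  by (auto simp: lincomb_def intro: sum.cong)

lemma lincomb_Un:
  "finite I \<Longrightarrow> finite J \<Longrightarrow> I \<inter> J = {} \<Longrightarrow> lincomb (I \<union> J) b c = lincomb I b c + lincomb J b c"
  by (simp add: lincomb_def sum.union_disjoint)

lemma lincomb_insert:
  "finite I \<Longrightarrow> i \<notin> I \<Longrightarrow> lincomb (insert i I) b c = scl (b i) (c i) + lincomb I b c"
  by (simp add: lincomb_def)

lemma lincomb_reindex: "bij_betw f J I \<Longrightarrow> lincomb I b c = lincomb J (b \<circ> f) (c \<circ> f)"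
  unfolding lincomb_def by (simp add: sum.reindex_bij_betw[symmetric, of f J I])

text \<open>Gaussian elimination on the last coordinate: one vector that is nonzero there clears it
  from all others, which then lie in a space of dimension one less. A dependency among the cleared
  vectors unfolds to one among the original vectors.\<close>

lemma more_vectors_than_dimension_dependent:
  fixes b :: "'i \<Rightarrow> nat \<Rightarrow> 'k::division_ring"
  assumes "finite I" "card I > n" "b ` I \<subseteq> coord_space n"
  shows "\<exists>c. lincomb I b c = 0 \<and> (\<exists>i\<in>I. c i \<noteq> 0)"
  using assms
proof (induction n arbitrary: I b)
  case 0
  then obtain i where i: "i \<in> I" by fastforce
  have "lincomb I b (\<lambda>_. 1) = 0"
    using 0 by (auto simp: lincomb_apply fun_eq_iff coord_space_def image_subset_iff)
  then show ?case using i by (intro exI[of _ "\<lambda>_. 1"]) auto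
next
  case (Suc n)
  show ?case
  proof (cases "\<forall>i\<in>I. b i n = 0")
    case True
    then have "b ` I \<subseteq> coord_space n"
      using Suc.prems(3) by (auto simp: coord_space_def image_subset_iff) (metis le_antisym not_less_eq_eq)
    then show ?thesis using Suc.IH[of I b] Suc.prems by simp
  next
    case False
    then obtain i0 where i0: "i0 \<in> I" "b i0 n \<noteq> 0" by auto
    \<comment> \<open>Scalars act on the right, so the inverse must stand to the left of
      \<open>b i n\<close> in order to cancel against \<open>b i0 n\<close>.\<close>
    define a where "a i = inverse (b i0 n) * b i n" for i
    define b' where "b' i = b i - scl (b i0) (a i)" for i
    have "b' i \<in> coord_space n" if "i \<in> I" for i
      unfolding coord_space_def
    proof safe
      fix k assume "n \<le> k"
      show "b' i k = 0"
      proof (cases "k = n")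
        case True
        then show ?thesis using i0 by (simp add: b'_def a_def mult.assoc[symmetric])
      next
        case False
        then have "b i k = 0" "b i0 k = 0"
          using Suc.prems(3) that i0 \<open>n \<le> k\<close> by (auto simp: coord_space_def image_subset_iff)
        then show ?thesis by (simp add: b'_def)
      qed
    qed
    then have "b' ` (I - {i0}) \<subseteq> coord_space n" by auto
    moreover have "card (I - {i0}) > n" using Suc.prems i0 by auto
    ultimately obtain c where c: "lincomb (I - {i0}) b' c = 0" "\<exists>i\<in>I - {i0}. c i \<noteq> 0"
      using Suc.IH[of "I - {i0}" b'] Suc.prems(1) by blast
    \<comment> \<open>The coefficient of \<open>b i0\<close> collects the multiples that were
      subtracted in forming \<open>b'\<close>. The other coefficients are unchanged, so one of them
      stays nonzero.\<close>
    define c' where "c' i = (if i = i0 then - (\<Sum>i\<in>I - {i0}. a i * c i) else c i)" for i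
    have "lincomb I b c' = scl (b i0) (c' i0) + lincomb (I - {i0}) b c'"
      using lincomb_insert[of "I - {i0}" i0 b c'] Suc.prems(1) i0 by (simp add: insert_absorb)
    also have "lincomb (I - {i0}) b c' = lincomb (I - {i0}) b c"
      by (rule lincomb_cong) (auto simp: c'_def)
    also have "scl (b i0) (c' i0) + lincomb (I - {i0}) b c = lincomb (I - {i0}) b' c"
      by (auto simp: fun_eq_iff lincomb_apply c'_def b'_def algebra_simps sum_subtractf sum_distrib_left)
    finally have "lincomb I b c' = 0" using c by simp
    moreover have "\<exists>i\<in>I. c' i \<noteq> 0" using c by (auto simp: c'_def)
    ultimately show ?thesis by blast
  qed
qed

lemma independent_card_le:
  assumes "finite I" "b ` I \<subseteq> coord_space n"
    and "\<And>c. lincomb I b c = 0 \<Longrightarrow> \<forall>i\<in>I. c i = 0"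
  shows "card I \<le> n"
  using more_vectors_than_dimension_dependent[of I n b] assms by force

text \<open>A family in \<open>Y\<close> that is independent modulo \<open>X\<close> is independent
  outright, since 0 lies in \<open>X\<close>. Its size is therefore at most \<open>n\<close>, and a
  largest such family exists. Adjoining any \<open>y\<close> to it creates a relation modulo
  \<open>X\<close>, which can be solved for \<open>y\<close>.\<close>

lemma rel_basis_exists:
  fixes X Y :: "(nat \<Rightarrow> 'k::division_ring) set"
  assumes X: "rsubspace X" and Y: "Y \<subseteq> coord_space n"
  shows "\<exists>k b. rel_basis X Y {..<k::nat} b"
proof -
  define P where "P k \<longleftrightarrow> (\<exists>b. b ` {..<k::nat} \<subseteq> Y \<and>
     (\<forall>c. lincomb {..<k} b c \<in> X \<longrightarrow> (\<forall>i\<in>{..<k}. c i = 0)))" for k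
  have "P 0" by (simp add: P_def)
  moreover have bd: "k \<le> n" if Pk: "P k" for k
  proof -
    obtain b where b: "b ` {..<k} \<subseteq> Y" "\<And>c. lincomb {..<k} b c \<in> X \<Longrightarrow> \<forall>i\<in>{..<k}. c i = 0"
      using Pk by (auto simp: P_def)
    then have "card {..<k} \<le> n"
      using Y by (intro independent_card_le[of _ b]) (auto simp: rsubspace_0[OF X])
    then show ?thesis by simp
  qed
  ultimately obtain k where k: "P k" "\<And>j. P j \<Longrightarrow> j \<le> k"
    using Nat.ex_has_greatest_nat[of P 0 n] by auto
  then obtain b where b: "b ` {..<k} \<subseteq> Y" "\<And>c. lincomb {..<k} b c \<in> X \<Longrightarrow> \<forall>i\<in>{..<k}. c i = 0"
    by (auto simp: P_def)
  have "\<exists>c. y - lincomb {..<k} b c \<in> X" if y: "y \<in> Y" for y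
  proof -
    define b' where "b' = b(k := y)"
    have "b' ` {..<Suc k} \<subseteq> Y" using b y by (auto simp: b'_def lessThan_Suc)
    moreover have "\<not> P (Suc k)" using k(2) by fastforce
    ultimately obtain c i where c: "lincomb {..<Suc k} b' c \<in> X" "i < Suc k" "c i \<noteq> 0"
      unfolding P_def by (metis lessThan_iff)
    have split: "lincomb {..<Suc k} b' c = scl y (c k) + lincomb {..<k} b c"
      unfolding lessThan_Suc
      by (subst lincomb_insert) (auto simp: b'_def intro!: lincomb_cong)
    \<comment> \<open>Otherwise the relation would involve only the old family, and all its
      coefficients would vanish.\<close>
    have "c k \<noteq> 0"
    proof
      assume "c k = 0"
      then have "lincomb {..<k} b c \<in> X" using c split by (simp add: scl_def zero_fun_def[symmetric])
      then show False using b(2) c \<open>c k = 0\<close> by (metis less_antisym lessThan_iff)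
    qed
    have "scl (lincomb {..<Suc k} b' c) (inverse (c k)) \<in> X"
      by (rule rsubspace_scl[OF X c(1)])
    also have "scl (lincomb {..<Suc k} b' c) (inverse (c k))
       = y - lincomb {..<k} b (\<lambda>i. - (c i * inverse (c k)))"
      using \<open>c k \<noteq> 0\<close>
      by (auto simp: split fun_eq_iff lincomb_apply algebra_simps sum_distrib_right sum_negf)
    finally show ?thesis by blast
  qed
  then show ?thesis unfolding rel_basis_def using b by blast
qed

text \<open>Both halves are restrictions of one function to disjoint index sets, so a chain of
  quotients is glued without renaming any vector.\<close>

lemma rel_basis_trans:
  assumes b1: "rel_basis X Y I b" and b2: "rel_basis Y Z J b" and IJ: "I \<inter> J = {}"
    and Y: "rsubspace Y" and sub: "X \<subseteq> Y" "Y \<subseteq> Z"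
  shows "rel_basis X Z (I \<union> J) b"
  unfolding rel_basis_def
proof (intro conjI allI ballI impI)
  note Un = lincomb_Un[OF rel_basis_finite[OF b1] rel_basis_finite[OF b2] IJ]
  show "finite (I \<union> J)" "b ` (I \<union> J) \<subseteq> Z"
    using rel_basis_finite[OF b1] rel_basis_finite[OF b2] rel_basis_subset[OF b1]
      rel_basis_subset[OF b2] sub by auto
  {
    fix z assume "z \<in> Z"
    then obtain c where c: "z - lincomb J b c \<in> Y" using rel_basis_span[OF b2] by blast
    then obtain d where d: "z - lincomb J b c - lincomb I b d \<in> X"
      using rel_basis_span[OF b1] by blast
    have "lincomb (I \<union> J) b (\<lambda>i. if i \<in> I then d i else c i) = lincomb I b d + lincomb J b c"
      unfolding Un using IJ by (intro arg_cong2[where f = plus] lincomb_cong) auto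
    then have "z - lincomb (I \<union> J) b (\<lambda>i. if i \<in> I then d i else c i) \<in> X"
      using d by (simp add: algebra_simps)
    then show "\<exists>c. z - lincomb (I \<union> J) b c \<in> X" by blast
  }
  {
    fix c i assume c: "lincomb (I \<union> J) b c \<in> X" and i: "i \<in> I \<union> J"
    have "lincomb (I \<union> J) b c - lincomb I b c \<in> Y"
      using c sub by (intro rsubspace_diff[OF Y] rsubspace_lincomb[OF Y rel_basis_subset[OF b1]]) auto
    then have "lincomb J b c \<in> Y" by (simp add: Un)
    then have J: "\<And>i. i \<in> J \<Longrightarrow> c i = 0" using rel_basis_indep[OF b2] by simp
    then have "lincomb I b c \<in> X" using c by (simp add: Un lincomb_zero_coeff)
    then show "c i = 0" using rel_basis_indep[OF b1] i J by blast
  }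
qed

text \<open>The second isomorphism theorem, \<open>Y / (X \<inter> Y)\<close> against
  \<open>(X + Y) / X\<close>, on representatives: the same vectors serve both quotients. This lets
  one block of vectors take part in several chains.\<close>

lemma rel_basis_plus:
  assumes b: "rel_basis (X \<inter> Y) Y I b" and X: "rsubspace X" and Y: "rsubspace Y"
  shows "rel_basis X (X + Y) I b"
  unfolding rel_basis_def
proof (intro conjI allI ballI impI)
  show "finite I" "b ` I \<subseteq> X + Y"
    using rel_basis_finite[OF b] rel_basis_subset[OF b] subset_plus_right[OF X, of Y] by auto
  show "c i = 0" if "lincomb I b c \<in> X" "i \<in> I" for c i
    using that rel_basis_indep[OF b, of c i] rsubspace_lincomb[OF Y rel_basis_subset[OF b], of c] by simp
  fix z assume "z \<in> X + Y"
  then obtain x y where z: "z = x + y" "x \<in> X" "y \<in> Y" by (elim set_plus_elim)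
  then obtain c where "y - lincomb I b c \<in> X" using rel_basis_span[OF b] by blast
  then have "x + (y - lincomb I b c) \<in> X" using z X by (simp add: rsubspace_add)
  then have "z - lincomb I b c \<in> X" by (simp add: z algebra_simps)
  then show "\<exists>c. z - lincomb I b c \<in> X" by blast
qed

lemma rel_basis_reindex:
  assumes b: "rel_basis X Y I b" and f: "bij_betw f J I"
  shows "rel_basis X Y J (b \<circ> f)"
  unfolding rel_basis_def
proof (intro conjI allI ballI impI)
  show "finite J" using rel_basis_finite[OF b] f by (simp add: bij_betw_finite)
  show "(b \<circ> f) ` J \<subseteq> Y" using rel_basis_subset[OF b] f by (auto simp: bij_betw_def)
  show "\<exists>c. y - lincomb J (b \<circ> f) c \<in> X" if "y \<in> Y" for y
    using rel_basis_span[OF b that] unfolding lincomb_reindex[OF f, of b] by blast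
  fix c j assume c: "lincomb J (b \<circ> f) c \<in> X" and j: "j \<in> J"
  have "lincomb I b (c \<circ> the_inv_into J f) = lincomb J (b \<circ> f) c"
    unfolding lincomb_reindex[OF f] using f
    by (intro lincomb_cong) (auto simp: bij_betw_def the_inv_into_f_f)
  then have "(c \<circ> the_inv_into J f) (f j) = 0"
    using rel_basis_indep[OF b, of "c \<circ> the_inv_into J f"] c f j by (auto simp: bij_betw_def)
  then show "c j = 0" using f j by (simp add: bij_betw_def the_inv_into_f_f)
qed

lemma rel_basis_cong:
  assumes "rel_basis X Y I b" "\<And>i. i \<in> I \<Longrightarrow> b i = b' i"
  shows "rel_basis X Y I b'"
proof -
  have "lincomb I b c = lincomb I b' c" for c by (intro lincomb_cong) (auto simp: assms)
  then show ?thesis using assms unfolding rel_basis_def by (auto simp: image_subset_iff)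
qed

text \<open>Coordinates with respect to the basis turn the independent family into independent
  vectors of \<open>coord_space (card I)\<close>, to which the bound on independent families
  applies.\<close>

lemma basis_card_le:
  assumes I: "rel_basis {0} Y I b" and J: "finite J" "d ` J \<subseteq> Y"
    and ind: "\<And>c. lincomb J d c = 0 \<Longrightarrow> \<forall>j\<in>J. c j = 0"
  shows "card J \<le> card I"
proof -
  obtain f where f: "bij_betw f {..<card I} I"
    using I by (metis ex_bij_betw_nat_finite lessThan_atLeast0 rel_basis_def)
  note B = rel_basis_reindex[OF I f]
  let ?n = "card I" and ?b = "b \<circ> f"
  have "\<forall>j\<in>J. \<exists>c. d j = lincomb {..<?n} ?b c"
    using rel_basis_span[OF B] J by fastforce
  then obtain a where a: "\<And>j. j \<in> J \<Longrightarrow> d j = lincomb {..<?n} ?b (a j)" by metis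
  \<comment> \<open>The coefficients obtained from spanning are arbitrary outside the index range.
    Cutting them to zero there puts the coordinate vectors into \<open>coord_space\<close>.\<close>
  define a' where "a' j = (\<lambda>k. if k < ?n then a j k else 0)" for j
  have d: "d j = lincomb {..<?n} ?b (a' j)" if "j \<in> J" for j
    unfolding a[OF that] by (intro lincomb_cong) (auto simp: a'_def)
  show ?thesis
  proof (rule independent_card_le[of J a'])
    show "finite J" by fact
    show "a' ` J \<subseteq> coord_space (card I)" by (auto simp: a'_def coord_space_def)
    fix c assume c: "lincomb J a' c = 0"
    have "lincomb J d c k = (\<Sum>i<?n. ?b i k * lincomb J a' c i)" for k
    proof -
      have "lincomb J d c k = (\<Sum>j\<in>J. \<Sum>i<?n. ?b i k * (a' j i * c j))"
        unfolding lincomb_apply[of J]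
        by (intro sum.cong) (auto simp: d lincomb_apply sum_distrib_right mult.assoc)
      also have "\<dots> = (\<Sum>i<?n. ?b i k * lincomb J a' c i)"
        by (subst sum.swap) (simp add: lincomb_apply sum_distrib_left)
      finally show ?thesis .
    qed
    then have "lincomb J d c = 0" by (simp add: c fun_eq_iff)
    then show "\<forall>i\<in>J. c i = 0" by (rule ind)
  qed
qed

section \<open>Matrices and column spaces\<close>

lemma range_lincomb_insert:
  assumes "finite G" "g \<notin> G"
  shows "range (lincomb (insert g G) d) = range (lincomb G d) + range (scl (d g))"
proof (intro equalityI subsetI)
  fix x assume "x \<in> range (lincomb (insert g G) d)"
  then obtain c where "x = lincomb (insert g G) d c" by blast
  then have "x = lincomb G d c + scl (d g) (c g)"
    using lincomb_insert[OF assms, of d c] by (simp add: add.commute)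
  then show "x \<in> range (lincomb G d) + range (scl (d g))" by blast
next
  fix x assume "x \<in> range (lincomb G d) + range (scl (d g))"
  then obtain c a where x: "x = lincomb G d c + scl (d g) a" by (auto elim!: set_plus_elim)
  have "lincomb (insert g G) d (c(g := a)) = scl (d g) a + lincomb G d (c(g := a))"
    by (simp add: lincomb_insert[OF assms])
  also have "lincomb G d (c(g := a)) = lincomb G d c"
    using assms by (intro lincomb_cong) auto
  finally show "x \<in> range (lincomb (insert g G) d)"
    unfolding x by (metis add.commute rangeI)
qed

lemma rsubspace_range_lincomb: "rsubspace (range (lincomb I b))"
  unfolding rsubspace_def
proof (intro conjI ballI allI)
  show "0 \<in> range (lincomb I b)"
    using lincomb_zero_coeff[of I "\<lambda>_. 0" b] by (metis rangeI)
next
  fix x y assume "x \<in> range (lincomb I b)" "y \<in> range (lincomb I b)"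
  then obtain c d where "x = lincomb I b c" "y = lincomb I b d" by blast
  then have "x + y = lincomb I b (\<lambda>i. c i + d i)"
    by (auto simp: lincomb_apply fun_eq_iff algebra_simps sum.distrib)
  then show "x + y \<in> range (lincomb I b)" by blast
next
  fix x a assume "x \<in> range (lincomb I b)"
  then obtain c where "x = lincomb I b c" by blast
  then have "scl x a = lincomb I b (\<lambda>i. c i * a)"
    by (auto simp: lincomb_apply fun_eq_iff sum_distrib_right mult.assoc)
  then show "scl x a \<in> range (lincomb I b)" by blast
qed

lemma rsubspace_range_scl: "rsubspace (range (scl x))"
proof -
  have "range (scl x) = range (lincomb {()} (\<lambda>_. x))"
    by (auto simp: lincomb_def image_iff)
  then show ?thesis using rsubspace_range_lincomb by metis
qed

text \<open>\<open>qrank\<close> speaks of sets of column indices, so a basis of a column space has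
  to be found among the generators themselves: a new generator is dropped if it lies in the span so
  far and is kept otherwise.\<close>

lemma basis_subfamily:
  assumes "finite G"
  shows "\<exists>J\<subseteq>G. rel_basis {0} (range (lincomb G d)) J d"
  using assms
proof (induction G)
  case empty
  then show ?case by (auto simp: rel_basis_def lincomb_def)
next
  case (insert g G)
  let ?Y = "range (lincomb G d)" and ?L = "range (scl (d g))"
  obtain J where J: "J \<subseteq> G" "rel_basis {0} ?Y J d" using insert.IH by blast
  note sY = rsubspace_range_lincomb[of G d]
  have rng: "range (lincomb (insert g G) d) = ?Y + ?L"
    using insert.hyps by (rule range_lincomb_insert)
  show "\<exists>J\<subseteq>insert g G. rel_basis {0} (range (lincomb (insert g G) d)) J d"
  proof (cases "d g \<in> ?Y")
    case True
    have "?L \<subseteq> ?Y" using rsubspace_scl[OF sY True] by auto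
    have "?Y + ?L \<subseteq> ?Y"
    proof
      fix v assume "v \<in> ?Y + ?L"
      then obtain x y where "v = x + y" "x \<in> ?Y" "y \<in> ?L" by (elim set_plus_elim)
      then show "v \<in> ?Y" using \<open>?L \<subseteq> ?Y\<close> rsubspace_add[OF sY] by blast
    qed
    then have "?Y + ?L = ?Y" using subset_plus_left[OF rsubspace_range_scl] by blast
    then show ?thesis using J by (intro exI[of _ J]) (simp add: rng subset_insertI2)
  next
    case False
    have lg: "lincomb {g} d c = scl (d g) (c g)" for c by (simp add: lincomb_def)
    have "rel_basis (?Y \<inter> ?L) ?L {g} d"
      unfolding rel_basis_def
    proof (intro conjI allI ballI impI)
      show "finite {g}" by simp
      have "d g = scl (d g) 1" by (simp add: fun_eq_iff)
      then show "d ` {g} \<subseteq> ?L" by auto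
      show "\<exists>c. y - lincomb {g} d c \<in> ?Y \<inter> ?L" if "y \<in> ?L" for y
      proof -
        obtain a where "y = scl (d g) a" using \<open>y \<in> ?L\<close> by blast
        then have "y - lincomb {g} d (\<lambda>_. a) = 0" by (simp add: lg)
        then show ?thesis using sY rsubspace_range_scl by (metis IntI rsubspace_0)
      qed
      fix c i assume c: "lincomb {g} d c \<in> ?Y \<inter> ?L" "i \<in> {g}"
      show "c i = 0"
      proof (rule ccontr)
        assume "c i \<noteq> 0"
        then have "scl (scl (d g) (c g)) (inverse (c g)) = d g"
          using c by (auto simp: fun_eq_iff mult.assoc)
        moreover have "scl (scl (d g) (c g)) (inverse (c g)) \<in> ?Y"
          using c by (simp add: lg rsubspace_scl[OF sY])
        ultimately show False using False by argo
      qed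
    qed
    then have "rel_basis ?Y (?Y + ?L) {g} d"
      by (rule rel_basis_plus[OF _ sY rsubspace_range_scl])
    then have "rel_basis {0} (?Y + ?L) (J \<union> {g}) d"
      using J insert.hyps by (intro rel_basis_trans[OF J(2)])
        (auto simp: sY rsubspace_0 subset_plus_left[OF rsubspace_range_scl, THEN subsetD])
    then show ?thesis using J by (intro exI[of _ "J \<union> {g}"]) (auto simp: rng)
  qed
qed

section \<open>Matrices as right linear maps, and their ranks\<close>

definition column :: "'k::division_ring mat \<Rightarrow> nat \<Rightarrow> nat \<Rightarrow> 'k" where
  "column M j = (\<lambda>i. if i < dim_row M then M $$ (i, j) else 0)"

text \<open>The product of a matrix with a vector, written as a right combination of columns, so
  that the column space is literally a range of \<open>lincomb\<close>. Entries of the argument from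
  \<open>dim_col M\<close> on are ignored.\<close>

definition mat_app :: "'k::division_ring mat \<Rightarrow> (nat \<Rightarrow> 'k) \<Rightarrow> nat \<Rightarrow> 'k" where
  "mat_app M = lincomb {..<dim_col M} (column M)"

definition col_space :: "'k::division_ring mat \<Rightarrow> (nat \<Rightarrow> 'k) set" where
  "col_space M = range (mat_app M)"

definition mat_of_family :: "nat \<Rightarrow> nat \<Rightarrow> (nat \<Rightarrow> nat \<Rightarrow> 'k) \<Rightarrow> 'k mat" where
  "mat_of_family m n b = mat m n (\<lambda>(i, j). b j i)"

definition unit_fun :: "nat \<Rightarrow> nat \<Rightarrow> 'k::division_ring" where
  "unit_fun j = (\<lambda>i. if i = j then 1 else 0)"

lemma mat_app_apply:
  "mat_app M x i = (if i < dim_row M then \<Sum>j<dim_col M. M $$ (i, j) * x j else 0)"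
  by (simp add: mat_app_def lincomb_apply column_def)

lemma mat_app_in_coord_space: "mat_app M x \<in> coord_space (dim_row M)"
  by (simp add: mat_app_apply coord_space_def)

lemma rsubspace_col_space: "rsubspace (col_space M)"
  by (simp add: col_space_def mat_app_def rsubspace_range_lincomb)

lemma col_space_subset: "M \<in> carrier_mat m n \<Longrightarrow> col_space M \<subseteq> coord_space m"
  using mat_app_in_coord_space[of M] by (auto simp: col_space_def)

lemma mat_app_diff: "mat_app M (x - y) = mat_app M x - mat_app M y"
  by (simp add: mat_app_apply fun_eq_iff algebra_simps sum_subtractf)

lemma mat_app_add: "mat_app M (x + y) = mat_app M x + mat_app M y"
  by (simp add: mat_app_apply fun_eq_iff algebra_simps sum.distrib)

lemma mat_app_zero: "mat_app M 0 = 0"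
  by (simp add: mat_app_apply fun_eq_iff)

lemma mat_app_scl: "mat_app M (scl x c) = scl (mat_app M x) c"
  by (simp add: mat_app_apply fun_eq_iff sum_distrib_right mult.assoc)

lemma mat_app_lincomb: "mat_app M (lincomb I b c) = lincomb I (\<lambda>i. mat_app M (b i)) c"
  unfolding lincomb_def
  by (induction I rule: infinite_finite_induct)
    (simp_all only: sum.infinite sum.empty sum.insert mat_app_zero mat_app_add mat_app_scl not_False_eq_True)

lemma mat_app_cong:
  "(\<And>i. i < dim_col M \<Longrightarrow> x i = y i) \<Longrightarrow> mat_app M x = mat_app M y"
  unfolding mat_app_def by (rule lincomb_cong) auto

lemma sum_unit_fun:
  assumes "j < n"
  shows "(\<Sum>k<n. f k * unit_fun j k) = f j" "(\<Sum>k<n. unit_fun k j * f k) = f j"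
proof -
  have "(\<Sum>k\<in>{..<n} - {j}. f k * unit_fun j k) = 0" "(\<Sum>k\<in>{..<n} - {j}. unit_fun k j * f k) = 0"
    by (intro sum.neutral; auto simp: unit_fun_def)+
  then show "(\<Sum>k<n. f k * unit_fun j k) = f j" "(\<Sum>k<n. unit_fun k j * f k) = f j"
    using assms by (simp_all add: sum.remove[of _ j] unit_fun_def)
qed

lemma mat_app_unit_fun: "j < dim_col M \<Longrightarrow> mat_app M (unit_fun j) = column M j"
  by (auto simp: mat_app_apply column_def fun_eq_iff sum_unit_fun)

lemma column_mult:
  "M \<in> carrier_mat m n \<Longrightarrow> N \<in> carrier_mat n p \<Longrightarrow> j < p \<Longrightarrow>
    column (M * N) j = mat_app M (column N j)"
  by (auto simp: column_def mat_app_apply fun_eq_iff scalar_prod_def lessThan_atLeast0)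

lemma mat_app_mult:
  assumes "M \<in> carrier_mat m n" "N \<in> carrier_mat n p"
  shows "mat_app (M * N) x = mat_app M (mat_app N x)"
proof -
  have "mat_app (M * N) x = lincomb {..<p} (column (M * N)) x"
    using assms by (simp add: mat_app_def)
  also have "\<dots> = lincomb {..<p} (\<lambda>j. mat_app M (column N j)) x"
    by (rule lincomb_cong) (simp_all add: column_mult[OF assms])
  also have "\<dots> = mat_app M (mat_app N x)"
    using assms by (simp add: mat_app_lincomb[symmetric] mat_app_def[of N])
  finally show ?thesis .
qed

lemma mat_app_one:
  assumes "x \<in> coord_space n"
  shows "mat_app (1\<^sub>m n) x = x"
proof
  fix i
  have "(\<Sum>j<n. 1\<^sub>m n $$ (i, j) * x j) = (\<Sum>j<n. unit_fun j i * x j)" if "i < n"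
    using that by (intro sum.cong) (auto simp: unit_fun_def)
  then show "mat_app (1\<^sub>m n) x i = x i"
    using assms by (auto simp: mat_app_apply sum_unit_fun coord_space_def)
qed

lemma eq_mat_columnI:
  assumes "M \<in> carrier_mat m n" "N \<in> carrier_mat m n" "\<And>j. j < n \<Longrightarrow> column M j = column N j"
  shows "M = N"
proof (rule eq_matI)
  fix i j assume "i < dim_row N" "j < dim_col N"
  then show "M $$ (i, j) = N $$ (i, j)"
    using assms(3)[of j] assms(1,2) by (auto simp: column_def fun_eq_iff) metis
qed (use assms in auto)

lemma mat_of_family_carrier [simp]: "mat_of_family m n b \<in> carrier_mat m n"
  by (simp add: mat_of_family_def)

lemma column_mat_of_family: "b j \<in> coord_space m \<Longrightarrow> j < n \<Longrightarrow> column (mat_of_family m n b) j = b j"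
  by (auto simp: column_def mat_of_family_def coord_space_def fun_eq_iff)

lemma mat_app_mat_of_family:
  "b ` {..<n} \<subseteq> coord_space m \<Longrightarrow> mat_app (mat_of_family m n b) x = lincomb {..<n} b x"
  unfolding mat_app_def
  by (rule lincomb_cong[THEN trans])
    (auto simp: column_mat_of_family image_subset_iff mat_of_family_def column_def
      coord_space_def fun_eq_iff)

lemma GL_intro: "M \<in> carrier_mat n n \<Longrightarrow> N \<in> carrier_mat n n \<Longrightarrow> M * N = 1\<^sub>m n \<Longrightarrow> N * M = 1\<^sub>m n \<Longrightarrow> M \<in> GL n"
  by (auto simp: GL_def invertible_mat_def inverts_mat_def)

text \<open>\<open>invertible_mat\<close> does not state the shape of the inverse; it is recovered
  from the dimensions of the two products.\<close>

lemma GL_inverse: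
  assumes "M \<in> GL n"
  obtains N where "M \<in> carrier_mat n n" "N \<in> carrier_mat n n" "M * N = 1\<^sub>m n" "N * M = 1\<^sub>m n"
proof -
  obtain N where M: "M \<in> carrier_mat n n" and N: "M * N = 1\<^sub>m n" "N * M = 1\<^sub>m (dim_row N)"
    using assms by (auto simp: GL_def invertible_mat_def inverts_mat_def)
  have "dim_row N = dim_col (N * M)" "dim_col N = n"
    using N by (metis index_one_mat(3), metis index_mult_mat(3) index_one_mat(3))
  then have "N \<in> carrier_mat n n" using M by auto
  then show thesis using that M N by auto
qed

lemma GL_mult:
  assumes "M \<in> GL n" "N \<in> GL n"
  shows "M * N \<in> GL n"
proof -
  obtain M' where M: "M \<in> carrier_mat n n" "M' \<in> carrier_mat n n" "M * M' = 1\<^sub>m n" "M' * M = 1\<^sub>m n"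
    using GL_inverse[OF assms(1)] .
  obtain N' where N: "N \<in> carrier_mat n n" "N' \<in> carrier_mat n n" "N * N' = 1\<^sub>m n" "N' * N = 1\<^sub>m n"
    using GL_inverse[OF assms(2)] .
  have "N * (N' * M') = M'" "M' * (M * N) = N"
    using M N by (simp_all add: assoc_mult_mat[symmetric, of _ n n _ n _ n])
  moreover have "M * N * (N' * M') = M * (N * (N' * M'))" "N' * M' * (M * N) = N' * (M' * (M * N))"
    using M N by (meson assoc_mult_mat mult_carrier_mat)+
  ultimately show ?thesis
    using M N by (intro GL_intro[of _ n "N' * M'"]) (auto simp: mult_carrier_mat[of _ n n _ n])
qed

lemma standard_basis: "rel_basis {0} (coord_space n) {..<n} unit_fun"
proof -
  have *: "lincomb {..<n} unit_fun c i = (if i < n then c i else 0)" for c :: "nat \<Rightarrow> 'a" and i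
    by (auto simp: lincomb_apply sum_unit_fun, auto simp: unit_fun_def)
  show ?thesis
    unfolding rel_basis_def
  proof (intro conjI allI ballI impI)
    show "(unit_fun :: nat \<Rightarrow> nat \<Rightarrow> 'a) ` {..<n} \<subseteq> coord_space n"
      by (auto simp: unit_fun_def coord_space_def)
    show "\<exists>c. y - lincomb {..<n} unit_fun c \<in> {0}" if "y \<in> coord_space n" for y :: "nat \<Rightarrow> 'a"
      using that by (intro exI[of _ y]) (auto simp: fun_eq_iff * coord_space_def)
    show "c i = 0" if "lincomb {..<n} unit_fun c \<in> {0}" "i \<in> {..<n}" for c :: "nat \<Rightarrow> 'a" and i
      using that *[of c i] by simp
  qed simp
qed

lemma basis_card_unique:
  assumes I: "rel_basis {0} Y I b" and J: "rel_basis {0} Y J d"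
  shows "card I = card J"
proof (rule antisym)
  show "card J \<le> card I"
    using rel_basis_indep[OF J]
    by (intro basis_card_le[OF I rel_basis_finite[OF J] rel_basis_subset[OF J]]) simp
  show "card I \<le> card J"
    using rel_basis_indep[OF I]
    by (intro basis_card_le[OF J rel_basis_finite[OF I] rel_basis_subset[OF I]]) simp
qed

lemma basis_coord_space_card: "rel_basis {0} (coord_space n) I b \<Longrightarrow> card I = n"
  using basis_card_unique[OF _ standard_basis] by fastforce

text \<open>The columns of the candidate inverse are the coordinates of the unit vectors in the
  basis, which gives a right inverse. That it is also a left inverse follows from independence: the
  matrix \<open>M\<close> acts injectively, and \<open>M * (N * M) = M\<close>.\<close>

lemma basis_matrix_invertible:
  fixes b :: "nat \<Rightarrow> nat \<Rightarrow> quat"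
  assumes b: "rel_basis {0} (coord_space n) {..<n} b"
  shows "mat_of_family n n b \<in> GL n"
proof -
  let ?M = "mat_of_family n n b"
  note sub = rel_basis_subset[OF b]
  have "\<forall>j. \<exists>c. j < n \<longrightarrow> unit_fun j = lincomb {..<n} b c"
    using rel_basis_span[OF b rel_basis_mem[OF standard_basis]] by simp
  then obtain c where c: "\<And>j. j < n \<Longrightarrow> unit_fun j = lincomb {..<n} b (c j)" by metis
  let ?N = "mat_of_family n n c"
  have cN: "column ?N j i = c j i" if "j < n" "i < n" for i j
    using that by (simp add: column_def mat_of_family_def)
  have MN: "?M * ?N = 1\<^sub>m n"
  proof (rule eq_mat_columnI[of _ n n])
    fix j assume "j < n"
    then have "column (?M * ?N) j = mat_app ?M (column ?N j)"
      by (intro column_mult[of _ n n _ n]) auto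
    also have "\<dots> = lincomb {..<n} b (column ?N j)" by (rule mat_app_mat_of_family[OF sub])
    also have "\<dots> = unit_fun j" unfolding c[OF \<open>j < n\<close>] using \<open>j < n\<close> by (intro lincomb_cong) (auto simp: cN)
    also have "\<dots> = column (1\<^sub>m n) j" using \<open>j < n\<close> by (auto simp: column_def unit_fun_def fun_eq_iff)
    finally show "column (?M * ?N) j = column (1\<^sub>m n) j" .
  qed (auto intro: mult_carrier_mat[of _ n n])
  have "?N * ?M = 1\<^sub>m n"
  proof (rule eq_mat_columnI[of _ n n])
    fix j assume j: "j < n"
    have "?M * (?N * ?M) = ?M"
      by (metis MN assoc_mult_mat left_mult_one_mat mat_of_family_carrier)
    then have "mat_app ?M (column (?N * ?M) j) = column ?M j"
      using column_mult[of ?M n n "?N * ?M" n j] j mult_carrier_mat[of ?N n n ?M n] by simp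
    then have "mat_app ?M (column (?N * ?M) j) - mat_app ?M (unit_fun j) = 0"
      using j by (simp add: mat_app_unit_fun mat_of_family_def)
    then have "lincomb {..<n} b (column (?N * ?M) j - unit_fun j) \<in> {0}"
      by (simp only: mat_app_mat_of_family[OF sub, symmetric] mat_app_diff singleton_iff)
    then have "column (?N * ?M) j i = unit_fun j i" if "i < n" for i
      using rel_basis_indep[OF b, of "column (?N * ?M) j - unit_fun j" i] that by simp
    then show "column (?N * ?M) j = column (1\<^sub>m n) j"
      using j by (auto simp: column_def unit_fun_def fun_eq_iff mat_of_family_def)
  qed (auto intro: mult_carrier_mat[of _ n n])
  with MN show ?thesis by (intro GL_intro) auto
qed

text \<open>Independent sets of columns cannot be larger than a basis of the column space, and a
  basis consisting of columns attains the bound. With this, a rank is found by exhibiting any basis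
  of the column space.\<close>

lemma qrank_eq_card:
  assumes I: "rel_basis {0} (col_space M) I b"
  shows "qrank M = card I"
  unfolding qrank_def
proof (rule Max_eqI)
  have ind: "right_indep_cols M J \<longleftrightarrow> (\<forall>c. lincomb J (column M) c = 0 \<longrightarrow> (\<forall>j\<in>J. c j = 0))" for J
    unfolding right_indep_cols_def
  proof (intro all_cong1 arg_cong2[where f = "(\<longrightarrow>)"] refl)
    fix c
    have "lincomb J (column M) c i = (if i < dim_row M then \<Sum>j\<in>J. M $$ (i, j) * c j else 0)" for i
      by (simp add: lincomb_apply column_def)
    then show "(\<forall>i<dim_row M. (\<Sum>j\<in>J. M $$ (i, j) * c j) = 0) = (lincomb J (column M) c = 0)"
      by (simp add: fun_eq_iff)
  qed
  have cs: "col_space M = range (lincomb {..<dim_col M} (column M))"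
    by (simp add: col_space_def mat_app_def)
  have cols: "column M j \<in> col_space M" if "j < dim_col M" for j
    using that mat_app_unit_fun[of j M] unfolding col_space_def by (metis rangeI)
  show "finite (card ` {J. J \<subseteq> {..<dim_col M} \<and> right_indep_cols M J})"
    by auto
  show "k \<le> card I" if "k \<in> card ` {J. J \<subseteq> {..<dim_col M} \<and> right_indep_cols M J}" for k
  proof -
    obtain J where J: "J \<subseteq> {..<dim_col M}" "right_indep_cols M J" "k = card J"
      using \<open>k \<in> _\<close> by auto
    show ?thesis unfolding J(3)
      using J cols by (intro basis_card_le[OF I, of _ "column M"]) (auto simp: ind intro: finite_subset)
  qed
  obtain J where J: "J \<subseteq> {..<dim_col M}" "rel_basis {0} (col_space M) J (column M)"
    using basis_subfamily[of "{..<dim_col M}" "column M"] by (auto simp: cs)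
  have "right_indep_cols M J" using rel_basis_indep[OF J(2)] by (auto simp: ind)
  then show "card I \<in> card ` {J. J \<subseteq> {..<dim_col M} \<and> right_indep_cols M J}"
    using J basis_card_unique[OF I J(2)] by auto
qed

lemma column_reduction:
  fixes B :: "quat mat"
  assumes B: "B \<in> carrier_mat m p" and x: "rel_basis {0} (col_space B) {..<r} x"
  obtains T where "T \<in> GL p" "r \<le> p"
    "\<And>j. j < p \<Longrightarrow> column (B * T) j = (if j < r then x j else 0)"
proof -
  have "\<exists>y. y \<in> coord_space p \<and> mat_app B y = x j" if j: "j < r" for j
  proof -
    obtain y where "mat_app B y = x j"
      using rel_basis_mem[OF x, of j] j by (auto simp: col_space_def)
    \<comment> \<open>Entries of a preimage from \<open>p\<close> on do not affect the product, so
      they may be set to zero to obtain a vector of length \<open>p\<close>.\<close>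
    then have "mat_app B (\<lambda>i. if i < p then y i else 0) = x j"
      using B mat_app_cong[of B "\<lambda>i. if i < p then y i else 0" y] by auto
    then show ?thesis by (intro exI[of _ "\<lambda>i. if i < p then y i else 0"]) (auto simp: coord_space_def)
  qed
  then obtain y where y: "\<And>j. j < r \<Longrightarrow> y j \<in> coord_space p" "\<And>j. j < r \<Longrightarrow> mat_app B (y j) = x j"
    by metis
  define K where "K = {z \<in> coord_space p. mat_app B z = 0}"
  have sK: "rsubspace K"
    unfolding rsubspace_def K_def using rsubspace_coord_space[of p]
    by (auto simp: mat_app_zero mat_app_add mat_app_scl rsubspace_def fun_eq_iff)
  obtain k z where z: "rel_basis {0} K {..<k::nat} z"
    using rel_basis_exists[OF rsubspace_zero, of K p] unfolding K_def by blast
  define w where "w j = (if j < r then y j else z (j - r))" for j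
  have "bij_betw (\<lambda>j. j - r) {r..<r + k} {..<k}"
    by (rule bij_betw_byWitness[of _ "\<lambda>j. j + r"]) auto
  from rel_basis_reindex[OF z this] have w1: "rel_basis {0} K {r..<r + k} w"
    by (rule rel_basis_cong) (auto simp: w_def)
  have w2: "rel_basis K (coord_space p) {..<r} w"
  proof (rule rel_basis_cong[of _ _ _ y])
    have lin: "mat_app B (lincomb {..<r} y c) = lincomb {..<r} x c" for c
      unfolding mat_app_lincomb by (rule lincomb_cong) (auto simp: y)
    show "rel_basis K (coord_space p) {..<r} y"
      unfolding rel_basis_def
    proof (intro conjI allI ballI impI)
      show sub: "y ` {..<r} \<subseteq> coord_space p" using y by auto
      show "\<exists>c. u - lincomb {..<r} y c \<in> K" if u: "u \<in> coord_space p" for u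
      proof -
        obtain c where "mat_app B u - lincomb {..<r} x c = 0"
          using rel_basis_span[OF x, of "mat_app B u"] by (auto simp: col_space_def)
        then have "u - lincomb {..<r} y c \<in> K"
          unfolding K_def using u sub
          by (auto simp: mat_app_diff lin intro!: rsubspace_diff rsubspace_lincomb rsubspace_coord_space)
        then show ?thesis by blast
      qed
      show "c i = 0" if "lincomb {..<r} y c \<in> K" "i \<in> {..<r}" for c i
        using that rel_basis_indep[OF x, of c i] by (simp add: K_def lin[symmetric])
    qed simp
  qed (auto simp: w_def)
  have "rel_basis {0} (coord_space p) ({r..<r + k} \<union> {..<r}) w"
    by (rule rel_basis_trans[OF w1 w2 _ sK]) (auto simp: rsubspace_0[OF sK], auto simp: K_def)
  moreover have un: "{r..<r + k} \<union> {..<r} = {..<r + k}" by auto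
  ultimately have w: "rel_basis {0} (coord_space p) {..<r + k} w" by simp
  \<comment> \<open>Comparing dimensions shows that preimages and kernel vectors together fill
    exactly \<open>p\<close> columns, so \<open>T\<close> is square.\<close>
  then have rk: "r + k = p" using basis_coord_space_card by fastforce
  let ?T = "mat_of_family p p w"
  show thesis
  proof (rule that[of ?T])
    show "?T \<in> GL p" using w rk by (intro basis_matrix_invertible) simp
    show "r \<le> p" using rk by simp
    fix j assume j: "j < p"
    have "column (B * ?T) j = mat_app B (column ?T j)"
      by (rule column_mult[OF B _ j]) simp
    also have "column ?T j = w j"
      using rel_basis_mem[OF w, of j] j rk by (intro column_mat_of_family) auto
    also have "mat_app B (w j) = (if j < r then x j else 0)"
      using y(2) rel_basis_mem[OF z, of "j - r"] j rk by (auto simp: w_def K_def)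
    finally show "column (B * ?T) j = (if j < r then x j else 0)" .
  qed
qed

section \<open>Three subspaces\<close>

text \<open>The index \<open>(k, i)\<close> names the \<open>i\<close>-th vector of block
  \<open>k\<close>. With pairs as indices, disjoint sets of block numbers give disjoint sets of
  vectors, and unions of blocks are again of this form.\<close>

definition block_index :: "(nat \<Rightarrow> nat) \<Rightarrow> nat set \<Rightarrow> (nat \<times> nat) set" where
  "block_index n K = (SIGMA k:K. {..<n k})"

text \<open>This provides the sign in block 6: with \<open>- v\<close> there, the sum of matching
  vectors in blocks 4 and 6 is \<open>u - v\<close>, which lies in the third subspace.\<close>

lemma rel_basis_neg:
  assumes b: "rel_basis X Y I b" and Y: "rsubspace Y"
  shows "rel_basis X Y I (\<lambda>i. - b i)"
  unfolding rel_basis_def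
proof (intro conjI allI ballI impI)
  have neg: "lincomb I (\<lambda>i. - b i) c = lincomb I b (\<lambda>i. - c i)" for c
    by (simp add: lincomb_apply fun_eq_iff)
  show "finite I" "(\<lambda>i. - b i) ` I \<subseteq> Y"
    using rel_basis_finite[OF b] rel_basis_mem[OF b] rsubspace_neg[OF Y] by auto
  show "\<exists>c. y - lincomb I (\<lambda>i. - b i) c \<in> X" if y: "y \<in> Y" for y
  proof -
    obtain c where "y - lincomb I b c \<in> X" using rel_basis_span[OF b y] by blast
    then have "y - lincomb I (\<lambda>i. - b i) (\<lambda>i. - c i) \<in> X" unfolding neg by simp
    then show ?thesis by blast
  qed
  show "c i = 0" if "lincomb I (\<lambda>i. - b i) c \<in> X" "i \<in> I" for c i
    using rel_basis_indep[OF b, of "\<lambda>i. - c i" i] that by (simp add: neg)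
qed

text \<open>The variant for counting dimensions: the two families may be unrelated and their index
  sets may overlap, which the disjoint sum of the index sets resolves.\<close>

lemma rel_basis_trans_Plus:
  assumes b: "rel_basis X Y I b" and d: "rel_basis Y Z J d"
    and "rsubspace Y" "X \<subseteq> Y" "Y \<subseteq> Z"
  shows "rel_basis X Z (I <+> J) (case_sum b d)"
proof -
  have I: "bij_betw projl (Inl ` I) I" and J: "bij_betw projr (Inr ` J) J"
    by (auto simp: bij_betw_def inj_on_def image_image)
  have "rel_basis X Y (Inl ` I) (case_sum b d)" "rel_basis Y Z (Inr ` J) (case_sum b d)"
    by (rule rel_basis_cong[OF rel_basis_reindex[OF b I]], force,
        rule rel_basis_cong[OF rel_basis_reindex[OF d J]], force)
  then show ?thesis
    unfolding Plus_def using assms(3-) by (intro rel_basis_trans) auto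
qed

lemma rel_basis_block:
  assumes "rel_basis X Y {..<n k} f" "\<And>i. i < n k \<Longrightarrow> f i = b (k, i)"
  shows "rel_basis X Y (block_index n {k}) b"
proof (rule rel_basis_cong[OF rel_basis_reindex[OF assms(1)]])
  show "bij_betw snd (block_index n {k}) {..<n k}"
    by (rule bij_betw_byWitness[of _ "Pair k"]) (auto simp: block_index_def)
qed (auto simp: block_index_def assms(2))

lemma rel_basis_block_trans:
  assumes "rel_basis X Y (block_index n K) b" "rel_basis Y Z (block_index n L) b"
    and "K \<inter> L = {}" "rsubspace Y" "X \<subseteq> Y" "Y \<subseteq> Z"
  shows "rel_basis X Z (block_index n (K \<union> L)) b"
proof -
  have "block_index n (K \<union> L) = block_index n K \<union> block_index n L"
    "block_index n K \<inter> block_index n L = {}"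
    using assms(3) by (auto simp: block_index_def)
  then show ?thesis using rel_basis_trans[OF assms(1,2) _ assms(4-6)] by simp
qed

lemma card_block_index: "finite K \<Longrightarrow> card (block_index n K) = (\<Sum>k\<in>K. n k)"
  by (simp add: block_index_def)

text \<open>The quotients \<open>U \<inter> (V + W) / (U \<inter> V + U \<inter> W)\<close> obtained by permuting the three
  subspaces are isomorphic: write \<open>u = v + w\<close> and send \<open>u\<close> to \<open>v\<close>.\<close>

lemma rel_basis_shift:
  assumes U: "rsubspace U" and V: "rsubspace V" and W: "rsubspace W"
    and u: "rel_basis (U \<inter> V + U \<inter> W) (U \<inter> (V + W)) I u"
    and v: "\<And>i. i \<in> I \<Longrightarrow> v i \<in> V" and w: "\<And>i. i \<in> I \<Longrightarrow> u i - v i \<in> W"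
  shows "rel_basis (U \<inter> V + V \<inter> W) (V \<inter> (U + W)) I v"
  unfolding rel_basis_def
proof (intro conjI allI ballI impI)
  have uU: "u ` I \<subseteq> U" and vV: "v ` I \<subseteq> V" and wW: "(\<lambda>i. u i - v i) ` I \<subseteq> W"
    using rel_basis_subset[OF u] v w by auto
  have lc: "lincomb I u c - lincomb I v c = lincomb I (\<lambda>i. u i - v i) c" for c
    by (simp add: lincomb_apply fun_eq_iff algebra_simps sum_subtractf)
  show "finite I" by (rule rel_basis_finite[OF u])
  show "v ` I \<subseteq> V \<inter> (U + W)"
  proof safe
    fix i assume i: "i \<in> I"
    have "u i + - (u i - v i) \<in> U + W"
      using uU i rsubspace_neg[OF W w[OF i]] by (intro set_plus_intro) auto
    then show "v i \<in> U + W" by simp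
  qed (rule v)
  {
    fix y assume y: "y \<in> V \<inter> (U + W)"
    then obtain x z where xz: "y = x + z" "x \<in> U" "z \<in> W" by (auto elim: set_plus_elim)
    have "y + - z \<in> V + W" using y xz rsubspace_neg[OF W] by (intro set_plus_intro) auto
    then have "x \<in> U \<inter> (V + W)" using xz by simp
    then obtain c where "x - lincomb I u c \<in> U \<inter> V + U \<inter> W" using rel_basis_span[OF u] by blast
    then obtain p q where pq: "x - lincomb I u c = p + q" "p \<in> U" "p \<in> V" "q \<in> U" "q \<in> W"
      by (auto elim: set_plus_elim)
    \<comment> \<open>Once \<open>p\<close> is removed, the rest lies in \<open>V\<close> as a
      difference of elements of \<open>V\<close>, and in \<open>W\<close> because
      \<open>u i - v i\<close> does; so it belongs to \<open>V \<inter> W\<close>.\<close>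
    define s where "s = y - lincomb I v c - p"
    have "s = q + z + lincomb I (\<lambda>i. u i - v i) c"
      using pq(1) unfolding s_def lc[symmetric] xz(1) by (simp add: algebra_simps)
    then have "s \<in> W" using pq xz rsubspace_lincomb[OF W wW] by (simp add: rsubspace_add[OF W])
    moreover have "s \<in> V"
      unfolding s_def using y pq rsubspace_lincomb[OF V vV] by (simp add: rsubspace_diff[OF V])
    ultimately have "p + s \<in> U \<inter> V + V \<inter> W" using pq by (intro set_plus_intro) auto
    then have "y - lincomb I v c \<in> U \<inter> V + V \<inter> W" by (simp add: s_def)
    then show "\<exists>c. y - lincomb I v c \<in> U \<inter> V + V \<inter> W" by blast
  }
  {
    fix c i assume c: "lincomb I v c \<in> U \<inter> V + V \<inter> W" and i: "i \<in> I"
    then obtain p q where pq: "lincomb I v c = p + q" "p \<in> U" "p \<in> V" "q \<in> V" "q \<in> W"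
      by (auto elim: set_plus_elim)
    \<comment> \<open>The same argument with the roles exchanged: a relation for \<open>v\<close>
      becomes one for \<open>u\<close>, because the remainder lies in both \<open>U\<close> and
      \<open>W\<close>.\<close>
    define s where "s = lincomb I u c - p"
    have "s = lincomb I (\<lambda>i. u i - v i) c + q" using pq(1) by (simp add: s_def lc[symmetric] algebra_simps)
    then have "s \<in> W" using pq rsubspace_lincomb[OF W wW] by (simp add: rsubspace_add[OF W])
    moreover have "s \<in> U" unfolding s_def using pq rsubspace_lincomb[OF U uU] by (simp add: rsubspace_diff[OF U])
    ultimately have "p + s \<in> U \<inter> V + U \<inter> W" using pq by (intro set_plus_intro) auto
    then have "lincomb I u c \<in> U \<inter> V + U \<inter> W" by (simp add: s_def)
    then show "c i = 0" using rel_basis_indep[OF u] i by blast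
  }
qed

text \<open>The blocks are numbered as the block rows of the canonical form. Blocks 4 and 6 together
  carry the only indecomposable configuration of dimension two, three lines in a plane.\<close>

definition diag_family :: "(nat \<times> nat \<Rightarrow> nat \<Rightarrow> 'k::division_ring) \<Rightarrow> nat \<times> nat \<Rightarrow> nat \<Rightarrow> 'k" where
  "diag_family b = (\<lambda>(k, i). if k = 4 then b (4, i) + b (6, i) else b (k, i))"

lemma plus_subset: "rsubspace Z \<Longrightarrow> X \<subseteq> Z \<Longrightarrow> Y \<subseteq> Z \<Longrightarrow> X + Y \<subseteq> Z"
  by (auto elim!: set_plus_elim intro: rsubspace_add)

text \<open>Block 1 is a basis of the triple intersection; 2, 3, 7 complete it to
  \<open>U \<inter> V\<close>, \<open>U \<inter> W\<close>, \<open>V \<inter> W\<close>; 4 and 6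
  represent the distributivity defects inside \<open>U\<close> and \<open>V\<close>, and the sums of
  their matching vectors the defect inside \<open>W\<close>; 5, 8, 9 are what each subspace has
  beyond its intersection with the sum of the other two; 10 completes the sum to the whole space.
  The index sets for \<open>U\<close>, \<open>V\<close>, \<open>W\<close> are written in the order
  of the block columns of the reduced matrices. The other quotients serve the completion to a basis
  and the rank counts.\<close>

lemma three_subspaces_basis:
  fixes U V W :: "(nat \<Rightarrow> 'k::division_ring) set"
  assumes U: "rsubspace U" "U \<subseteq> coord_space m" and V: "rsubspace V" "V \<subseteq> coord_space m"
    and W: "rsubspace W" "W \<subseteq> coord_space m"
  obtains n b where "n 6 = n 4"
    "rel_basis {0} U (block_index n {1, 2, 3, 4, 5}) b"
    "rel_basis {0} V (block_index n {6, 7, 8, 1, 2}) b"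
    "rel_basis {0} W (block_index n {9, 4, 7, 3, 1}) (diag_family b)"
    "rel_basis U (U + V) (block_index n {6, 7, 8}) b"
    "rel_basis U (U + W) (block_index n {4, 7, 9}) (diag_family b)"
    "rel_basis V (V + W) (block_index n {3, 4, 9}) (diag_family b)"
    "rel_basis (U + V) (U + V + W) (block_index n {9}) b"
    "rel_basis (U + V + W) (coord_space m) (block_index n {10}) b"
    "rel_basis (U \<inter> V \<inter> W) W (block_index n {3, 4, 7, 9}) (diag_family b)"
proof -
  note [simp] = rsubspace_Int rsubspace_plus rsubspace_zero U(1) V(1) W(1)
  let ?E = "coord_space m :: (nat \<Rightarrow> 'k) set" and ?T = "U \<inter> V \<inter> W"
  have ex: "\<exists>k b. rel_basis X Y {..<k::nat} b" if "rsubspace X" "Y \<subseteq> ?E" for X Y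
    using rel_basis_exists that by blast
  obtain k1 f1 where f1: "rel_basis {0} ?T {..<k1::nat} f1" using ex[of "{0}" ?T] U by auto
  obtain k2 f2 where f2: "rel_basis ?T (U \<inter> V) {..<k2::nat} f2" using ex[of ?T "U \<inter> V"] U by auto
  obtain k3 f3 where f3: "rel_basis ?T (U \<inter> W) {..<k3::nat} f3" using ex[of ?T "U \<inter> W"] U by auto
  obtain k4 f4 where f4: "rel_basis (U \<inter> V + U \<inter> W) (U \<inter> (V + W)) {..<k4::nat} f4"
    using ex[of "U \<inter> V + U \<inter> W" "U \<inter> (V + W)"] U by auto
  obtain k5 f5 where f5: "rel_basis (U \<inter> (V + W)) U {..<k5::nat} f5"
    using ex[of "U \<inter> (V + W)" U] U by auto
  obtain k7 f7 where f7: "rel_basis ?T (V \<inter> W) {..<k7::nat} f7" using ex[of ?T "V \<inter> W"] V by auto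
  obtain k8 f8 where f8: "rel_basis (V \<inter> (U + W)) V {..<k8::nat} f8"
    using ex[of "V \<inter> (U + W)" V] V by auto
  obtain k9 f9 where f9: "rel_basis ((U + V) \<inter> W) W {..<k9::nat} f9"
    using ex[of "(U + V) \<inter> W" W] W by auto
  obtain k10 f10 where f10: "rel_basis (U + V + W) ?E {..<k10::nat} f10"
    using ex[of "U + V + W" ?E] by auto
  \<comment> \<open>A representative of the defect inside \<open>U\<close> lies in
    \<open>V + W\<close>. Fixing one splitting of each representative couples the three
    defects.\<close>
  have "\<exists>v. v \<in> V \<and> f4 i - v \<in> W" if "i < k4" for i
  proof -
    have "f4 i \<in> V + W" using rel_basis_mem[OF f4, of i] that by simp
    then obtain v w where "f4 i = v + w" "v \<in> V" "w \<in> W" by (elim set_plus_elim)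
    then show ?thesis by (intro exI[of _ v]) simp
  qed
  then obtain v where v: "\<And>i. i < k4 \<Longrightarrow> v i \<in> V" "\<And>i. i < k4 \<Longrightarrow> f4 i - v i \<in> W" by metis
  have fv: "rel_basis (U \<inter> V + V \<inter> W) (V \<inter> (U + W)) {..<k4} (\<lambda>i. - v i)"
    by (rule rel_basis_neg[OF rel_basis_shift[OF _ _ _ f4]]) (use v in auto)
  have fw: "rel_basis (U \<inter> W + W \<inter> V) (W \<inter> (U + V)) {..<k4} (\<lambda>i. f4 i - v i)"
    by (rule rel_basis_shift[of _ _ _ _ f4]) (use v f4 in \<open>auto simp: add.commute\<close>)

  \<comment> \<open>The leading 0 makes list positions agree with block numbers, which start at 1.
    Block 6 receives the size of block 4.\<close>
  define n where "n k = [0, k1, k2, k3, k4, k5, k4, k7, k8, k9, k10] ! k" for k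
  define b where "b = (\<lambda>(k, i). [0, f1 i, f2 i, f3 i, f4 i, f5 i, - v i, f7 i, f8 i, f9 i, f10 i] ! k)"
  let ?d = "diag_family b" and ?R = "\<lambda>X Y K. rel_basis X Y (block_index n K)"
  have n: "n (Suc 0) = k1" "n 2 = k2" "n 3 = k3" "n 4 = k4" "n 5 = k5" "n 6 = k4" "n 7 = k7" "n 8 = k8"
    "n 9 = k9" "n 10 = k10" by (simp_all add: n_def)
  have b1: "?R {0} ?T {1} b" "?R {0} ?T {1} ?d"
    by (rule rel_basis_block[of _ _ _ _ f1]; use f1 in \<open>simp add: n b_def diag_family_def\<close>)+
  have b2: "?R ?T (U \<inter> V) {2} b"
    by (rule rel_basis_block[of _ _ _ _ f2]; use f2 in \<open>simp add: n b_def diag_family_def\<close>)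
  have b3: "?R ?T (U \<inter> W) {3} b" "?R ?T (U \<inter> W) {3} ?d"
    by (rule rel_basis_block[of _ _ _ _ f3]; use f3 in \<open>simp add: n b_def diag_family_def\<close>)+
  have b4: "?R (U \<inter> V + U \<inter> W) (U \<inter> (V + W)) {4} b"
    by (rule rel_basis_block[of _ _ _ _ f4]; use f4 in \<open>simp add: n b_def diag_family_def\<close>)
  have d4: "?R (U \<inter> W + W \<inter> V) (W \<inter> (U + V)) {4} ?d"
    by (rule rel_basis_block[of _ _ _ _ "\<lambda>i. f4 i - v i"]; use fw in \<open>simp add: n b_def diag_family_def\<close>)
  have b5: "?R (U \<inter> (V + W)) U {5} b"
    by (rule rel_basis_block[of _ _ _ _ f5]; use f5 in \<open>simp add: n b_def diag_family_def\<close>)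
  have b6: "?R (U \<inter> V + V \<inter> W) (V \<inter> (U + W)) {6} b"
    by (rule rel_basis_block[of _ _ _ _ "\<lambda>i. - v i"]; use fv in \<open>simp add: n b_def diag_family_def\<close>)
  have b7: "?R ?T (V \<inter> W) {7} b" "?R ?T (V \<inter> W) {7} ?d"
    by (rule rel_basis_block[of _ _ _ _ f7]; use f7 in \<open>simp add: n b_def diag_family_def\<close>)+
  have b8: "?R (V \<inter> (U + W)) V {8} b"
    by (rule rel_basis_block[of _ _ _ _ f8]; use f8 in \<open>simp add: n b_def diag_family_def\<close>)
  have b9: "?R ((U + V) \<inter> W) W {9} b" "?R ((U + V) \<inter> W) W {9} ?d"
    by (rule rel_basis_block[of _ _ _ _ f9]; use f9 in \<open>simp add: n b_def diag_family_def\<close>)+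
  have b10: "?R (U + V + W) ?E {10} b"
    by (rule rel_basis_block[of _ _ _ _ f10]; use f10 in \<open>simp add: n b_def diag_family_def\<close>)

  have plus: "?R X (X + Y) K f" if "?R Z Y K f" "Z = X \<inter> Y" "rsubspace X" "rsubspace Y" for X Y Z K f
    using that by (auto intro: rel_basis_plus)
  \<comment> \<open>Blocks 3 and 7 were chosen modulo the triple intersection. As this is also the
    intersection of any two of the pairwise ones, they remain bases modulo a pairwise intersection,
    as each chain requires.\<close>
  have b3': "?R (U \<inter> V) (U \<inter> V + U \<inter> W) {3} b" by (rule plus[OF b3(1)]) auto
  have b7': "?R (U \<inter> V) (U \<inter> V + V \<inter> W) {7} b" by (rule plus[OF b7(1)]) auto
  have d7': "?R (U \<inter> W) (U \<inter> W + V \<inter> W) {7} ?d" by (rule plus[OF b7(2)]) auto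
  have d3': "?R (V \<inter> W) (V \<inter> W + U \<inter> W) {3} ?d" by (rule plus[OF b3(2)]) auto
  \<comment> \<open>The half of the distributive law that always holds; the gap to equality is
    filled by block 4, block 6 or the diagonal family, according to whether \<open>X\<close> is
    \<open>U\<close>, \<open>V\<close> or \<open>W\<close>.\<close>
  have sub: "X \<inter> Y + X \<inter> Z \<subseteq> X \<inter> (Y + Z)" if "rsubspace X" for X Y Z :: "(nat \<Rightarrow> 'k) set"
    using that by (auto elim!: set_plus_elim intro: rsubspace_add)
  note zero = rsubspace_0[OF U(1)] rsubspace_0[OF V(1)] rsubspace_0[OF W(1)]
  note tr = rel_basis_block_trans
  note pl = subset_plus_left subset_plus_right

  have T_UV: "?R {0} (U \<inter> V) {1, 2} b"
    using tr[OF b1(1) b2] zero by (auto simp: insert_commute)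
  have "?R (U \<inter> V + U \<inter> W) U {4, 5} b"
    using tr[OF b4 b5] sub[OF U(1), of V W] by (simp add: insert_commute)
  from tr[OF b3' this] have "?R (U \<inter> V) U {3, 4, 5} b"
    using pl(1)[of "U \<inter> W" "U \<inter> V"] plus_subset[OF U(1), of "U \<inter> V" "U \<inter> W"]
    by (simp add: insert_commute)
  from tr[OF T_UV this] have RU: "?R {0} U {1, 2, 3, 4, 5} b"
    using zero by (simp add: insert_commute)

  have "?R (U \<inter> V + V \<inter> W) V {6, 8} b"
    using tr[OF b6 b8] sub[OF V(1), of U W] by (simp add: Int_commute insert_commute)
  from tr[OF b7' this] have V_UV: "?R (U \<inter> V) V {6, 7, 8} b"
    using pl(1)[of "V \<inter> W" "U \<inter> V"] plus_subset[OF V(1), of "U \<inter> V" "V \<inter> W"]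
    by (simp add: insert_commute)
  from tr[OF T_UV this] have RV: "?R {0} V {6, 7, 8, 1, 2} b"
    using zero by (simp add: insert_commute)

  have WW: "W \<inter> (U + V) = (U + V) \<inter> W" "U \<inter> W + W \<inter> V = U \<inter> W + V \<inter> W"
    "V \<inter> W + U \<inter> W = U \<inter> W + V \<inter> W" by (auto simp: add.commute Int_commute)
  have W1: "?R (U \<inter> W + V \<inter> W) W {4, 9} ?d"
    using tr[OF d4[unfolded WW] b9(2)] sub[OF W(1), of U V] by (simp add: Int_commute insert_commute)
  have W2: "U \<inter> W + V \<inter> W \<subseteq> W" using plus_subset[OF W(1), of "U \<inter> W" "V \<inter> W"] by simp
  from tr[OF d7' W1] have W3: "?R (U \<inter> W) W {4, 7, 9} ?d"
    using pl(1)[of "V \<inter> W" "U \<inter> W"] W2 by (simp add: insert_commute)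
  from tr[OF d3'[unfolded WW] W1] have W4: "?R (V \<inter> W) W {3, 4, 9} ?d"
    using pl(2)[of "U \<inter> W" "V \<inter> W"] W2 by (simp add: insert_commute)
  have W5: "?R ?T W {3, 4, 7, 9} ?d"
    using tr[OF b3(2) W3] by (auto simp: insert_commute)
  from tr[OF b1(2) W5] have RW: "?R {0} W {9, 4, 7, 3, 1} ?d"
    using zero by (simp add: insert_commute)

  show thesis
  proof (rule that[of n b])
    show "?R U (U + V) {6, 7, 8} b" by (rule plus[OF V_UV]) auto
    show "?R U (U + W) {4, 7, 9} ?d" by (rule plus[OF W3]) auto
    show "?R V (V + W) {3, 4, 9} ?d" by (rule plus[OF W4]) auto
    show "?R (U + V) (U + V + W) {9} b" by (rule plus[OF b9(1)]) auto
  qed (use RU RV RW b10 W5 n in auto)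
qed

section \<open>The involution and Hermitian forms\<close>

text \<open>The scalar case of \<open>eta_star\<close>. For an imaginary unit it negates the
  \<eta>-coordinate and fixes the other three; it is an anti-automorphism of order two.\<close>

definition eta_conj :: "quat \<Rightarrow> quat \<Rightarrow> quat" where
  "eta_conj \<eta> x = - \<eta> * qcnj x * \<eta>"

lemma quat_sel [simp]:
  "qRe 0 = 0" "qI 0 = 0" "qJ 0 = 0" "qK 0 = 0" "qRe 1 = 1" "qI 1 = 0" "qJ 1 = 0" "qK 1 = 0"
  "qRe (x + y) = qRe x + qRe y" "qI (x + y) = qI x + qI y"
  "qJ (x + y) = qJ x + qJ y" "qK (x + y) = qK x + qK y"
  "qRe (- x) = - qRe x" "qI (- x) = - qI x" "qJ (- x) = - qJ x" "qK (- x) = - qK x"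
  "qRe (x * y) = qRe x * qRe y - qI x * qI y - qJ x * qJ y - qK x * qK y"
  "qI (x * y) = qRe x * qI y + qI x * qRe y + qJ x * qK y - qK x * qJ y"
  "qJ (x * y) = qRe x * qJ y - qI x * qK y + qJ x * qRe y + qK x * qI y"
  "qK (x * y) = qRe x * qK y + qI x * qJ y - qJ x * qI y + qK x * qRe y"
  "qRe (qcnj x) = qRe x" "qI (qcnj x) = - qI x" "qJ (qcnj x) = - qJ x" "qK (qcnj x) = - qK x"
  "qRe quat_i = 0" "qI quat_i = 1" "qJ quat_i = 0" "qK quat_i = 0"
  "qRe quat_j = 0" "qI quat_j = 0" "qJ quat_j = 1" "qK quat_j = 0"
  "qRe quat_k = 0" "qI quat_k = 0" "qJ quat_k = 0" "qK quat_k = 1"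
  by (simp_all add: zero_quat_def one_quat_def plus_quat_def uminus_quat_def times_quat_def
      qcnj_def quat_i_def quat_j_def quat_k_def)

locale quat_unit =
  fixes \<eta> :: quat
  assumes eta: "\<eta> \<in> {quat_i, quat_j, quat_k}"
begin

lemma eta_conj_eq:
  "eta_conj \<eta> x = Quat (qRe x) (if \<eta> = quat_i then - qI x else qI x)
     (if \<eta> = quat_j then - qJ x else qJ x) (if \<eta> = quat_k then - qK x else qK x)"
proof -
  have "\<eta> = quat_i \<or> \<eta> = quat_j \<or> \<eta> = quat_k" using eta by simp
  moreover have "quat_i \<noteq> quat_j" "quat_i \<noteq> quat_k" "quat_j \<noteq> quat_k"
    by (simp_all add: quat_i_def quat_j_def quat_k_def)
  ultimately show ?thesis by (elim disjE) (simp_all add: eta_conj_def quat_eq_iff)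
qed

lemma eta_conj_add: "eta_conj \<eta> (x + y) = eta_conj \<eta> x + eta_conj \<eta> y"
  by (simp add: eta_conj_eq quat_eq_iff)

lemma eta_conj_mult: "eta_conj \<eta> (x * y) = eta_conj \<eta> y * eta_conj \<eta> x"
proof -
  have "\<eta> = quat_i \<or> \<eta> = quat_j \<or> \<eta> = quat_k" using eta by simp
  moreover have "quat_i \<noteq> quat_j" "quat_i \<noteq> quat_k" "quat_j \<noteq> quat_k"
    by (simp_all add: quat_i_def quat_j_def quat_k_def)
  ultimately show ?thesis
    by (elim disjE) (simp_all add: eta_conj_eq quat_eq_iff mult.commute)
qed

lemma eta_conj_eta_conj [simp]: "eta_conj \<eta> (eta_conj \<eta> x) = x"
  and eta_conj_0 [simp]: "eta_conj \<eta> 0 = 0"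
  and eta_conj_1 [simp]: "eta_conj \<eta> 1 = 1"
  by (simp_all add: eta_conj_eq quat_eq_iff)

lemma eta_conj_sum: "eta_conj \<eta> (\<Sum>i\<in>I. f i) = (\<Sum>i\<in>I. eta_conj \<eta> (f i))"
  by (induction I rule: infinite_finite_induct) (auto simp: eta_conj_add)

lemma eta_star_dim [simp]: "dim_row (eta_star \<eta> M) = dim_col M" "dim_col (eta_star \<eta> M) = dim_row M"
  by (simp_all add: eta_star_def conj_transpose_def)

lemma eta_star_carrier: "M \<in> carrier_mat m n \<Longrightarrow> eta_star \<eta> M \<in> carrier_mat n m"
  by (simp add: eta_star_def conj_transpose_def)

lemma eta_star_index:
  "M \<in> carrier_mat m n \<Longrightarrow> i < n \<Longrightarrow> j < m \<Longrightarrow> eta_star \<eta> M $$ (i, j) = eta_conj \<eta> (M $$ (j, i))"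
  by (simp add: eta_star_def conj_transpose_def eta_conj_def)

lemma eta_star_eta_star: "eta_star \<eta> (eta_star \<eta> M) = M"
proof (rule eq_matI)
  fix i j assume ij: "i < dim_row M" "j < dim_col M"
  have M: "M \<in> carrier_mat (dim_row M) (dim_col M)" by (rule carrier_matI) (rule refl)+
  have "eta_star \<eta> (eta_star \<eta> M) $$ (i, j) = eta_conj \<eta> (eta_star \<eta> M $$ (j, i))"
    by (rule eta_star_index[OF eta_star_carrier[OF M] ij])
  also have "eta_star \<eta> M $$ (j, i) = eta_conj \<eta> (M $$ (i, j))"
    by (rule eta_star_index[OF M ij(2) ij(1)])
  finally show "eta_star \<eta> (eta_star \<eta> M) $$ (i, j) = M $$ (i, j)" by (simp only: eta_conj_eta_conj)
qed (simp_all only: eta_star_dim)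

lemma eta_star_mult:
  assumes M: "M \<in> carrier_mat m n" and N: "N \<in> carrier_mat n p"
  shows "eta_star \<eta> (M * N) = eta_star \<eta> N * eta_star \<eta> M"
proof (rule eq_matI)
  fix i j assume "i < dim_row (eta_star \<eta> N * eta_star \<eta> M)" "j < dim_col (eta_star \<eta> N * eta_star \<eta> M)"
  then have ij: "i < p" "j < m" using M N by auto
  then show "eta_star \<eta> (M * N) $$ (i, j) = (eta_star \<eta> N * eta_star \<eta> M) $$ (i, j)"
    using M N by (simp add: eta_star_index[OF mult_carrier_mat[OF M N]] scalar_prod_def eta_conj_sum
      eta_conj_mult eta_star_index[OF M] eta_star_index[OF N])
qed (use M N in simp_all)

lemma eta_star_one: "eta_star \<eta> (1\<^sub>m n) = 1\<^sub>m n"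
  by (rule eq_matI) (simp_all add: eta_star_index[of "1\<^sub>m n" n n])

lemma eta_star_GL:
  assumes "M \<in> GL n"
  shows "eta_star \<eta> M \<in> GL n"
proof -
  obtain N where N: "M \<in> carrier_mat n n" "N \<in> carrier_mat n n" "M * N = 1\<^sub>m n" "N * M = 1\<^sub>m n"
    using GL_inverse[OF assms] .
  show ?thesis
    by (rule GL_intro[of _ _ "eta_star \<eta> N"])
      (use N in \<open>simp_all add: eta_star_carrier eta_star_mult[symmetric] eta_star_one\<close>)
qed

end

locale eta_hermitian = quat_unit +
  fixes A :: "quat mat" and m :: nat
  assumes A: "A \<in> carrier_mat m m" and A_star: "eta_star \<eta> A = A"
begin

text \<open>The sesquilinear form of \<open>A\<close>: the row \<open>eta_star\<close> of
  \<open>x\<close>, times \<open>A\<close>, times the column \<open>y\<close>. It is right linear in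
  \<open>y\<close> and conjugate linear in \<open>x\<close>.\<close>

definition form :: "(nat \<Rightarrow> quat) \<Rightarrow> (nat \<Rightarrow> quat) \<Rightarrow> quat" where
  "form x y = (\<Sum>i<m. \<Sum>j<m. eta_conj \<eta> (x i) * A $$ (i, j) * y j)"

lemma form_add: "form x (y + z) = form x y + form x z"
  by (simp add: form_def algebra_simps sum.distrib)

lemma form_diff: "form x (y - z) = form x y - form x z"
  by (simp add: form_def algebra_simps sum_subtractf)

lemma form_scl: "form x (scl y c) = form x y * c"
  by (simp add: form_def sum_distrib_right mult.assoc)

lemma form_0: "form x 0 = 0"
  by (simp add: form_def)

lemma form_lincomb: "form x (lincomb I b c) = (\<Sum>i\<in>I. form x (b i) * c i)"
  unfolding lincomb_def
  by (induction I rule: infinite_finite_induct)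
    (simp_all only: sum.infinite sum.empty sum.insert form_0 form_add form_scl not_False_eq_True)

lemma form_conj: "eta_conj \<eta> (form x y) = form y x"
proof -
  have "eta_conj \<eta> (A $$ (i, j)) = A $$ (j, i)" if "i < m" "j < m" for i j
    using that eta_star_index[OF A, of j i] by (simp add: A_star)
  then show ?thesis
    unfolding form_def eta_conj_sum eta_conj_mult eta_conj_eta_conj
    by (subst sum.swap) (intro sum.cong refl; simp add: mult.assoc)
qed

lemma form_zero_iff: "form x y = 0 \<longleftrightarrow> form y x = 0"
  by (metis form_conj eta_conj_0)

text \<open>The transformed matrix is the Gram matrix of the vectors \<open>w i\<close>. The search
  for an invertible matrix thus becomes the choice of a basis.\<close>

lemma congruence_index:
  assumes "i < m" "j < m"
  shows "(eta_star \<eta> (mat_of_family m m w) * A * mat_of_family m m w) $$ (i, j) = form (w i) (w j)"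
proof -
  let ?Q = "mat_of_family m m w"
  have Q: "?Q \<in> carrier_mat m m" "eta_star \<eta> ?Q \<in> carrier_mat m m"
    by (simp_all add: eta_star_carrier)
  have "(eta_star \<eta> ?Q * A) $$ (i, l) = (\<Sum>k<m. eta_conj \<eta> (w i k) * A $$ (k, l))" if "l < m" for l
    using assms that A Q
    by (simp add: scalar_prod_def eta_star_index[OF Q(1)] lessThan_atLeast0 del: eta_star_dim)
      (simp add: mat_of_family_def)
  then have "(eta_star \<eta> ?Q * A * ?Q) $$ (i, j)
      = (\<Sum>l<m. (\<Sum>k<m. eta_conj \<eta> (w i k) * A $$ (k, l)) * w j l)"
    using assms A Q by (simp add: scalar_prod_def lessThan_atLeast0 del: eta_star_dim index_mult_mat(1))
      (simp add: scalar_prod_def lessThan_atLeast0 mat_of_family_def)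
  also have "\<dots> = form (w i) (w j)"
    unfolding form_def by (subst sum.swap) (simp add: sum_distrib_right)
  finally show ?thesis .
qed

text \<open>Polarisation works because no nonzero multiple of 1 is negated by the involution.\<close>

lemma form_vanishes:
  assumes S: "rsubspace S" and iso: "\<And>x. x \<in> S \<Longrightarrow> form x x = 0" and x: "x \<in> S" and y: "y \<in> S"
  shows "form x y = 0"
proof (rule ccontr)
  assume a: "form x y \<noteq> 0"
  \<comment> \<open>Rescaling \<open>y\<close> makes the mixed value 1, which the involution fixes.
    The value of the form at \<open>x + ?z\<close> is then 2, although both vectors are
    isotropic.\<close>
  let ?z = "scl y (inverse (form x y))"
  have z: "?z \<in> S" by (rule rsubspace_scl[OF S y])
  have xz: "form x ?z = 1" using a by (simp add: form_scl)
  then have zx: "form ?z x = 1" using form_conj[of x ?z] by simp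
  have add_left: "form (x + ?z) w = form x w + form ?z w" for w
    by (metis form_add form_conj eta_conj_add)
  have "form (x + ?z) (x + ?z) = form x x + form x ?z + (form ?z x + form ?z ?z)"
    by (simp only: form_add add_left) (simp add: algebra_simps)
  also have "\<dots> = 1 + 1" by (simp only: xz zx iso[OF x] iso[OF z]) simp
  also have "\<dots> \<noteq> 0" by (simp add: quat_eq_iff del: one_add_one)
  finally show False using iso[OF rsubspace_add[OF S x z]] by simp
qed

text \<open>Pairing with \<open>b i\<close> isolates the coefficient \<open>c i\<close>. The
  combination is assumed to be orthogonal to the family rather than zero, so that the lemma yields
  both independence outright and independence modulo the orthogonal complement.\<close>

lemma orthogonal_independent:
  assumes I: "finite I" and orth: "\<And>i j. i \<in> I \<Longrightarrow> j \<in> I \<Longrightarrow> i \<noteq> j \<Longrightarrow> form (b i) (b j) = 0"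
    and nz: "\<And>i. i \<in> I \<Longrightarrow> form (b i) (b i) \<noteq> 0" and c: "\<And>i. i \<in> I \<Longrightarrow> form (b i) (lincomb I b c) = 0"
    and i: "i \<in> I"
  shows "c i = 0"
proof -
  have "(\<Sum>j\<in>I - {i}. form (b i) (b j) * c j) = 0"
    by (rule sum.neutral) (use orth i in auto)
  then have "form (b i) (lincomb I b c) = form (b i) (b i) * c i"
    unfolding form_lincomb using I i by (simp add: sum.remove[of _ i])
  then show ?thesis using c[OF i] nz[OF i] by simp
qed

lemma rel_basis_shift_index:
  assumes "rel_basis X Y {..<k::nat} f" "\<And>i. i < k \<Longrightarrow> w (a + i) = f i"
  shows "rel_basis X Y {a..<a + k} w"
proof (rule rel_basis_cong[OF rel_basis_reindex[OF assms(1)]])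
  show "bij_betw (\<lambda>j. j - a) {a..<a + k} {..<k}"
    by (rule bij_betw_byWitness[of _ "\<lambda>j. a + j"]) auto
qed (use assms(2) in \<open>auto simp: le_iff_add\<close>)

text \<open>The vectors \<open>w i\<close> are to become the conjugated rows of the transforming
  matrix. Let \<open>N\<close> be the vectors whose leading \<open>r\<close> coordinates vanish: the
  coordinate condition says that \<open>w i\<close> is a unit vector up to \<open>N\<close> for
  \<open>i < r\<close> and lies in \<open>N\<close> for the others. On \<open>N\<close> the form
  splits into a part spanned by orthogonal non-isotropic vectors and a part on which it is zero; the
  unit vectors are corrected to be orthogonal to the former.\<close>

lemma adapted_basis:
  assumes r: "r \<le> m"
  obtains w s where "rel_basis {0} (coord_space m) {..<m} w" "s \<le> m - r"
    "\<And>i j. i < m \<Longrightarrow> j < r \<Longrightarrow> w i j = unit_fun i j"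
    "\<And>i j. r \<le> i \<Longrightarrow> i < m \<Longrightarrow> r \<le> j \<Longrightarrow> j < m \<Longrightarrow> i \<noteq> j \<or> i < m - s \<Longrightarrow> form (w i) (w j) = 0"
    "\<And>i. m - s \<le> i \<Longrightarrow> i < m \<Longrightarrow> form (w i) (w i) \<noteq> 0"
    "\<And>i j. i < r \<Longrightarrow> m - s \<le> j \<Longrightarrow> j < m \<Longrightarrow> form (w i) (w j) = 0"
proof -
  let ?E = "coord_space m :: (nat \<Rightarrow> quat) set"
  define N where "N = {x \<in> ?E. \<forall>i<r. x i = 0}"
  have N: "rsubspace N" using rsubspace_coord_space[of m] by (auto simp: N_def rsubspace_def)
  define P where "P s \<longleftrightarrow> (\<exists>b. b ` {..<s} \<subseteq> N \<and> (\<forall>i<s. \<forall>j<s. i \<noteq> j \<longrightarrow> form (b i) (b j) = 0)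
    \<and> (\<forall>i<s. form (b i) (b i) \<noteq> 0))" for s :: nat
  have "P 0" by (simp add: P_def)
  moreover have "s \<le> m" if Ps: "P s" for s
  proof -
    obtain b where b: "b ` {..<s} \<subseteq> N" "\<forall>i<s. \<forall>j<s. i \<noteq> j \<longrightarrow> form (b i) (b j) = 0"
      "\<forall>i<s. form (b i) (b i) \<noteq> 0" using Ps unfolding P_def by blast
    have "card {..<s} \<le> m"
    proof (rule independent_card_le[of _ b])
      show "b ` {..<s} \<subseteq> coord_space m" using b(1) by (auto simp: N_def)
      show "\<forall>i\<in>{..<s}. c i = 0" if "lincomb {..<s} b c = 0" for c
        using orthogonal_independent[of "{..<s}" b c] b that by (simp add: form_0)
    qed simp
    then show ?thesis by simp
  qed
  ultimately obtain s where s: "P s" "\<And>j. P j \<Longrightarrow> j \<le> s"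
    using Nat.ex_has_greatest_nat[of P 0 m] by auto
  then obtain b where bN: "b ` {..<s} \<subseteq> N"
    and orth: "\<And>i j. i < s \<Longrightarrow> j < s \<Longrightarrow> i \<noteq> j \<Longrightarrow> form (b i) (b j) = 0"
    and nz: "\<And>i. i < s \<Longrightarrow> form (b i) (b i) \<noteq> 0"
    unfolding P_def by blast
  define Z where "Z = {x \<in> N. \<forall>i<s. form (b i) x = 0}"
  have Z: "rsubspace Z"
    using N by (auto simp: Z_def rsubspace_def form_0 form_add form_scl simp del: zero_fun_apply)
  \<comment> \<open>A vector of the complement \<open>Z\<close> with nonzero value could be adjoined
    to \<open>b\<close>, against the maximality of \<open>s\<close>.\<close>
  have "form x x = 0" if x: "x \<in> Z" for x
  proof (rule ccontr)
    assume nx: "form x x \<noteq> 0"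
    have xb: "form (b i) x = 0" "form x (b i) = 0" if "i < s" for i
      using x that form_zero_iff by (auto simp: Z_def)
    have "P (Suc s)"
      unfolding P_def
    proof (intro exI[of _ "b(s := x)"] conjI allI impI)
      show "(b(s := x)) ` {..<Suc s} \<subseteq> N" using bN x by (auto simp: Z_def lessThan_Suc)
      show "form ((b(s := x)) i) ((b(s := x)) j) = 0" if "i < Suc s" "j < Suc s" "i \<noteq> j" for i j
        using that xb orth by (auto simp: less_Suc_eq)
      show "form ((b(s := x)) i) ((b(s := x)) i) \<noteq> 0" if "i < Suc s" for i
        using that nx nz by (auto simp: less_Suc_eq)
    qed
    then show False using s(2) by fastforce
  qed
  then have Z0: "form x y = 0" if "x \<in> Z" "y \<in> Z" for x y
    using form_vanishes[OF Z] that by blast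
  \<comment> \<open>The projection along the span of \<open>b\<close>, available because the values
    \<open>form (b i) (b i)\<close> are invertible. It subtracts an element of \<open>N\<close>,
    hence leaves the leading \<open>r\<close> coordinates alone.\<close>
  define pr where "pr y = y - lincomb {..<s} b (\<lambda>i. inverse (form (b i) (b i)) * form (b i) y)" for y
  have pr: "form (b i) (pr y) = 0" if "i < s" for i y
  proof -
    have "form (b i) (lincomb {..<s} b (\<lambda>i. inverse (form (b i) (b i)) * form (b i) y)) = form (b i) y"
    proof -
      have "(\<Sum>j\<in>{..<s} - {i}. form (b i) (b j) * (inverse (form (b j) (b j)) * form (b j) y)) = 0"
        by (rule sum.neutral) (use orth that in auto)
      then show ?thesis
        unfolding form_lincomb using that nz by (simp add: sum.remove[of _ i] mult.assoc[symmetric])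
    qed
    then show ?thesis by (simp add: pr_def form_diff)
  qed
  have lN: "lincomb {..<s} b c \<in> N" for c by (rule rsubspace_lincomb[OF N bN])
  have b: "rel_basis Z N {..<s} b"
    unfolding rel_basis_def
  proof (intro conjI allI ballI impI)
    show "\<exists>c. y - lincomb {..<s} b c \<in> Z" if "y \<in> N" for y
    proof -
      have "pr y \<in> Z" using pr lN that by (auto simp: Z_def) (simp add: pr_def rsubspace_diff[OF N])
      then show ?thesis unfolding pr_def by blast
    qed
    show "c i = 0" if "lincomb {..<s} b c \<in> Z" "i \<in> {..<s}" for c i
      using orthogonal_independent[of "{..<s}" b c i] orth nz that by (auto simp: Z_def)
  qed (use bN in auto)
  obtain t z where z: "rel_basis {0} Z {..<t::nat} z"
    using rel_basis_exists[OF rsubspace_zero, of Z m] by (auto simp: Z_def N_def)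
  define q where "q j = pr (unit_fun j)" for j
  have q: "rel_basis N ?E {..<r} q"
    unfolding rel_basis_def
  proof (intro conjI allI ballI impI)
    have qu: "unit_fun j - q j \<in> N" for j using lN by (simp add: q_def pr_def)
    have lq: "lincomb {..<r} unit_fun c - lincomb {..<r} q c \<in> N" for c
    proof -
      have "lincomb {..<r} unit_fun c - lincomb {..<r} q c = lincomb {..<r} (\<lambda>j. unit_fun j - q j) c"
        by (simp add: lincomb_apply fun_eq_iff algebra_simps sum_subtractf)
      then show ?thesis using rsubspace_lincomb[OF N, of "\<lambda>j. unit_fun j - q j" "{..<r}" c] qu by auto
    qed
    have lu: "lincomb {..<r} unit_fun c i = (if i < r then c i else 0)" for c :: "nat \<Rightarrow> quat" and i
      by (auto simp: lincomb_apply sum_unit_fun, auto simp: unit_fun_def)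
    show "q ` {..<r} \<subseteq> ?E"
    proof safe
      fix j assume "j < r"
      then have "unit_fun j \<in> ?E" using r by (auto simp: unit_fun_def coord_space_def)
      moreover have "unit_fun j - q j \<in> ?E" using qu[of j] unfolding N_def by blast
      ultimately have "unit_fun j - (unit_fun j - q j) \<in> ?E"
        by (rule rsubspace_diff[OF rsubspace_coord_space])
      then show "q j \<in> ?E" by simp
    qed
    show "\<exists>c. y - lincomb {..<r} q c \<in> N" if y: "y \<in> ?E" for y
    proof -
      have "y - lincomb {..<r} unit_fun y \<in> N"
        using y r by (auto simp: N_def coord_space_def lu)
      from rsubspace_add[OF N this lq[of y]] show ?thesis by (intro exI[of _ y]) simp
    qed
    show "c i = 0" if "lincomb {..<r} q c \<in> N" "i \<in> {..<r}" for c i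
    proof -
      have "lincomb {..<r} unit_fun c \<in> N" using rsubspace_add[OF N lq[of c] that(1)] by simp
      then have "lincomb {..<r} unit_fun c i = 0" using that by (auto simp: N_def)
      then show ?thesis using that by (simp add: lu)
    qed
  qed simp
  \<comment> \<open>The order fixes the shape of the Gram matrix: \<open>q\<close> for the rows
    occupied by the other three matrices, the isotropic \<open>z\<close> for the zero block, and
    \<open>b\<close> last for the diagonal block.\<close>
  define w where "w j = (if j < r then q j else if j < r + t then z (j - r) else b (j - (r + t)))" for j
  have w1: "rel_basis {0} Z {r..<r + t} w" by (rule rel_basis_shift_index[OF z]) (simp add: w_def)
  have w2: "rel_basis Z N {r + t..<r + t + s} w" by (rule rel_basis_shift_index[OF b]) (simp add: w_def)
  have w3: "rel_basis N ?E {..<r} w" by (rule rel_basis_cong[OF q]) (simp add: w_def)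
  have sub: "{0} \<subseteq> Z" "Z \<subseteq> N" "{0} \<subseteq> N" "N \<subseteq> ?E"
    using rsubspace_0[OF Z] rsubspace_0[OF N] by (auto simp: Z_def N_def simp del: zero_fun_apply)
  have "rel_basis {0} ?E ({r..<r + t} \<union> {r + t..<r + t + s} \<union> {..<r}) w"
    by (rule rel_basis_trans[OF rel_basis_trans[OF w1 w2 _ Z] w3 _ N]) (use sub in auto)
  moreover have "{r..<r + t} \<union> {r + t..<r + t + s} \<union> {..<r} = {..<r + t + s}" by auto
  ultimately have w: "rel_basis {0} ?E {..<r + t + s} w" by simp
  then have rts: "r + t + s = m" using basis_coord_space_card by fastforce
  have ms: "m - s = r + t" using rts by simp
  have wZ: "w i \<in> Z" if "r \<le> i" "i < r + t" for i
    using that rel_basis_mem[OF w1, of i] by simp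
  have wb: "w i = b (i - (r + t))" "i - (r + t) < s" if "r + t \<le> i" "i < m" for i
    using that rts by (auto simp: w_def)
  show thesis
  proof (rule that[of w s])
    show "rel_basis {0} ?E {..<m} w" using w by (simp add: rts)
    show "s \<le> m - r" using rts by simp
    show "w i j = unit_fun i j" if "i < m" "j < r" for i j
    proof (cases "i < r")
      case True
      have "lincomb {..<s} b c j = 0" for c using lN[of c] \<open>j < r\<close> by (simp add: N_def)
      then show ?thesis using True by (simp add: w_def q_def pr_def)
    next
      case False
      then have "w i \<in> N" using that rts rel_basis_mem[OF w1, of i] rel_basis_mem[OF w2, of i] sub
        by (cases "i < r + t") auto
      then show ?thesis using False \<open>j < r\<close> by (auto simp: N_def unit_fun_def)
    qed
    show "form (w i) (w j) = 0" if "r \<le> i" "i < m" "r \<le> j" "j < m" "i \<noteq> j \<or> i < m - s" for i j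
    proof -
      consider "i < r + t" "j < r + t" | "i < r + t" "r + t \<le> j" | "r + t \<le> i" "j < r + t"
        | "r + t \<le> i" "r + t \<le> j" by linarith
      then show ?thesis
      proof cases
        case 1 then show ?thesis using Z0 wZ that by simp
      next
        case 2
        then have "form (w j) (w i) = 0" using wZ[of i] wb[of j] that by (simp add: Z_def)
        then show ?thesis using form_zero_iff by blast
      next
        case 3 then show ?thesis using wZ[of j] wb[of i] that by (simp add: Z_def)
      next
        case 4 then show ?thesis using wb[of i] wb[of j] that ms orth by auto
      qed
    qed
    show "form (w i) (w i) \<noteq> 0" if "m - s \<le> i" "i < m" for i
      using that nz wb[of i] by (simp add: ms)
    show "form (w i) (w j) = 0" if "i < r" "m - s \<le> j" "j < m" for i j
    proof -
      have "form (w j) (w i) = 0" using that pr wb[of j] by (simp add: ms w_def[of i] q_def)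
      then show ?thesis using form_zero_iff by blast
    qed
  qed
qed

text \<open>Applying \<open>eta_star\<close> to the basis matrix moves the coordinate condition to
  columns: the leading \<open>r\<close> columns of \<open>P\<close> are those of the identity. Hence
  left multiplication by \<open>P\<close> fixes every matrix whose rows from \<open>r\<close> on are
  zero.\<close>

lemma congruence_reduction:
  assumes "r \<le> m"
  obtains P s where "P \<in> GL m" "s \<le> m - r"
    "\<And>i j. i < m \<Longrightarrow> j < r \<Longrightarrow> P $$ (i, j) = (if i = j then 1 else 0)"
    "\<And>i j. r \<le> i \<Longrightarrow> i < m \<Longrightarrow> r \<le> j \<Longrightarrow> j < m \<Longrightarrow> i \<noteq> j \<or> i < m - s \<Longrightarrow>
      (P * A * eta_star \<eta> P) $$ (i, j) = 0"
    "\<And>i. m - s \<le> i \<Longrightarrow> i < m \<Longrightarrow> (P * A * eta_star \<eta> P) $$ (i, i) \<noteq> 0"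
    "\<And>i j. i < r \<Longrightarrow> m - s \<le> j \<Longrightarrow> j < m \<Longrightarrow> (P * A * eta_star \<eta> P) $$ (i, j) = 0"
proof -
  obtain w s where w: "rel_basis {0} (coord_space m) {..<m} w" "s \<le> m - r"
    "\<And>i j. i < m \<Longrightarrow> j < r \<Longrightarrow> w i j = unit_fun i j"
    "\<And>i j. r \<le> i \<Longrightarrow> i < m \<Longrightarrow> r \<le> j \<Longrightarrow> j < m \<Longrightarrow> i \<noteq> j \<or> i < m - s \<Longrightarrow> form (w i) (w j) = 0"
    "\<And>i. m - s \<le> i \<Longrightarrow> i < m \<Longrightarrow> form (w i) (w i) \<noteq> 0"
    "\<And>i j. i < r \<Longrightarrow> m - s \<le> j \<Longrightarrow> j < m \<Longrightarrow> form (w i) (w j) = 0"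
    using adapted_basis[OF assms] by blast
  let ?Q = "mat_of_family m m w"
  have PP: "eta_star \<eta> (eta_star \<eta> ?Q) = ?Q" by (rule eta_star_eta_star)
  show thesis
  proof (rule that[of "eta_star \<eta> ?Q" s])
    show "eta_star \<eta> ?Q \<in> GL m" by (rule eta_star_GL[OF basis_matrix_invertible[OF w(1)]])
    show "eta_star \<eta> ?Q $$ (i, j) = (if i = j then 1 else 0)" if "i < m" "j < r" for i j
    proof -
      have "?Q $$ (j, i) = unit_fun i j" using that assms w(3) by (simp add: mat_of_family_def)
      then show ?thesis
        using that assms eta_star_index[of ?Q m m i j] by (simp add: unit_fun_def)
    qed
  qed (use w assms in \<open>simp_all add: PP congruence_index\<close>)
qed

end

section \<open>Block matrices\<close>

definition offset :: "nat list \<Rightarrow> nat \<Rightarrow> nat" where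
  "offset ns k = sum_list (take k ns)"

lemma offset_0 [simp]: "offset ns 0 = 0"
  and offset_Cons_Suc [simp]: "offset (n # ns) (Suc k) = n + offset ns k"
  by (simp_all add: offset_def)

lemma offset_less: "k < length ns \<Longrightarrow> i < ns ! k \<Longrightarrow> offset ns k + i < sum_list ns"
proof (induction ns arbitrary: k)
  case (Cons n ns)
  then show ?case by (cases k) (auto simp: add.assoc trans_less_add1)
qed simp

lemma offset_cases:
  assumes "j < sum_list ns"
  obtains k i where "k < length ns" "i < ns ! k" "j = offset ns k + i"
  using assms
proof (induction ns arbitrary: j thesis)
  case (Cons n ns)
  show ?case
  proof (cases "j < n")
    case True
    then show ?thesis using Cons.prems(1)[of 0 j] by simp
  next
    case False
    then have "j - n < sum_list ns" using Cons.prems(2) by simp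
    then obtain k i where "k < length ns" "i < ns ! k" "j - n = offset ns k + i"
      using Cons.IH by blast
    then show ?thesis using Cons.prems(1)[of "Suc k" i] False by simp
  qed
qed simp

lemma offset_eq_iff:
  "k < length ns \<Longrightarrow> l < length ns \<Longrightarrow> i < ns ! k \<Longrightarrow> j < ns ! l \<Longrightarrow>
    offset ns k + i = offset ns l + j \<longleftrightarrow> k = l \<and> i = j"
proof (induction ns arbitrary: k l)
  case (Cons n ns)
  then show ?case by (cases k; cases l) auto
qed simp

lemma hcat_block:
  assumes "Ms \<noteq> []" "length cs = length Ms" "\<And>l. l < length Ms \<Longrightarrow> Ms ! l \<in> carrier_mat r (cs ! l)"
  shows "hcat Ms \<in> carrier_mat r (sum_list cs)"
    and "\<And>l i j. l < length Ms \<Longrightarrow> i < r \<Longrightarrow> j < cs ! l \<Longrightarrow>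
      hcat Ms $$ (i, offset cs l + j) = (Ms ! l) $$ (i, j)"
proof -
  have "hcat Ms \<in> carrier_mat r (sum_list cs) \<and> (\<forall>l i j. l < length Ms \<longrightarrow> i < r \<longrightarrow> j < cs ! l \<longrightarrow>
      hcat Ms $$ (i, offset cs l + j) = (Ms ! l) $$ (i, j))"
    using assms
  proof (induction Ms arbitrary: cs rule: hcat.induct)
    case (2 M)
    then show ?case by (cases cs) auto
  next
    case (3 M N Ms)
    from 3(3) obtain c cs' where cs: "cs = c # cs'" by (cases cs) auto
    let ?R = "hcat (N # Ms)"
    have M: "M \<in> carrier_mat r c" using 3(4)[of 0] cs by simp
    have IH: "?R \<in> carrier_mat r (sum_list cs')"
      "\<And>l i j. l < length (N # Ms) \<Longrightarrow> i < r \<Longrightarrow> j < cs' ! l \<Longrightarrow>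
        ?R $$ (i, offset cs' l + j) = ((N # Ms) ! l) $$ (i, j)"
    proof -
      have "(N # Ms) ! l \<in> carrier_mat r (cs' ! l)" if "l < length (N # Ms)" for l
        using 3(4)[of "Suc l"] cs that by simp
      moreover have "length cs' = length (N # Ms)" using 3(3) cs by simp
      ultimately have IH': "?R \<in> carrier_mat r (sum_list cs') \<and>
          (\<forall>l i j. l < length (N # Ms) \<longrightarrow> i < r \<longrightarrow> j < cs' ! l \<longrightarrow>
            ?R $$ (i, offset cs' l + j) = ((N # Ms) ! l) $$ (i, j))" by (rule "3.IH"[OF list.distinct(2), rotated])
      show "?R \<in> carrier_mat r (sum_list cs')" using IH' by (rule conjunct1)
      show "?R $$ (i, offset cs' l + j) = ((N # Ms) ! l) $$ (i, j)"
        if "l < length (N # Ms)" "i < r" "j < cs' ! l" for l i j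
        using conjunct2[OF IH'] that by blast
    qed
    have H: "hcat (M # N # Ms) = four_block_mat M ?R (0\<^sub>m 0 (dim_col M)) (0\<^sub>m 0 (dim_col ?R))"
      by (simp only: hcat.simps Let_def)
    have "hcat (M # N # Ms) \<in> carrier_mat r (sum_list cs)"
      using four_block_carrier_mat[OF M zero_carrier_mat[of 0 "dim_col ?R"]] carrier_matD(2)[OF IH(1)]
      unfolding H cs by simp
    moreover have "hcat (M # N # Ms) $$ (i, offset cs l + j) = ((M # N # Ms) ! l) $$ (i, j)"
      if l: "l < length (M # N # Ms)" and i: "i < r" and j: "j < cs ! l" for l i j
    proof (cases l)
      case 0
      then show ?thesis unfolding H using M IH(1) i j cs by simp
    next
      case (Suc l')
      then have "offset cs' l' + j < sum_list cs'" using l j 3(3) cs by (intro offset_less) auto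
      then show ?thesis unfolding H using Suc M IH i j l cs by simp
    qed
    ultimately show ?case by blast
  qed simp
  then show "hcat Ms \<in> carrier_mat r (sum_list cs)"
    and "\<And>l i j. l < length Ms \<Longrightarrow> i < r \<Longrightarrow> j < cs ! l \<Longrightarrow>
      hcat Ms $$ (i, offset cs l + j) = (Ms ! l) $$ (i, j)" by auto
qed

lemma vcat_block:
  assumes "Ms \<noteq> []" "length rs = length Ms" "\<And>k. k < length Ms \<Longrightarrow> Ms ! k \<in> carrier_mat (rs ! k) c"
  shows "vcat Ms \<in> carrier_mat (sum_list rs) c"
    and "\<And>k i j. k < length Ms \<Longrightarrow> i < rs ! k \<Longrightarrow> j < c \<Longrightarrow>
      vcat Ms $$ (offset rs k + i, j) = (Ms ! k) $$ (i, j)"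
proof -
  have "vcat Ms \<in> carrier_mat (sum_list rs) c \<and> (\<forall>k i j. k < length Ms \<longrightarrow> i < rs ! k \<longrightarrow> j < c \<longrightarrow>
      vcat Ms $$ (offset rs k + i, j) = (Ms ! k) $$ (i, j))"
    using assms
  proof (induction Ms arbitrary: rs rule: vcat.induct)
    case (2 M)
    then show ?case by (cases rs) auto
  next
    case (3 M N Ms)
    from 3(3) obtain r rs' where rs: "rs = r # rs'" by (cases rs) auto
    let ?R = "vcat (N # Ms)"
    have M: "M \<in> carrier_mat r c" using 3(4)[of 0] rs by simp
    have IH: "?R \<in> carrier_mat (sum_list rs') c"
      "\<And>k i j. k < length (N # Ms) \<Longrightarrow> i < rs' ! k \<Longrightarrow> j < c \<Longrightarrow>
        ?R $$ (offset rs' k + i, j) = ((N # Ms) ! k) $$ (i, j)"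
    proof -
      have "(N # Ms) ! k \<in> carrier_mat (rs' ! k) c" if "k < length (N # Ms)" for k
        using 3(4)[of "Suc k"] rs that by simp
      moreover have "length rs' = length (N # Ms)" using 3(3) rs by simp
      ultimately have IH': "?R \<in> carrier_mat (sum_list rs') c \<and>
          (\<forall>k i j. k < length (N # Ms) \<longrightarrow> i < rs' ! k \<longrightarrow> j < c \<longrightarrow>
            ?R $$ (offset rs' k + i, j) = ((N # Ms) ! k) $$ (i, j))" by (rule "3.IH"[OF list.distinct(2), rotated])
      show "?R \<in> carrier_mat (sum_list rs') c" using IH' by (rule conjunct1)
      show "?R $$ (offset rs' k + i, j) = ((N # Ms) ! k) $$ (i, j)"
        if "k < length (N # Ms)" "i < rs' ! k" "j < c" for k i j
        using conjunct2[OF IH'] that by blast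
    qed
    have H: "vcat (M # N # Ms) = M @\<^sub>r ?R"
      by (simp only: vcat.simps)
    have "vcat (M # N # Ms) \<in> carrier_mat (sum_list rs) c"
      unfolding H rs using M IH(1) by (simp add: carrier_append_rows)
    moreover have "vcat (M # N # Ms) $$ (offset rs k + i, j) = ((M # N # Ms) ! k) $$ (i, j)"
      if k: "k < length (M # N # Ms)" and i: "i < rs ! k" and j: "j < c" for k i j
    proof (cases k)
      case 0
      then show ?thesis unfolding H using M IH(1) i j rs by (simp add: append_rows_def)
    next
      case (Suc k')
      then have "offset rs' k' + i < sum_list rs'" using k i 3(3) rs by (intro offset_less) auto
      then show ?thesis unfolding H using Suc M IH i j k rs by (simp add: append_rows_def)
    qed
    ultimately show ?case by blast
  qed simp
  then show "vcat Ms \<in> carrier_mat (sum_list rs) c"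
    and "\<And>k i j. k < length Ms \<Longrightarrow> i < rs ! k \<Longrightarrow> j < c \<Longrightarrow>
      vcat Ms $$ (offset rs k + i, j) = (Ms ! k) $$ (i, j)" by auto
qed

lemma block_mat_block:
  assumes ne: "rs \<noteq> []" "cs \<noteq> []" and len: "length Mss = length rs"
    "\<And>k. k < length rs \<Longrightarrow> length (Mss ! k) = length cs"
    and car: "\<And>k l. k < length rs \<Longrightarrow> l < length cs \<Longrightarrow> Mss ! k ! l \<in> carrier_mat (rs ! k) (cs ! l)"
  shows "block_mat Mss \<in> carrier_mat (sum_list rs) (sum_list cs)"
    and "\<And>k l i j. k < length rs \<Longrightarrow> l < length cs \<Longrightarrow> i < rs ! k \<Longrightarrow> j < cs ! l \<Longrightarrow>
      block_mat Mss $$ (offset rs k + i, offset cs l + j) = (Mss ! k ! l) $$ (i, j)"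
proof -
  have row: "hcat (Mss ! k) \<in> carrier_mat (rs ! k) (sum_list cs)"
    "\<And>l i j. l < length cs \<Longrightarrow> i < rs ! k \<Longrightarrow> j < cs ! l \<Longrightarrow>
      hcat (Mss ! k) $$ (i, offset cs l + j) = (Mss ! k ! l) $$ (i, j)" if "k < length rs" for k
  proof -
    have "Mss ! k \<noteq> []" using ne len(2)[OF that] by auto
    then show "hcat (Mss ! k) \<in> carrier_mat (rs ! k) (sum_list cs)"
      "\<And>l i j. l < length cs \<Longrightarrow> i < rs ! k \<Longrightarrow> j < cs ! l \<Longrightarrow>
        hcat (Mss ! k) $$ (i, offset cs l + j) = (Mss ! k ! l) $$ (i, j)"
      using hcat_block[of "Mss ! k" cs "rs ! k"] len(2)[OF that] car[OF that] by simp_all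
  qed
  have nonempty: "map hcat Mss \<noteq> []" using ne len by auto
  have len': "length rs = length (map hcat Mss)" using len by simp
  have row': "map hcat Mss ! k \<in> carrier_mat (rs ! k) (sum_list cs)" if "k < length (map hcat Mss)" for k
    using row(1)[of k] that len by simp
  note V = vcat_block[OF nonempty len' row']
  show "block_mat Mss \<in> carrier_mat (sum_list rs) (sum_list cs)"
    unfolding block_mat_def by (rule V(1))
  show "block_mat Mss $$ (offset rs k + i, offset cs l + j) = (Mss ! k ! l) $$ (i, j)"
    if "k < length rs" "l < length cs" "i < rs ! k" "j < cs ! l" for k l i j
    unfolding block_mat_def using V(2)[of k i "offset cs l + j"] row(2)[of k l i j] that len
    by (simp add: offset_less)
qed

text \<open>A matrix of identity and zero blocks is described by the positions \<open>p\<close>;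
  each column is the sum of the unit vectors selected by its block column. A sum is necessary
  because \<open>form_D\<close> has a block column with two identity blocks. \<open>sq\<close>
  reflects the encoding, in which an identity block takes its size from its rows alone.\<close>

lemma pattern_columns:
  fixes p :: "nat \<Rightarrow> nat \<Rightarrow> bool" and Fss :: "(nat \<Rightarrow> nat \<Rightarrow> 'k::division_ring mat) list list"
  assumes ne: "rs \<noteq> []" "cs \<noteq> []" and len: "length Fss = length rs"
    "\<And>k. k < length rs \<Longrightarrow> length (Fss ! k) = length cs"
    and F: "\<And>k l. k < length rs \<Longrightarrow> l < length cs \<Longrightarrow>
      Fss ! k ! l = (if p k l then (\<lambda>r c. 1\<^sub>m r) else 0\<^sub>m)"
    and sq: "\<And>k l. k < length rs \<Longrightarrow> l < length cs \<Longrightarrow> p k l \<Longrightarrow> rs ! k = cs ! l"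
  shows "sized_block_mat rs cs Fss \<in> carrier_mat (sum_list rs) (sum_list cs)" (is "?S \<in> _")
    and "\<And>l j. l < length cs \<Longrightarrow> j < cs ! l \<Longrightarrow> column (sized_block_mat rs cs Fss) (offset cs l + j)
      = (\<Sum>k | k < length rs \<and> p k l. unit_fun (offset rs k + j))"
proof -
  define Mss where "Mss = map2 (\<lambda>r Fs. map2 (\<lambda>c F. F r c) cs Fs) rs Fss"
  have S: "?S = block_mat Mss" by (simp add: sized_block_mat_def Mss_def)
  have M: "Mss ! k ! l = (if p k l then 1\<^sub>m (rs ! k) else 0\<^sub>m (rs ! k) (cs ! l))"
    if "k < length rs" "l < length cs" for k l
    using that len F[OF that] by (simp add: Mss_def)
  have L: "length Mss = length rs" "\<And>k. k < length rs \<Longrightarrow> length (Mss ! k) = length cs"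
    using len by (simp_all add: Mss_def)
  have car: "Mss ! k ! l \<in> carrier_mat (rs ! k) (cs ! l)" if "k < length rs" "l < length cs" for k l
    using M[OF that] sq[OF that] by auto
  have B: "block_mat Mss \<in> carrier_mat (sum_list rs) (sum_list cs)"
    "\<And>k l i j. k < length rs \<Longrightarrow> l < length cs \<Longrightarrow> i < rs ! k \<Longrightarrow> j < cs ! l \<Longrightarrow>
      block_mat Mss $$ (offset rs k + i, offset cs l + j) = (Mss ! k ! l) $$ (i, j)"
    by (rule block_mat_block[OF ne L car]; assumption)+
  show C: "?S \<in> carrier_mat (sum_list rs) (sum_list cs)" unfolding S by (rule B(1))
  fix l j assume l: "l < length cs" and j: "j < cs ! l"
  show "column ?S (offset cs l + j) = (\<Sum>k | k < length rs \<and> p k l. unit_fun (offset rs k + j))"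
  proof
    fix i
    show "column ?S (offset cs l + j) i = (\<Sum>k | k < length rs \<and> p k l. unit_fun (offset rs k + j)) i"
    proof (cases "i < sum_list rs")
      case True
      then obtain k i' where i: "k < length rs" "i' < rs ! k" "i = offset rs k + i'"
        by (rule offset_cases)
      have "column ?S (offset cs l + j) i = (Mss ! k ! l) $$ (i', j)"
        using C True B(2)[OF i(1) l i(2) j] by (simp add: column_def i(3) S)
      also have "\<dots> = (if p k l \<and> i' = j then 1 else 0)"
        using M[OF i(1) l] i(2) j sq[OF i(1) l] by auto
      \<comment> \<open>Distinct blocks occupy disjoint index ranges, so only the block row
        containing \<open>i\<close> can contribute to the sum.\<close>
      also have "\<dots> = (\<Sum>k' | k' < length rs \<and> p k' l. if k' = k then if i' = j then 1 else 0 else 0)"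
        using i(1) by (simp add: sum.delta')
      also have "\<dots> = (\<Sum>k' | k' < length rs \<and> p k' l. unit_fun (offset rs k' + j) i)"
        using i j sq l offset_eq_iff[of k rs _ i' j]
        by (intro sum.cong) (auto simp: unit_fun_def)
      finally show ?thesis by (simp add: sum_fun_apply)
    next
      case False
      have "unit_fun (offset rs k + j) i = (0 :: 'k)" if "k < length rs" "p k l" for k
        using offset_less[of k rs j] sq[of k l] that l j False by (auto simp: unit_fun_def)
      then have "(\<Sum>k | k < length rs \<and> p k l. unit_fun (offset rs k + j) i) = (0 :: 'k)"
        by (intro sum.neutral) simp
      then show ?thesis using C False by (simp add: sum_fun_apply column_def)
    qed
  qed
qed

text \<open>\<open>K\<close> lists block numbers in the order in which their vectors become columns.
  Positions past the last block produce a default pair with first entry 0.\<close>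

fun block_enum :: "(nat \<Rightarrow> nat) \<Rightarrow> nat list \<Rightarrow> nat \<Rightarrow> nat \<times> nat" where
  "block_enum n [] j = (0, j)"
| "block_enum n (k # K) j = (if j < n k then (k, j) else block_enum n K (j - n k))"

lemma block_enum_offset:
  "l < length K \<Longrightarrow> i < n (K ! l) \<Longrightarrow> block_enum n K (offset (map n K) l + i) = (K ! l, i)"
proof (induction K arbitrary: l)
  case (Cons k K)
  then show ?case by (cases l) auto
qed simp

lemma bij_betw_block_enum:
  assumes "distinct K"
  shows "bij_betw (block_enum n K) {..<sum_list (map n K)} (block_index n (set K))"
proof (rule bij_betwI')
  fix x y assume "x \<in> {..<sum_list (map n K)}" "y \<in> {..<sum_list (map n K)}"
  then obtain k i l j where "k < length K" "i < n (K ! k)" "x = offset (map n K) k + i"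
    "l < length K" "j < n (K ! l)" "y = offset (map n K) l + j"
    by (auto elim!: offset_cases)
  then show "(block_enum n K x = block_enum n K y) = (x = y)"
    using assms offset_eq_iff[of k "map n K" l i j] by (simp add: block_enum_offset nth_eq_iff_index_eq)
next
  fix x assume "x \<in> {..<sum_list (map n K)}"
  then obtain k i where "k < length K" "i < n (K ! k)" "x = offset (map n K) k + i"
    by (auto elim!: offset_cases)
  then show "block_enum n K x \<in> block_index n (set K)"
    by (auto simp: block_enum_offset block_index_def)
next
  fix y assume "y \<in> block_index n (set K)"
  then obtain k i where k: "k < length K" "i < n (K ! k)" "y = (K ! k, i)"
    by (auto simp: block_index_def in_set_conv_nth)
  then have "block_enum n K (offset (map n K) k + i) = y" by (simp add: block_enum_offset)
  moreover have "offset (map n K) k + i < sum_list (map n K)" using k by (intro offset_less) auto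
  ultimately show "\<exists>x\<in>{..<sum_list (map n K)}. y = block_enum n K x" by auto
qed

lemma rel_basis_block_enum:
  "rel_basis X Y (block_index n (set K)) b \<Longrightarrow> distinct K \<Longrightarrow>
    rel_basis X Y {..<sum_list (map n K)} (b \<circ> block_enum n K)"
  by (rule rel_basis_reindex[OF _ bij_betw_block_enum])

text \<open>The column reduction in block coordinates. The size \<open>q\<close> appended to the
  list is the width of the zero block column, that is \<open>p\<close> minus the rank.\<close>

lemma block_column_reduction:
  fixes B :: "quat mat"
  assumes B: "B \<in> carrier_mat m p" and d: "rel_basis {0} (col_space B) (block_index n (set K)) d"
    and K: "distinct K"
  obtains T q where "T \<in> GL p" "p = sum_list (map n K @ [q])"
    "\<And>l j. l < length K \<Longrightarrow> j < n (K ! l) \<Longrightarrow> column (B * T) (offset (map n K @ [q]) l + j) = d (K ! l, j)"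
    "\<And>j. j < q \<Longrightarrow> column (B * T) (offset (map n K @ [q]) (length K) + j) = 0"
proof -
  let ?r = "sum_list (map n K)"
  obtain T where T: "T \<in> GL p" "?r \<le> p"
    "\<And>j. j < p \<Longrightarrow> column (B * T) j = (if j < ?r then (d \<circ> block_enum n K) j else 0)"
    using column_reduction[OF B rel_basis_block_enum[OF d K]] by blast
  have off: "offset (map n K @ [q]) l = offset (map n K) l" if "l \<le> length K" for l q
    using that by (simp add: offset_def)
  show thesis
  proof (rule that[of T "p - ?r"])
    show "p = sum_list (map n K @ [p - ?r])" using T(2) by simp
    show "column (B * T) (offset (map n K @ [p - ?r]) l + j) = d (K ! l, j)"
      if "l < length K" "j < n (K ! l)" for l j
      using T(2,3) offset_less[of l "map n K" j] that by (simp add: off block_enum_offset)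
    show "column (B * T) (offset (map n K @ [p - ?r]) (length K) + j) = 0" if "j < p - ?r" for j
      using T(3) that by (simp add: off) (simp add: offset_def)
  qed (rule T)
qed

section \<open>Ranks of stacked matrices\<close>

definition linear_fun :: "((nat \<Rightarrow> 'k::division_ring) \<Rightarrow> nat \<Rightarrow> 'k) \<Rightarrow> bool" where
  "linear_fun f \<longleftrightarrow> (\<forall>x y. f (x + y) = f x + f y) \<and> (\<forall>x c. f (scl x c) = scl (f x) c)"

lemma linear_fun_zero: "linear_fun f \<Longrightarrow> f 0 = 0"
proof -
  assume f: "linear_fun f"
  then have "f (0 + 0) = f 0 + f 0" unfolding linear_fun_def by blast
  then show "f 0 = 0" unfolding add_0 by (metis add_cancel_right_left)
qed

lemma linear_fun_diff: "linear_fun f \<Longrightarrow> f (x - y) = f x - f y"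
  by (metis (no_types, opaque_lifting) diff_add_cancel eq_diff_eq linear_fun_def)

lemma linear_fun_lincomb: "linear_fun f \<Longrightarrow> f (lincomb I b c) = lincomb I (\<lambda>i. f (b i)) c"
  unfolding lincomb_def
  by (induction I rule: infinite_finite_induct)
    (simp_all only: sum.infinite sum.empty sum.insert linear_fun_zero not_False_eq_True,
      simp only: linear_fun_def)

lemma rsubspace_image: "linear_fun f \<Longrightarrow> rsubspace Y \<Longrightarrow> rsubspace (f ` Y)"
  unfolding rsubspace_def
proof (intro conjI ballI allI)
  assume f: "linear_fun f" and Y: "0 \<in> Y \<and> (\<forall>x\<in>Y. \<forall>y\<in>Y. x + y \<in> Y) \<and> (\<forall>x\<in>Y. \<forall>c. scl x c \<in> Y)"
  show "0 \<in> f ` Y" using linear_fun_zero[OF f] Y by (metis imageI)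
  show "x + y \<in> f ` Y" if "x \<in> f ` Y" "y \<in> f ` Y" for x y
    using that f Y unfolding linear_fun_def by (metis (no_types, opaque_lifting) image_iff)
  show "scl x c \<in> f ` Y" if "x \<in> f ` Y" for x c
    using that f Y unfolding linear_fun_def by (metis (no_types, opaque_lifting) image_iff)
qed

text \<open>The homomorphism theorem relative to \<open>X\<close>: \<open>K\<close> is the part of
  \<open>Y\<close> that \<open>f\<close> maps into \<open>X\<close>, so a basis of
  \<open>Y / K\<close> maps to a basis of what the image of \<open>Y\<close> adds to
  \<open>X\<close>. Ranks of stacked matrices are counted by adding one group of columns at a time,
  \<open>K\<close> recording what the earlier ones already contain.\<close>

lemma rel_basis_image:
  assumes f: "linear_fun f" and b: "rel_basis K Y I b" and X: "rsubspace X" and Y: "rsubspace Y"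
    and K: "\<And>x. x \<in> Y \<Longrightarrow> x \<in> K \<longleftrightarrow> f x \<in> X" and KY: "K \<subseteq> Y"
  shows "rel_basis X (X + f ` Y) I (\<lambda>i. f (b i))"
  unfolding rel_basis_def
proof (intro conjI allI ballI impI)
  note lin = linear_fun_lincomb[OF f, of I b]
  show "finite I" by (rule rel_basis_finite[OF b])
  show "(\<lambda>i. f (b i)) ` I \<subseteq> X + f ` Y"
    using subset_plus_right[OF X, of "f ` Y"] rel_basis_mem[OF b] by blast
  show "\<exists>c. z - lincomb I (\<lambda>i. f (b i)) c \<in> X" if zX: "z \<in> X + f ` Y" for z
  proof -
    obtain x y where z: "z = x + f y" "x \<in> X" "y \<in> Y" using zX by (auto elim: set_plus_elim)
    obtain c where c: "y - lincomb I b c \<in> K" using rel_basis_span[OF b z(3)] by blast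
    then have "f (y - lincomb I b c) \<in> X" using K KY by blast
    then have "x + (f y - lincomb I (\<lambda>i. f (b i)) c) \<in> X"
      unfolding linear_fun_diff[OF f] lin using z(2) by (rule rsubspace_add[OF X, rotated])
    then have "z - lincomb I (\<lambda>i. f (b i)) c \<in> X" by (simp add: z(1) algebra_simps)
    then show ?thesis by blast
  qed
  show "c i = 0" if "lincomb I (\<lambda>i. f (b i)) c \<in> X" "i \<in> I" for c i
    using rel_basis_indep[OF b, of c i] that K[of "lincomb I b c"]
      rsubspace_lincomb[OF Y rel_basis_subset[OF b]] by (simp add: lin)
qed

definition stack :: "nat \<Rightarrow> (nat \<Rightarrow> 'k) \<Rightarrow> (nat \<Rightarrow> 'k) \<Rightarrow> nat \<Rightarrow> 'k" where
  "stack m x y = (\<lambda>i. if i < m then x i else y (i - m))"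

lemma stack_cases:
  fixes z :: "nat \<Rightarrow> 'k::division_ring"
  obtains x y where "z = stack p x y" "x \<in> coord_space p"
proof (rule that)
  show "z = stack p (\<lambda>i. if i < p then z i else 0) (\<lambda>i. z (i + p))"
    by (auto simp: stack_def)
qed (simp add: coord_space_def)

lemma stack_add: "stack m (x + x') (y + y') = stack m x y + stack m x' y'"
  by (simp add: stack_def fun_eq_iff)

lemma stack_scl: "stack m (scl x c) (scl y c) = scl (stack m x y) c"
  by (simp add: stack_def fun_eq_iff)

lemma stack_eq_0_iff:
  assumes "x \<in> coord_space m"
  shows "stack m x y = 0 \<longleftrightarrow> x = 0 \<and> y = 0"
proof
  assume st: "stack m x y = 0"
  have "x i = 0" for i
    using fun_cong[OF st, of i] assms by (cases "i < m") (auto simp: stack_def coord_space_def)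
  moreover have "y i = 0" for i
    using fun_cong[OF st, of "i + m"] by (simp add: stack_def)
  ultimately show "x = 0 \<and> y = 0" by (simp add: fun_eq_iff)
qed (simp add: stack_def fun_eq_iff)

lemma sum_lessThan_add: "(\<Sum>i<a + b. f i) = (\<Sum>i<a. f i) + (\<Sum>i<b. f (i + a :: nat))"
  for f :: "nat \<Rightarrow> 'a::comm_monoid_add"
  by (induction b) (simp_all add: add.assoc add.commute[of a])

lemma mat_app_zero_mat [simp]: "mat_app (0\<^sub>m m n) x = 0"
  by (simp add: mat_app_apply fun_eq_iff)

lemma mat_app_hcat:
  assumes M: "M \<in> carrier_mat m p" and R: "hcat (N # Ms) \<in> carrier_mat m q"
  shows "mat_app (hcat (M # N # Ms)) (stack p x y) = mat_app M x + mat_app (hcat (N # Ms)) y"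
proof -
  define R' where "R' = hcat (N # Ms)"
  have H: "hcat (M # N # Ms) = four_block_mat M R' (0\<^sub>m 0 p) (0\<^sub>m 0 q)"
    using M R unfolding R'_def by (simp only: hcat.simps Let_def carrier_matD)
  have R': "R' \<in> carrier_mat m q" unfolding R'_def by (rule R)
  show ?thesis
    unfolding H R'_def[symmetric]
    using M R' by (auto simp: fun_eq_iff mat_app_apply sum_lessThan_add stack_def)
qed

lemma mat_app_append_rows:
  assumes M: "M \<in> carrier_mat m p" and N: "N \<in> carrier_mat n p"
  shows "mat_app (M @\<^sub>r N) x = stack m (mat_app M x) (mat_app N x)"
  using M N by (auto simp: append_rows_def fun_eq_iff mat_app_apply stack_def)

lemma hcat_carrier:
  assumes M: "M \<in> carrier_mat m p" and R: "hcat (N # Ms) \<in> carrier_mat m q"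
  shows "hcat (M # N # Ms) \<in> carrier_mat m (p + q)"
  using four_block_carrier_mat[OF M zero_carrier_mat[of 0 "dim_col (hcat (N # Ms))"]]
    carrier_matD(2)[OF R] by (simp add: Let_def)

lemma hcat_carrier2:
  "M \<in> carrier_mat m p \<Longrightarrow> N \<in> carrier_mat m q \<Longrightarrow> hcat [M, N] \<in> carrier_mat m (p + q)"
  by (rule hcat_carrier) simp_all

lemma hcat_carrier3:
  "M \<in> carrier_mat m p \<Longrightarrow> N \<in> carrier_mat m q \<Longrightarrow> L \<in> carrier_mat m r \<Longrightarrow>
    hcat [M, N, L] \<in> carrier_mat m (p + (q + r))"
  by (intro hcat_carrier hcat_carrier2)

lemma hcat_carrier4:
  "M \<in> carrier_mat m p \<Longrightarrow> N \<in> carrier_mat m q \<Longrightarrow> L \<in> carrier_mat m r \<Longrightarrow> K \<in> carrier_mat m s \<Longrightarrow>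
    hcat [M, N, L, K] \<in> carrier_mat m (p + (q + (r + s)))"
  by (intro hcat_carrier hcat_carrier2)

lemma mat_app_hcat2:
  assumes "M \<in> carrier_mat m p" "N \<in> carrier_mat m q"
  shows "mat_app (hcat [M, N]) (stack p x y) = mat_app M x + mat_app N y"
  using mat_app_hcat[of M m p N "[]" q] assms by simp

lemma mat_app_hcat3:
  assumes "M \<in> carrier_mat m p" "N \<in> carrier_mat m q" "L \<in> carrier_mat m r"
  shows "mat_app (hcat [M, N, L]) (stack p x (stack q y z)) = mat_app M x + (mat_app N y + mat_app L z)"
  using mat_app_hcat[OF assms(1) hcat_carrier2[OF assms(2,3)]] mat_app_hcat2[OF assms(2,3)] by simp

lemma mat_app_hcat4:
  assumes "M \<in> carrier_mat m p" "N \<in> carrier_mat m q" "L \<in> carrier_mat m r" "K \<in> carrier_mat m s"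
  shows "mat_app (hcat [M, N, L, K]) (stack p x (stack q y (stack r z w)))
    = mat_app M x + (mat_app N y + (mat_app L z + mat_app K w))"
  using mat_app_hcat[OF assms(1) hcat_carrier3[OF assms(2-4)]] mat_app_hcat3[OF assms(2-4)] by simp

lemma col_space_row2:
  assumes "M \<in> carrier_mat m p" "N \<in> carrier_mat m q"
  shows "col_space (block_mat [[M, N]]) = col_space M + col_space N"
proof (intro equalityI subsetI)
  fix u assume "u \<in> col_space (block_mat [[M, N]])"
  then obtain z where z: "u = mat_app (hcat [M, N]) z" by (auto simp: block_mat_def col_space_def)
  obtain x y where "z = stack p x y" by (rule stack_cases)
  then show "u \<in> col_space M + col_space N"
    using z mat_app_hcat2[OF assms, of x y] unfolding col_space_def by (auto intro: set_plus_intro)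
next
  fix u assume "u \<in> col_space M + col_space N"
  then obtain x y where "u = mat_app M x + mat_app N y" by (auto simp: col_space_def elim: set_plus_elim)
  then show "u \<in> col_space (block_mat [[M, N]])"
    unfolding mat_app_hcat2[OF assms, symmetric] by (simp add: block_mat_def col_space_def del: hcat.simps)
qed

lemma col_space_row3:
  assumes "M \<in> carrier_mat m p" "N \<in> carrier_mat m q" "L \<in> carrier_mat m r"
  shows "col_space (block_mat [[M, N, L]]) = col_space M + col_space N + col_space L"
proof -
  have "col_space (hcat [M, N, L]) = col_space M + col_space (hcat [N, L])"
  proof (intro equalityI subsetI)
    fix u assume "u \<in> col_space (hcat [M, N, L])"
    then obtain z where z: "u = mat_app (hcat [M, N, L]) z" by (auto simp: col_space_def)
    obtain x y where "z = stack p x y" by (rule stack_cases)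
    then show "u \<in> col_space M + col_space (hcat [N, L])"
      using z mat_app_hcat[OF assms(1) hcat_carrier2[OF assms(2,3)], of x y]
      unfolding col_space_def by (auto intro: set_plus_intro simp del: hcat.simps)
  next
    fix u assume "u \<in> col_space M + col_space (hcat [N, L])"
    then obtain x y where "u = mat_app M x + mat_app (hcat [N, L]) y"
      by (auto simp: col_space_def elim: set_plus_elim simp del: hcat.simps)
    then show "u \<in> col_space (hcat [M, N, L])"
      unfolding mat_app_hcat[OF assms(1) hcat_carrier2[OF assms(2,3)], symmetric]
      by (simp add: col_space_def del: hcat.simps)
  qed
  then show ?thesis
    using col_space_row2[OF assms(2,3)] by (simp add: block_mat_def add.assoc del: hcat.simps)
qed

text \<open>With \<open>f u = (u, 0)\<close>, \<open>g v = (0, v)\<close> and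
  \<open>h w = (w, w)\<close>, the column space is the sum of the three images. The images of
  \<open>f\<close> and \<open>g\<close> are independent, and for \<open>w\<close> in the column
  space of \<open>D\<close> the vector \<open>(w, w)\<close> lies in their sum exactly if
  \<open>w\<close> lies in the triple intersection. So the rank is the sum of the three ranks minus
  the dimension of that intersection, which explains the formula for m1.\<close>

lemma qrank_pair:
  fixes B C D :: "quat mat"
  assumes B: "B \<in> carrier_mat m p1" and C: "C \<in> carrier_mat m p2" and D: "D \<in> carrier_mat m p3"
    and b: "rel_basis {0} (col_space B) I b" and c: "rel_basis {0} (col_space C) J c"
    and d: "rel_basis (col_space B \<inter> col_space C \<inter> col_space D) (col_space D) K d"
  shows "qrank (block_mat [[D, B, 0\<^sub>m m p2], [D, 0\<^sub>m m p1, C]]) = card I + card J + card K"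
proof -
  let ?M = "block_mat [[D, B, 0\<^sub>m m p2], [D, 0\<^sub>m m p1, C]]"
  let ?U = "col_space B" and ?V = "col_space C" and ?W = "col_space D"
  define f g h :: "(nat \<Rightarrow> quat) \<Rightarrow> nat \<Rightarrow> quat"
    where "f u = stack m u 0" and "g v = stack m 0 v" and "h w = stack m w w" for u v w
  have lin: "linear_fun f" "linear_fun g" "linear_fun h"
    by (auto simp: linear_fun_def f_def g_def h_def stack_def fun_eq_iff)
  have app: "mat_app ?M (stack p3 x (stack p1 y z))
    = f (mat_app B y) + g (mat_app C z) + h (mat_app D x)" for x y z
  proof -
    have "?M = hcat [D, B, 0\<^sub>m m p2] @\<^sub>r hcat [D, 0\<^sub>m m p1, C]"
      by (simp add: block_mat_def del: hcat.simps)
    then have "mat_app ?M (stack p3 x (stack p1 y z))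
      = stack m (mat_app D x + mat_app B y) (mat_app D x + mat_app C z)"
      using mat_app_append_rows[OF hcat_carrier3[OF D B zero_carrier_mat] hcat_carrier3[OF D zero_carrier_mat C]]
      by (simp add: mat_app_hcat3[OF D B zero_carrier_mat] mat_app_hcat3[OF D zero_carrier_mat C] del: hcat.simps)
    then show ?thesis by (simp add: f_def g_def h_def stack_def fun_eq_iff add.commute)
  qed
  have total: "col_space ?M = {0} + f ` ?U + g ` ?V + h ` ?W"
  proof (intro equalityI subsetI)
    fix u assume "u \<in> col_space ?M"
    then obtain t where t: "u = mat_app ?M t" by (auto simp: col_space_def)
    obtain x t' where "t = stack p3 x t'" by (rule stack_cases)
    moreover obtain y z where "t' = stack p1 y z" by (rule stack_cases)
    ultimately have "u = f (mat_app B y) + g (mat_app C z) + h (mat_app D x)" using t app by simp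
    then show "u \<in> {0} + f ` ?U + g ` ?V + h ` ?W"
      unfolding col_space_def by (auto intro!: set_plus_intro)
  next
    fix u assume "u \<in> {0} + f ` ?U + g ` ?V + h ` ?W"
    then obtain x y z where "u = f (mat_app B y) + g (mat_app C z) + h (mat_app D x)"
      by (auto simp: col_space_def elim!: set_plus_elim)
    then show "u \<in> col_space ?M" unfolding app[symmetric] col_space_def by blast
  qed
  note sub = rsubspace_col_space[of B] rsubspace_col_space[of C] rsubspace_col_space[of D]
  note E = col_space_subset[OF B] col_space_subset[OF C] col_space_subset[OF D]
  let ?X = "{0} + f ` ?U" and ?Y = "{0} + f ` ?U + g ` ?V"
  have sX: "rsubspace ?X" and sY: "rsubspace ?Y"
    by (intro rsubspace_plus rsubspace_zero rsubspace_image lin sub)+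
  have Xm: "z \<in> ?X \<longleftrightarrow> (\<exists>u\<in>?U. z = stack m u 0)" for z
    by (auto simp: f_def)
  have Ym: "z \<in> ?Y \<longleftrightarrow> (\<exists>u\<in>?U. \<exists>v\<in>?V. z = stack m u v)" for z
  proof -
    have "stack m u 0 + stack m 0 v = stack m u v" for u v :: "nat \<Rightarrow> quat"
      by (simp add: stack_def fun_eq_iff)
    then show ?thesis by (auto simp: f_def g_def elim!: set_plus_elim) (metis imageI set_plus_intro)
  qed
  have inj: "stack m u v = stack m u' v' \<longleftrightarrow> u = u' \<and> v = v'" if "u \<in> coord_space m" "u' \<in> coord_space m"
    for u u' v v' :: "nat \<Rightarrow> quat"
  proof -
    have "stack m u v - stack m u' v' = stack m (u - u') (v - v')"
      by (simp add: stack_def fun_eq_iff)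
    then show ?thesis
      using stack_eq_0_iff[of "u - u'" m "v - v'"] rsubspace_diff[OF rsubspace_coord_space that]
      by (metis right_minus_eq)
  qed
  have z0: "0 \<in> coord_space m" by (rule rsubspace_0[OF rsubspace_coord_space])
  have "rel_basis {0} ?X I (\<lambda>i. f (b i))"
  proof (rule rel_basis_image[OF lin(1) b rsubspace_zero sub(1)])
    show "x \<in> {0} \<longleftrightarrow> f x \<in> {0}" if "x \<in> ?U" for x
      using that E stack_eq_0_iff[of x m 0] by (auto simp: f_def)
  qed (use rsubspace_0[OF sub(1)] in auto)
  moreover have "rel_basis ?X ?Y J (\<lambda>i. g (c i))"
  proof (rule rel_basis_image[OF lin(2) c sX sub(2)])
    show "x \<in> {0} \<longleftrightarrow> g x \<in> ?X" if "x \<in> ?V" for x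
      using E(1) inj[OF z0] rsubspace_0[OF sub(1)] unfolding Xm g_def by blast
  qed (use rsubspace_0[OF sub(2)] in auto)
  ultimately have XY: "rel_basis {0} ?Y (I <+> J) (case_sum (\<lambda>i. f (b i)) (\<lambda>i. g (c i)))"
    by (rule rel_basis_trans_Plus[OF _ _ sX])
      (use rsubspace_0[OF sX] subset_plus_left[OF rsubspace_image[OF lin(2) sub(2)]] in auto)
  have "rel_basis ?Y (?Y + h ` ?W) K (\<lambda>i. h (d i))"
  proof (rule rel_basis_image[OF lin(3) d sY sub(3)])
    show "x \<in> ?U \<inter> ?V \<inter> ?W \<longleftrightarrow> h x \<in> ?Y" if x: "x \<in> ?W" for x
    proof -
      have "x \<in> coord_space m" using x E by blast
      then have "h x \<in> ?Y \<longleftrightarrow> (\<exists>u\<in>?U. \<exists>v\<in>?V. x = u \<and> x = v)"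
        unfolding Ym h_def using E(1) by (intro bex_cong refl) (simp add: inj subset_eq)
      then show ?thesis using x by auto
    qed
  qed auto
  with XY have "rel_basis {0} (?Y + h ` ?W) ((I <+> J) <+> K)
      (case_sum (case_sum (\<lambda>i. f (b i)) (\<lambda>i. g (c i))) (\<lambda>i. h (d i)))"
    by (rule rel_basis_trans_Plus[OF _ _ sY])
      (use rsubspace_0[OF sY] subset_plus_left[OF rsubspace_image[OF lin(3) sub(3)]] in auto)
  then have "qrank ?M = card ((I <+> J) <+> K)"
    unfolding total[symmetric] by (rule qrank_eq_card)
  then show ?thesis
    using rel_basis_finite[OF b] rel_basis_finite[OF c] rel_basis_finite[OF d]
    by (simp add: card_Plus)
qed

section \<open>Kernels of conjugate transposes and the bordered matrix\<close>

context quat_unit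
begin

text \<open>The standard form, that is \<open>form\<close> for the identity matrix. It expresses
  orthogonality to a column space.\<close>

definition pair :: "nat \<Rightarrow> (nat \<Rightarrow> quat) \<Rightarrow> (nat \<Rightarrow> quat) \<Rightarrow> quat" where
  "pair m u x = (\<Sum>i<m. eta_conj \<eta> (u i) * x i)"

lemma mat_app_eta_star:
  "B \<in> carrier_mat m p \<Longrightarrow> j < p \<Longrightarrow> mat_app (eta_star \<eta> B) x j = pair m (column B j) x"
  by (simp add: mat_app_apply pair_def column_def eta_star_index)

lemma pair_lincomb: "pair m (lincomb I b c) x = (\<Sum>i\<in>I. eta_conj \<eta> (c i) * pair m (b i) x)"
proof -
  have "pair m (lincomb I b c) x = (\<Sum>k<m. \<Sum>i\<in>I. eta_conj \<eta> (c i) * (eta_conj \<eta> (b i k) * x k))"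
    by (simp add: pair_def lincomb_apply eta_conj_sum eta_conj_mult sum_distrib_right mult.assoc)
  also have "\<dots> = (\<Sum>i\<in>I. eta_conj \<eta> (c i) * pair m (b i) x)"
    by (subst sum.swap) (simp add: pair_def sum_distrib_left)
  finally show ?thesis .
qed

lemma pair_unit_fun: "j < m \<Longrightarrow> pair m (unit_fun j) x = x j"
proof -
  assume j: "j < m"
  have "pair m (unit_fun j) x = (\<Sum>i<m. x i * unit_fun j i)"
    unfolding pair_def by (intro sum.cong) (auto simp: unit_fun_def)
  then show ?thesis using j by (simp add: sum_unit_fun)
qed

lemma pair_add: "pair m (u + v) x = pair m u x + pair m v x"
  by (simp add: pair_def eta_conj_add algebra_simps sum.distrib)

lemma pair_mat_app:
  assumes P: "P \<in> carrier_mat m m"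
  shows "pair m u (mat_app (eta_star \<eta> P) y) = pair m (mat_app P u) y"
proof -
  have "pair m u (mat_app (eta_star \<eta> P) y)
      = (\<Sum>i<m. \<Sum>j<m. eta_conj \<eta> (u i) * (eta_conj \<eta> (P $$ (j, i)) * y j))"
    using P eta_star_index[OF P] unfolding pair_def
    by (intro sum.cong) (auto simp: mat_app_apply sum_distrib_left)
  also have "\<dots> = pair m (mat_app P u) y"
    using P by (subst sum.swap)
      (simp add: pair_def mat_app_apply eta_conj_sum eta_conj_mult sum_distrib_right mult.assoc)
  finally show ?thesis .
qed

text \<open>The rows of \<open>eta_star \<eta> B\<close> are conjugated columns of \<open>B\<close>,
  so the kernel is the orthogonal complement of the column space. The conditions from several
  borders thus merge into orthogonality to the sum of their column spaces.\<close>

lemma eta_star_kernel: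
  assumes B: "B \<in> carrier_mat m p"
  shows "mat_app (eta_star \<eta> B) x = 0 \<longleftrightarrow> (\<forall>u\<in>col_space B. pair m u x = 0)"
proof
  assume "mat_app (eta_star \<eta> B) x = 0"
  then have "pair m (column B j) x = 0" if "j < p" for j
    using mat_app_eta_star[OF B that, of x] by simp
  then show "\<forall>u\<in>col_space B. pair m u x = 0"
    using B by (auto simp: col_space_def mat_app_def pair_lincomb)
next
  assume u: "\<forall>u\<in>col_space B. pair m u x = 0"
  show "mat_app (eta_star \<eta> B) x = 0"
  proof
    fix j
    show "mat_app (eta_star \<eta> B) x j = 0 j"
    proof (cases "j < p")
      case True
      then have "column B j \<in> col_space B"
        using mat_app_unit_fun[of j B] B unfolding col_space_def by (metis carrier_matD(2) rangeI)
      then show ?thesis using True mat_app_eta_star[OF B True] u by simp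
    next
      case False
      then show ?thesis using B by (simp add: mat_app_apply)
    qed
  qed
qed

end

context eta_hermitian
begin

text \<open>The subspace consists of the \<open>x\<close> for which the columns through
  \<open>A\<close>, combined with coefficients \<open>x\<close>, already lie in the span of the
  border columns. Its codimension is read off in the coordinates \<open>y\<close> with
  \<open>x = mat_app (eta_star \<eta> P) y\<close>: orthogonality to \<open>G\<close> says that the
  leading \<open>r\<close> entries of \<open>y\<close> vanish, and
  \<open>mat_app A x \<in> G\<close> then says that the last \<open>s\<close> vanish.\<close>

lemma bordered_kernel:
  assumes P: "P \<in> GL m" and r: "r + s \<le> m" and G: "G \<subseteq> coord_space m"
    and g: "rel_basis {0} G {..<r} g" and sG: "rsubspace G"
    and Pg: "\<And>j. j < r \<Longrightarrow> mat_app P (g j) = unit_fun j"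
    and zero: "\<And>i j. r \<le> i \<Longrightarrow> i < m \<Longrightarrow> r \<le> j \<Longrightarrow> j < m \<Longrightarrow> i \<noteq> j \<or> i < m - s \<Longrightarrow>
      (P * A * eta_star \<eta> P) $$ (i, j) = 0"
    and nz: "\<And>i. m - s \<le> i \<Longrightarrow> i < m \<Longrightarrow> (P * A * eta_star \<eta> P) $$ (i, i) \<noteq> 0"
  shows "\<exists>d. rel_basis {x \<in> coord_space m. (\<forall>u\<in>G. pair m u x = 0) \<and> mat_app A x \<in> G}
    (coord_space m) ({..<r} \<union> {m - s..<m}) d"
proof -
  let ?E = "coord_space m :: (nat \<Rightarrow> quat) set" and ?J = "{..<r} \<union> {m - s..<m}"
  let ?K = "{x \<in> ?E. (\<forall>u\<in>G. pair m u x = 0) \<and> mat_app A x \<in> G}"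
  let ?L = "{y \<in> ?E. \<forall>j\<in>?J. y j = 0}"
  let ?Q = "eta_star \<eta> P" and ?A = "P * A * eta_star \<eta> P"
  have Pc: "P \<in> carrier_mat m m" and Qc: "?Q \<in> carrier_mat m m"
    using P eta_star_carrier by (auto simp: GL_def)
  obtain P' where P': "P' \<in> carrier_mat m m" "P' * P = 1\<^sub>m m" using GL_inverse[OF P] by metis
  obtain Q' where Q': "Q' \<in> carrier_mat m m" "?Q * Q' = 1\<^sub>m m" using GL_inverse[OF eta_star_GL[OF P]] by metis
  have Plc: "mat_app P (lincomb {..<r} g c) = lincomb {..<r} unit_fun c" for c
    unfolding mat_app_lincomb by (rule lincomb_cong) (simp_all add: Pg)
  have lu: "lincomb {..<r} unit_fun c i = (if i < r then c i else 0)" for c :: "nat \<Rightarrow> quat" and i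
    by (auto simp: lincomb_apply sum_unit_fun, auto simp: unit_fun_def)
  have Gspan: "\<exists>c. u = lincomb {..<r} g c" if "u \<in> G" for u
    using rel_basis_span[OF g that] by simp
  have lG: "lincomb {..<r} g c \<in> G" for c
    by (rule rsubspace_lincomb[OF sG rel_basis_subset[OF g]])
  have pair_iff: "(\<forall>u\<in>G. pair m u (mat_app ?Q y) = 0) \<longleftrightarrow> (\<forall>j<r. y j = 0)" for y
  proof
    assume *: "\<forall>u\<in>G. pair m u (mat_app ?Q y) = 0"
    show "\<forall>j<r. y j = 0"
    proof safe
      fix j assume "j < r"
      then have "pair m (g j) (mat_app ?Q y) = 0" using * rel_basis_mem[OF g, of j] by simp
      then show "y j = 0" using \<open>j < r\<close> r by (simp add: pair_mat_app[OF Pc] Pg pair_unit_fun)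
    qed
  next
    assume *: "\<forall>j<r. y j = 0"
    show "\<forall>u\<in>G. pair m u (mat_app ?Q y) = 0"
    proof
      fix u assume "u \<in> G"
      then obtain c where u: "u = lincomb {..<r} g c" using Gspan by blast
      show "pair m u (mat_app ?Q y) = 0"
        unfolding u pair_mat_app[OF Pc] Plc using * r by (simp add: pair_lincomb pair_unit_fun)
    qed
  qed
  \<comment> \<open>\<open>P\<close> carries \<open>G\<close> onto the span of the leading
    \<open>r\<close> unit vectors, so membership is visible in the entries of
    \<open>mat_app P x\<close> from \<open>r\<close> on.\<close>
  have G_iff: "x \<in> G \<longleftrightarrow> (\<forall>i. r \<le> i \<longrightarrow> mat_app P x i = 0)" if x: "x \<in> ?E" for x
  proof
    assume "x \<in> G"
    then obtain c where "x = lincomb {..<r} g c" using Gspan by blast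
    then show "\<forall>i. r \<le> i \<longrightarrow> mat_app P x i = 0" by (simp add: Plc lu)
  next
    assume "\<forall>i. r \<le> i \<longrightarrow> mat_app P x i = 0"
    then have "mat_app P x = mat_app P (lincomb {..<r} g (mat_app P x))"
      unfolding Plc by (auto simp: fun_eq_iff lu)
    then have "mat_app P' (mat_app P x) = mat_app P' (mat_app P (lincomb {..<r} g (mat_app P x)))"
      by (rule arg_cong)
    moreover have "lincomb {..<r} g (mat_app P x) \<in> ?E" using lG G by blast
    ultimately have "x = lincomb {..<r} g (mat_app P x)"
      unfolding mat_app_mult[OF P'(1) Pc, symmetric] P'(2) using x by (simp add: mat_app_one)
    then show "x \<in> G" using lG by metis
  qed
  have AQ: "mat_app A (mat_app ?Q y) \<in> G \<longleftrightarrow> (\<forall>i. r \<le> i \<longrightarrow> mat_app ?A y i = 0)" for y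
  proof -
    have "mat_app A (mat_app ?Q y) \<in> ?E" using mat_app_in_coord_space[of A] A by auto
    moreover have "mat_app ?A y = mat_app P (mat_app A (mat_app ?Q y))"
      using mat_app_mult[OF mult_carrier_mat[OF Pc A] Qc] mat_app_mult[OF Pc A] by simp
    ultimately show ?thesis by (simp add: G_iff)
  qed
  have Ac: "?A \<in> carrier_mat m m" using Pc A Qc by (auto intro: mult_carrier_mat)
  \<comment> \<open>In the rows from \<open>r\<close> on, a \<open>y\<close> vanishing below
    \<open>r\<close> meets only the diagonal entries of the last \<open>s\<close> rows, and these
    are nonzero.\<close>
  have A_iff: "(\<forall>i. r \<le> i \<longrightarrow> mat_app ?A y i = 0) \<longleftrightarrow> (\<forall>j\<in>{m - s..<m}. y j = 0)"
    if y: "\<forall>j<r. y j = 0" for y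
  proof -
    have val: "mat_app ?A y i = (if m - s \<le> i then ?A $$ (i, i) * y i else 0)"
      if i: "r \<le> i" "i < m" for i
    proof -
      have "(\<Sum>j\<in>{..<m} - {i}. ?A $$ (i, j) * y j) = 0"
      proof (rule sum.neutral, rule ballI)
        fix j assume "j \<in> {..<m} - {i}"
        then show "?A $$ (i, j) * y j = 0" using zero[of i j] y i by (cases "j < r") auto
      qed
      then have "mat_app ?A y i = ?A $$ (i, i) * y i"
        using Ac i by (simp add: mat_app_apply sum.remove[of _ i] del: index_mult_mat)
      then show ?thesis using zero[of i i] i by simp
    qed
    show ?thesis
    proof
      assume *: "\<forall>i. r \<le> i \<longrightarrow> mat_app ?A y i = 0"
      show "\<forall>j\<in>{m - s..<m}. y j = 0"
      proof
        fix j assume j: "j \<in> {m - s..<m}"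
        then have "r \<le> j" using r by auto
        then show "y j = 0" using val[of j] nz[of j] * j by simp
      qed
    next
      assume *: "\<forall>j\<in>{m - s..<m}. y j = 0"
      show "\<forall>i. r \<le> i \<longrightarrow> mat_app ?A y i = 0"
      proof safe
        fix i assume "r \<le> i"
        then show "mat_app ?A y i = 0"
          using val[of i] * mat_app_in_coord_space[of ?A y] Ac
          by (cases "i < m") (auto simp: coord_space_def simp del: index_mult_mat)
      qed
    qed
  qed
  have K_iff: "y \<in> ?L \<longleftrightarrow> mat_app ?Q y \<in> ?K" if "y \<in> ?E" for y
  proof -
    have "mat_app ?Q y \<in> ?E" using mat_app_in_coord_space[of ?Q] Qc by auto
    then have "mat_app ?Q y \<in> ?K \<longleftrightarrow> (\<forall>j<r. y j = 0) \<and> (\<forall>j\<in>{m - s..<m}. y j = 0)"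
      unfolding mem_Collect_eq pair_iff AQ using A_iff[of y] by blast
    then show ?thesis using that by auto
  qed
  have unitE: "unit_fun j \<in> ?E" if "j < m" for j using that by (auto simp: unit_fun_def coord_space_def)
  have fJ: "finite ?J" and Jm: "j < m" if "j \<in> ?J" for j using that r by auto
  have luJ: "lincomb ?J unit_fun c i = (if i \<in> ?J then c i else 0)" for c :: "nat \<Rightarrow> quat" and i
  proof -
    have "lincomb ?J unit_fun c i = (\<Sum>j\<in>?J. if j = i then c j else 0)"
      unfolding lincomb_apply by (rule sum.cong) (auto simp: unit_fun_def)
    then show ?thesis by (simp add: sum.delta)
  qed
  have L: "rel_basis ?L ?E ?J unit_fun"
    unfolding rel_basis_def
  proof (intro conjI allI ballI impI)
    show "unit_fun ` ?J \<subseteq> ?E" using unitE r by auto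
    show "\<exists>c. y - lincomb ?J unit_fun c \<in> ?L" if y: "y \<in> ?E" for y
    proof -
      have "y - lincomb ?J unit_fun y \<in> ?E"
        using unitE r by (intro rsubspace_diff[OF rsubspace_coord_space y]
          rsubspace_lincomb[OF rsubspace_coord_space]) auto
      then have "y - lincomb ?J unit_fun y \<in> ?L" by (simp add: luJ)
      then show ?thesis by blast
    qed
    show "c i = 0" if "lincomb ?J unit_fun c \<in> ?L" "i \<in> ?J" for c i
    proof -
      have "lincomb ?J unit_fun c i = 0" using that by blast
      then show ?thesis using that(2) by (simp only: luJ if_True)
    qed
  qed simp
  have pair0: "pair m u 0 = 0" "pair m u (x + y) = pair m u x + pair m u y"
    "pair m u (scl x c) = pair m u x * c" for u x y c
    by (simp_all add: pair_def algebra_simps sum.distrib sum_distrib_left sum_distrib_right)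
  have sK: "rsubspace ?K"
    using rsubspace_coord_space[of m] sG unfolding rsubspace_def
    by (auto simp only: mem_Collect_eq pair0 mat_app_zero mat_app_add mat_app_scl add_0 mult_zero_left)
  have lin: "linear_fun (mat_app ?Q)" by (simp add: linear_fun_def mat_app_add mat_app_scl)
  \<comment> \<open>The unit vectors complementary to \<open>?L\<close> are transported to a basis
    modulo \<open>?K\<close>; as \<open>eta_star \<eta> P\<close> is onto, nothing is lost.\<close>
  have "rel_basis ?K (?K + mat_app ?Q ` ?E) ?J (\<lambda>j. mat_app ?Q (unit_fun j))"
    by (rule rel_basis_image[OF lin L sK rsubspace_coord_space K_iff]) auto
  moreover have "?K + mat_app ?Q ` ?E = ?E"
  proof (intro equalityI subsetI)
    fix x assume "x \<in> ?K + mat_app ?Q ` ?E"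
    then show "x \<in> ?E"
      using mat_app_in_coord_space[of ?Q] Qc
      by (auto elim!: set_plus_elim intro!: rsubspace_add[OF rsubspace_coord_space])
  next
    fix x assume x: "x \<in> ?E"
    have "x = mat_app ?Q (mat_app Q' x)"
      unfolding mat_app_mult[OF Qc Q'(1), symmetric] Q'(2) using x by (simp add: mat_app_one)
    moreover have "mat_app Q' x \<in> ?E" using mat_app_in_coord_space[of Q'] Q'(1) by auto
    ultimately have "x \<in> mat_app ?Q ` ?E" by blast
    then show "x \<in> ?K + mat_app ?Q ` ?E" using subset_plus_right[OF sK] by blast
  qed
  ultimately show ?thesis by metis
qed

text \<open>The border columns through B, C, D contribute their rank \<open>r\<close>. The columns
  through A add the codimension \<open>r + s\<close> of the subspace in
  \<open>bordered_kernel\<close>, where \<open>r\<close> comes from the lower border and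
  \<open>s\<close> from the nonsingular diagonal part.\<close>

lemma qrank_bordered:
  assumes P: "P \<in> GL m" and r: "r + s \<le> m"
    and B: "B \<in> carrier_mat m p1" and C: "C \<in> carrier_mat m p2" and D: "D \<in> carrier_mat m p3"
    and g: "rel_basis {0} (col_space B + col_space C + col_space D) {..<r} g"
    and Pg: "\<And>j. j < r \<Longrightarrow> mat_app P (g j) = unit_fun j"
    and zero: "\<And>i j. r \<le> i \<Longrightarrow> i < m \<Longrightarrow> r \<le> j \<Longrightarrow> j < m \<Longrightarrow> i \<noteq> j \<or> i < m - s \<Longrightarrow>
      (P * A * eta_star \<eta> P) $$ (i, j) = 0"
    and nz: "\<And>i. m - s \<le> i \<Longrightarrow> i < m \<Longrightarrow> (P * A * eta_star \<eta> P) $$ (i, i) \<noteq> 0"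
  shows "qrank (block_mat [[A, B, C, D],
      [eta_star \<eta> B, 0\<^sub>m p1 p1, 0\<^sub>m p1 p2, 0\<^sub>m p1 p3],
      [eta_star \<eta> C, 0\<^sub>m p2 p1, 0\<^sub>m p2 p2, 0\<^sub>m p2 p3],
      [eta_star \<eta> D, 0\<^sub>m p3 p1, 0\<^sub>m p3 p2, 0\<^sub>m p3 p3]]) = 2 * r + s"
proof -
  let ?B = "eta_star \<eta> B" and ?C = "eta_star \<eta> C" and ?D = "eta_star \<eta> D"
  let ?G = "col_space B + col_space C + col_space D" and ?E = "coord_space m :: (nat \<Rightarrow> quat) set"
  let ?M = "block_mat [[A, B, C, D], [?B, 0\<^sub>m p1 p1, 0\<^sub>m p1 p2, 0\<^sub>m p1 p3],
      [?C, 0\<^sub>m p2 p1, 0\<^sub>m p2 p2, 0\<^sub>m p2 p3], [?D, 0\<^sub>m p3 p1, 0\<^sub>m p3 p2, 0\<^sub>m p3 p3]]"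
  let ?K = "{x \<in> ?E. (\<forall>u\<in>?G. pair m u x = 0) \<and> mat_app A x \<in> ?G}"
  note sub = rsubspace_col_space[of B] rsubspace_col_space[of C] rsubspace_col_space[of D]
  have sG: "rsubspace ?G" by (intro rsubspace_plus sub)
  have GE: "?G \<subseteq> ?E"
    using col_space_subset[OF B] col_space_subset[OF C] col_space_subset[OF D]
    by (intro plus_subset rsubspace_coord_space)
  obtain d where d: "rel_basis ?K ?E ({..<r} \<union> {m - s..<m}) d"
    using bordered_kernel[OF P r GE g sG Pg zero nz] by blast
  define f where "f u = stack m u 0" for u :: "nat \<Rightarrow> quat"
  \<comment> \<open>The three lower blocks as one vector, which vanishes exactly on the orthogonal
    complement of \<open>?G\<close>.\<close>
  define l where "l x = stack p1 (mat_app ?B x) (stack p2 (mat_app ?C x) (mat_app ?D x))" for x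
  define h where "h x = stack m (mat_app A x) (l x)" for x
  have lin: "linear_fun f" "linear_fun h"
    by (simp_all add: linear_fun_def f_def h_def l_def mat_app_add mat_app_scl stack_add stack_scl)
      (simp add: stack_def fun_eq_iff)
  note c = eta_star_carrier[OF B] eta_star_carrier[OF C] eta_star_carrier[OF D]
  have app: "mat_app ?M (stack m x (stack p1 a (stack p2 b c)))
      = f (mat_app B a + mat_app C b + mat_app D c) + h x" for x a b c
  proof -
    have M: "?M = hcat [A, B, C, D] @\<^sub>r hcat [?B, 0\<^sub>m p1 p1, 0\<^sub>m p1 p2, 0\<^sub>m p1 p3] @\<^sub>r
        hcat [?C, 0\<^sub>m p2 p1, 0\<^sub>m p2 p2, 0\<^sub>m p2 p3] @\<^sub>r hcat [?D, 0\<^sub>m p3 p1, 0\<^sub>m p3 p2, 0\<^sub>m p3 p3]"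
      by (simp add: block_mat_def del: hcat.simps)
    note z = zero_carrier_mat
    note h1 = hcat_carrier4[OF A B C D] and h2 = hcat_carrier4[OF c(1) z z z]
      and h3 = hcat_carrier4[OF c(2) z z z] and h4 = hcat_carrier4[OF c(3) z z z]
    note a34 = mat_app_append_rows[OF h3 h4] and c34 = carrier_append_rows[OF h3 h4]
    note a24 = mat_app_append_rows[OF h2 c34] and c24 = carrier_append_rows[OF h2 c34]
    note a14 = mat_app_append_rows[OF h1 c24]
    have "mat_app ?M (stack m x (stack p1 a (stack p2 b c)))
      = stack m (mat_app A x + (mat_app B a + (mat_app C b + mat_app D c))) (l x)"
      unfolding M a14 a24 a34 mat_app_hcat4[OF A B C D] mat_app_hcat4[OF c(1) z z z]
        mat_app_hcat4[OF c(2) z z z] mat_app_hcat4[OF c(3) z z z] by (simp add: l_def)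
    then show ?thesis by (simp add: f_def h_def stack_add[symmetric] add.commute add.left_commute)
  qed
  have total: "col_space ?M = {0} + f ` ?G + h ` ?E"
  proof (intro equalityI subsetI)
    fix u assume "u \<in> col_space ?M"
    then obtain t where t: "u = mat_app ?M t" by (auto simp: col_space_def)
    obtain x t' where x: "t = stack m x t'" "x \<in> ?E" by (rule stack_cases)
    moreover obtain a t'' where "t' = stack p1 a t''" by (rule stack_cases)
    moreover obtain b c where "t'' = stack p2 b c" by (rule stack_cases)
    ultimately have "u = f (mat_app B a + mat_app C b + mat_app D c) + h x" using t app by simp
    moreover have "mat_app B a + mat_app C b + mat_app D c \<in> ?G"
      unfolding col_space_def by (intro set_plus_intro rangeI)
    ultimately show "u \<in> {0} + f ` ?G + h ` ?E" using x(2) by auto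
  next
    fix u assume "u \<in> {0} + f ` ?G + h ` ?E"
    then obtain w x where u: "u = f w + h x" "w \<in> ?G" by (auto elim!: set_plus_elim)
    then obtain a b c where "w = mat_app B a + mat_app C b + mat_app D c"
      unfolding col_space_def by (auto elim!: set_plus_elim)
    then have "u = mat_app ?M (stack m x (stack p1 a (stack p2 b c)))" using u app by simp
    then show "u \<in> col_space ?M" unfolding col_space_def by blast
  qed
  let ?X = "{0} + f ` ?G"
  have sX: "rsubspace ?X" by (intro rsubspace_plus rsubspace_zero rsubspace_image lin sG)
  have X: "rel_basis {0} ?X {..<r} (\<lambda>i. f (g i))"
  proof (rule rel_basis_image[OF lin(1) g rsubspace_zero sG])
    show "x \<in> {0} \<longleftrightarrow> f x \<in> {0}" if "x \<in> ?G" for x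
      using that GE stack_eq_0_iff[of x m 0] by (auto simp: f_def)
  qed (use rsubspace_0[OF sG] in auto)
  have Aim: "mat_app A x \<in> ?E" for x using mat_app_in_coord_space[of A] A by auto
  have l0: "l x = 0 \<longleftrightarrow> (\<forall>u\<in>?G. pair m u x = 0)" for x
  proof -
    have "l x = 0 \<longleftrightarrow> mat_app ?B x = 0 \<and> mat_app ?C x = 0 \<and> mat_app ?D x = 0"
      using mat_app_in_coord_space[of ?B x] mat_app_in_coord_space[of ?C x] B C
      by (simp only: l_def stack_eq_0_iff eta_star_dim carrier_matD)
    also have "\<dots> \<longleftrightarrow> (\<forall>u\<in>?G. pair m u x = 0)"
      unfolding eta_star_kernel[OF B] eta_star_kernel[OF C] eta_star_kernel[OF D]
    proof (intro iffI conjI ballI)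
      have B': "col_space B \<subseteq> ?G" "col_space C \<subseteq> ?G" "col_space D \<subseteq> ?G"
        using order_trans[OF subset_plus_left[OF sub(2)] subset_plus_left[OF sub(3)]]
          order_trans[OF subset_plus_right[OF sub(1)] subset_plus_left[OF sub(3)]]
          subset_plus_right[OF rsubspace_plus[OF sub(1,2)]] by simp_all
      show "pair m u x = 0" if "\<forall>u\<in>?G. pair m u x = 0" "u \<in> col_space B" for u using that B' by blast
      show "pair m u x = 0" if "\<forall>u\<in>?G. pair m u x = 0" "u \<in> col_space C" for u using that B' by blast
      show "pair m u x = 0" if "\<forall>u\<in>?G. pair m u x = 0" "u \<in> col_space D" for u using that B' by blast
    qed (auto elim!: set_plus_elim simp: pair_add)
    finally show ?thesis .
  qed
  have "rel_basis ?X (?X + h ` ?E) ({..<r} \<union> {m - s..<m}) (\<lambda>i. h (d i))"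
  proof (rule rel_basis_image[OF lin(2) d sX rsubspace_coord_space])
    show "x \<in> ?K \<longleftrightarrow> h x \<in> ?X" if x: "x \<in> ?E" for x
    proof
      assume "x \<in> ?K"
      then have "l x = 0" "mat_app A x \<in> ?G" unfolding l0 by blast+
      then have "h x \<in> f ` ?G" by (simp add: h_def f_def)
      then show "h x \<in> ?X" by simp
    next
      assume "h x \<in> ?X"
      then obtain w where w: "w \<in> ?G" "h x = f w" by auto
      have "h x - f w = stack m (mat_app A x - w) (l x)" by (simp add: h_def f_def stack_def fun_eq_iff)
      moreover have "mat_app A x - w \<in> ?E" using Aim GE w by (intro rsubspace_diff[OF rsubspace_coord_space]) auto
      ultimately have "mat_app A x - w = 0 \<and> l x = 0"
        using w(2) stack_eq_0_iff[of "mat_app A x - w" m "l x"] by simp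
      then show "x \<in> ?K" using x w(1) l0 by simp
    qed
  qed auto
  with X have "rel_basis {0} (?X + h ` ?E) ({..<r} <+> ({..<r} \<union> {m - s..<m}))
      (case_sum (\<lambda>i. f (g i)) (\<lambda>i. h (d i)))"
    by (rule rel_basis_trans_Plus[OF _ _ sX])
      (use rsubspace_0[OF sX] subset_plus_left[OF rsubspace_image[OF lin(2) rsubspace_coord_space]] in auto)
  then have "qrank ?M = card ({..<r} <+> ({..<r} \<union> {m - s..<m}))"
    unfolding total[symmetric] by (rule qrank_eq_card)
  also have "\<dots> = 2 * r + s"
    using r by (simp add: card_Plus) (subst card_Un_disjoint, auto)
  finally show ?thesis .
qed

end

section \<open>The canonical form\<close>

lemma block_column_eqI:
  assumes "M \<in> carrier_mat m p" "S \<in> carrier_mat m p" and p: "p = sum_list cs"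
    and col: "\<And>l j. l < length cs \<Longrightarrow> j < cs ! l \<Longrightarrow>
      column M (offset cs l + j) = column S (offset cs l + j)"
  shows "M = S"
proof (rule eq_mat_columnI[OF assms(1,2)])
  fix J assume "J < p"
  then obtain l j where "l < length cs" "j < cs ! l" "J = offset cs l + j"
    unfolding p by (rule offset_cases)
  then show "column M J = column S J" using col by simp
qed

lemma less_6_cases: "l < 6 \<Longrightarrow> l = 0 \<or> l = 1 \<or> l = 2 \<or> l = 3 \<or> l = 4 \<or> l = (5::nat)"
  by linarith

lemma less_11_cases:
  "k < 11 \<Longrightarrow> k = 0 \<or> k = 1 \<or> k = 2 \<or> k = 3 \<or> k = 4 \<or> k = 5 \<or> k = 6 \<or> k = 7 \<or> k = 8
    \<or> k = 9 \<or> k = (10::nat)"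
  by presburger

text \<open>The set in \<open>?p\<close> lists the positions of the identity blocks, block row and
  block column counted from 0; the other two forms are treated in the same way.\<close>

lemma form_B_columns:
  assumes rs: "rs = [m1, m2, m3, m4, m5, m4, m6, m7, m8, t, s]" and cs: "cs = [m1, m2, m3, m4, m5, q]"
  shows "form_B rs cs \<in> carrier_mat (sum_list rs) (sum_list cs)"
    and "\<And>l j. l < 6 \<Longrightarrow> j < cs ! l \<Longrightarrow> column (form_B rs cs) (offset cs l + j) = (if l < 5 then unit_fun (offset rs l + j) else 0)"
proof -
  let ?p = "\<lambda>k l. (k, l) \<in> {(0, 0), (1, 1), (2, 2), (3, 3), (4, 4) :: nat \<times> nat}"
  have len: "length rs = 11" "length cs = 6" by (simp_all add: rs cs)
  obtain Fss where Fss: "form_B rs cs = sized_block_mat rs cs Fss" "length Fss = length rs"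
    "\<And>k. k < length rs \<Longrightarrow> length (Fss ! k) = length cs"
    "\<And>k l. k < length rs \<Longrightarrow> l < length cs \<Longrightarrow> Fss ! k ! l = (if ?p k l then (\<lambda>r c. 1\<^sub>m r) else 0\<^sub>m)"
  proof (rule that[OF form_B_def[unfolded Let_def]], goal_cases)
    case (2 k)
    then have "k < 11" by (simp add: len)
    from less_11_cases[OF this] show ?case unfolding len by (elim disjE) simp_all
  next
    case (3 k l)
    then have "k < 11" "l < 6" by (simp_all add: len)
    from less_11_cases[OF this(1)] less_6_cases[OF this(2)] show ?case by (elim disjE) simp_all
  qed (simp add: rs)
  have sq: "rs ! k = cs ! l" if "?p k l" for k l
    using that unfolding rs cs by (elim insertE) simp_all
  have ne: "rs \<noteq> []" "cs \<noteq> []" by (simp_all add: rs cs)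
  note pat = pattern_columns[OF ne Fss(2,3,4) sq]
  show "form_B rs cs \<in> carrier_mat (sum_list rs) (sum_list cs)"
    unfolding Fss(1) by (rule pat(1))
  fix l j assume l: "l < 6" "j < cs ! l"
  have eq: "column (form_B rs cs) (offset cs l + j) = (\<Sum>k | k < length rs \<and> ?p k l. unit_fun (offset rs k + j))"
    unfolding Fss(1) by (rule pat(2)) (use l len in simp_all)
  have set: "{k. k < length rs \<and> ?p k l} = (if l < 5 then {l} else {})"
    using less_6_cases[OF l(1)] unfolding len by (elim disjE) auto
  show "column (form_B rs cs) (offset cs l + j) = (if l < 5 then unit_fun (offset rs l + j) else 0)"
    using less_6_cases[OF l(1)] unfolding eq set by (elim disjE) simp_all
qed

lemma form_C_columns:
  assumes rs: "rs = [m1, m2, m3, m4, m5, m4, m6, m7, m8, t, s]" and cs: "cs = [m4, m6, m7, m1, m2, q]"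
  shows "form_C rs cs \<in> carrier_mat (sum_list rs) (sum_list cs)"
    and "\<And>l j. l < 6 \<Longrightarrow> j < cs ! l \<Longrightarrow> column (form_C rs cs) (offset cs l + j) = (if l < 5 then unit_fun (offset rs ([5, 6, 7, 0, 1] ! l) + j) else 0)"
proof -
  let ?p = "\<lambda>k l. (k, l) \<in> {(5, 0), (6, 1), (7, 2), (0, 3), (1, 4) :: nat \<times> nat}"
  have len: "length rs = 11" "length cs = 6" by (simp_all add: rs cs)
  obtain Fss where Fss: "form_C rs cs = sized_block_mat rs cs Fss" "length Fss = length rs"
    "\<And>k. k < length rs \<Longrightarrow> length (Fss ! k) = length cs"
    "\<And>k l. k < length rs \<Longrightarrow> l < length cs \<Longrightarrow> Fss ! k ! l = (if ?p k l then (\<lambda>r c. 1\<^sub>m r) else 0\<^sub>m)"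
  proof (rule that[OF form_C_def[unfolded Let_def]], goal_cases)
    case (2 k)
    then have "k < 11" by (simp add: len)
    from less_11_cases[OF this] show ?case unfolding len by (elim disjE) simp_all
  next
    case (3 k l)
    then have "k < 11" "l < 6" by (simp_all add: len)
    from less_11_cases[OF this(1)] less_6_cases[OF this(2)] show ?case by (elim disjE) simp_all
  qed (simp add: rs)
  have sq: "rs ! k = cs ! l" if "?p k l" for k l
    using that unfolding rs cs by (elim insertE) simp_all
  have ne: "rs \<noteq> []" "cs \<noteq> []" by (simp_all add: rs cs)
  note pat = pattern_columns[OF ne Fss(2,3,4) sq]
  show "form_C rs cs \<in> carrier_mat (sum_list rs) (sum_list cs)"
    unfolding Fss(1) by (rule pat(1))
  fix l j assume l: "l < 6" "j < cs ! l"
  have eq: "column (form_C rs cs) (offset cs l + j) = (\<Sum>k | k < length rs \<and> ?p k l. unit_fun (offset rs k + j))"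
    unfolding Fss(1) by (rule pat(2)) (use l len in simp_all)
  have set: "{k. k < length rs \<and> ?p k l} = (if l < 5 then {[5, 6, 7, 0, 1] ! l} else {})"
    using less_6_cases[OF l(1)] unfolding len by (elim disjE) auto
  show "column (form_C rs cs) (offset cs l + j) = (if l < 5 then unit_fun (offset rs ([5, 6, 7, 0, 1] ! l) + j) else 0)"
    using less_6_cases[OF l(1)] unfolding eq set by (elim disjE) simp_all
qed

text \<open>Block column 1 has its identity blocks in block rows 3 and 5, counted from 0. These are
  the two rows of size \<open>m4\<close>, and the sum of unit vectors is to be the image of a
  diagonal vector.\<close>

lemma form_D_columns:
  assumes rs: "rs = [m1, m2, m3, m4, m5, m4, m6, m7, m8, t, s]" and cs: "cs = [m8, m4, m6, m3, m1, q]"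
  shows "form_D rs cs \<in> carrier_mat (sum_list rs) (sum_list cs)"
    and "\<And>l j. l < 6 \<Longrightarrow> j < cs ! l \<Longrightarrow> column (form_D rs cs) (offset cs l + j) = (if l = 1 then unit_fun (offset rs 3 + j) + unit_fun (offset rs 5 + j)
        else if l < 5 then unit_fun (offset rs ([8, 3, 6, 2, 0] ! l) + j) else 0)"
proof -
  let ?p = "\<lambda>k l. (k, l) \<in> {(8, 0), (3, 1), (5, 1), (6, 2), (2, 3), (0, 4) :: nat \<times> nat}"
  have len: "length rs = 11" "length cs = 6" by (simp_all add: rs cs)
  obtain Fss where Fss: "form_D rs cs = sized_block_mat rs cs Fss" "length Fss = length rs"
    "\<And>k. k < length rs \<Longrightarrow> length (Fss ! k) = length cs"
    "\<And>k l. k < length rs \<Longrightarrow> l < length cs \<Longrightarrow> Fss ! k ! l = (if ?p k l then (\<lambda>r c. 1\<^sub>m r) else 0\<^sub>m)"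
  proof (rule that[OF form_D_def[unfolded Let_def]], goal_cases)
    case (2 k)
    then have "k < 11" by (simp add: len)
    from less_11_cases[OF this] show ?case unfolding len by (elim disjE) simp_all
  next
    case (3 k l)
    then have "k < 11" "l < 6" by (simp_all add: len)
    from less_11_cases[OF this(1)] less_6_cases[OF this(2)] show ?case by (elim disjE) simp_all
  qed (simp add: rs)
  have sq: "rs ! k = cs ! l" if "?p k l" for k l
    using that unfolding rs cs by (elim insertE) simp_all
  have ne: "rs \<noteq> []" "cs \<noteq> []" by (simp_all add: rs cs)
  note pat = pattern_columns[OF ne Fss(2,3,4) sq]
  show "form_D rs cs \<in> carrier_mat (sum_list rs) (sum_list cs)"
    unfolding Fss(1) by (rule pat(1))
  fix l j assume l: "l < 6" "j < cs ! l"
  have eq: "column (form_D rs cs) (offset cs l + j) = (\<Sum>k | k < length rs \<and> ?p k l. unit_fun (offset rs k + j))"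
    unfolding Fss(1) by (rule pat(2)) (use l len in simp_all)
  have set: "{k. k < length rs \<and> ?p k l} = (if l = 1 then {3, 5} else if l < 5 then {[8, 3, 6, 2, 0] ! l} else {})"
    using less_6_cases[OF l(1)] unfolding len by (elim disjE) auto
  show "column (form_D rs cs) (offset cs l + j) = (if l = 1 then unit_fun (offset rs 3 + j) + unit_fun (offset rs 5 + j)
        else if l < 5 then unit_fun (offset rs ([8, 3, 6, 2, 0] ! l) + j) else 0)"
    using less_6_cases[OF l(1)] unfolding eq set by (elim disjE) simp_all
qed


lemma block_enum_append: "j < sum_list (map n K) \<Longrightarrow> block_enum n (K @ L) j = block_enum n K j"
  by (induction K arbitrary: j) auto

lemma offset_less_offset: "k < l \<Longrightarrow> l \<le> length ns \<Longrightarrow> i < ns ! k \<Longrightarrow> offset ns k + i < offset ns l"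
  using offset_less[of k "take l ns" i] by (simp add: offset_def min_absorb1)

lemma offset_6_5: "offset [a1, a2, a3, a4, a5, a6] 5 = a1 + (a2 + (a3 + (a4 + a5)))"
  by (simp add: offset_def)

text \<open>Every vector is \<open>M\<close> applied to its image under the inverse, so the column
  space is everything.\<close>

lemma qrank_GL:
  assumes "M \<in> GL n"
  shows "qrank M = n"
proof -
  obtain N where M: "M \<in> carrier_mat n n" "N \<in> carrier_mat n n" "M * N = 1\<^sub>m n"
    using GL_inverse[OF assms] by metis
  have "col_space M = coord_space n"
  proof (intro equalityI subsetI)
    fix x :: "nat \<Rightarrow> quat" assume "x \<in> coord_space n"
    then have "x = mat_app M (mat_app N x)"
      by (simp add: mat_app_mult[OF M(1,2), symmetric] M(3) mat_app_one)
    then show "x \<in> col_space M" unfolding col_space_def by blast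
  qed (use col_space_subset[OF M(1)] in blast)
  then have "rel_basis {0} (col_space M) {..<n} unit_fun" by (simp add: standard_basis)
  from qrank_eq_card[OF this] show ?thesis by simp
qed

lemma diagonal_GL:
  fixes d :: "nat \<Rightarrow> quat"
  assumes "\<And>i. i < n \<Longrightarrow> d i \<noteq> 0"
  shows "mat n n (\<lambda>(i, j). if i = j then d i else 0) \<in> GL n"
proof (rule GL_intro)
  let ?D = "\<lambda>d. mat n n (\<lambda>(i, j). if i = j then d i else 0) :: quat mat"
  have "?D d * ?D e = 1\<^sub>m n" if "\<And>i. i < n \<Longrightarrow> d i * e i = 1" for d e
  proof (rule eq_mat_columnI[of _ n n])
    have col: "column (?D f) j = scl (unit_fun j) (f j)" if "j < n" for f j
      using that by (auto simp: column_def unit_fun_def fun_eq_iff)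
    fix j assume j: "j < n"
    have "column (?D d * ?D e) j = mat_app (?D d) (column (?D e) j)"
      by (rule column_mult[OF _ _ j]) (rule mat_carrier)+
    also have "\<dots> = scl (column (?D d) j) (e j)"
      using j unfolding col[OF j, of e] mat_app_scl by (subst mat_app_unit_fun) simp_all
    also have "\<dots> = column (1\<^sub>m n) j"
      using that[OF j] j unfolding col[OF j, of d] by (auto simp: column_def unit_fun_def fun_eq_iff)
    finally show "column (?D d * ?D e) j = column (1\<^sub>m n) j" .
  qed (auto intro: mult_carrier_mat[of _ n n])
  then show "?D d * ?D (\<lambda>i. inverse (d i)) = 1\<^sub>m n" "?D (\<lambda>i. inverse (d i)) * ?D d = 1\<^sub>m n"
    using assms by simp_all
qed (rule mat_carrier)+

context quat_unit
begin

lemma eta_star_congruence: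
  assumes P: "P \<in> carrier_mat n m" and A: "A \<in> carrier_mat m m" "eta_star \<eta> A = A"
  shows "eta_star \<eta> (P * A * eta_star \<eta> P) = P * A * eta_star \<eta> P"
proof -
  note eP = eta_star_carrier[OF P]
  have "eta_star \<eta> (P * A * eta_star \<eta> P) = P * (eta_star \<eta> A * eta_star \<eta> P)"
    unfolding eta_star_mult[OF mult_carrier_mat[OF P A(1)] eP] eta_star_mult[OF P A(1)] eta_star_eta_star ..
  then show ?thesis by (simp only: A(2) assoc_mult_mat[OF P A(1) eP])
qed

text \<open>Zeros are required only in the last block column and in the tenth diagonal block; the
  symmetry of \<open>S\<close> supplies the last block row, just as \<open>form_A\<close> fills its
  lower triangle by \<open>eta_star\<close> of the upper one. Blocks are numbered from 1 and lists
  from 0, whence \<open>k - 1\<close>.\<close>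

lemma form_A_eq:
  assumes S: "S \<in> carrier_mat m m" "eta_star \<eta> S = S" and m: "m = sum_list ns" and len: "length ns = 11"
    and z10: "\<And>i j. i < offset ns 10 \<Longrightarrow> offset ns 10 \<le> j \<Longrightarrow> j < m \<Longrightarrow> S $$ (i, j) = 0"
    and z9: "\<And>i j. offset ns 9 \<le> i \<Longrightarrow> i < offset ns 10 \<Longrightarrow> offset ns 9 \<le> j \<Longrightarrow> j < offset ns 10 \<Longrightarrow>
      S $$ (i, j) = 0"
    and F: "\<And>k l. F k l = mat (ns ! (k - 1)) (ns ! (l - 1))
      (\<lambda>(i, j). S $$ (offset ns (k - 1) + i, offset ns (l - 1) + j))"
    and \<Sigma>: "\<Sigma> = mat (ns ! 10) (ns ! 10) (\<lambda>(i, j). S $$ (offset ns 10 + i, offset ns 10 + j))"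
  shows "form_A \<eta> ns F \<Sigma> = S"
proof -
  define blk where "blk k l = (if k = 11 \<and> l = 11 then \<Sigma>
     else if k = 11 \<or> l = 11 \<or> k = 10 \<and> l = 10 then 0\<^sub>m (ns ! (k - 1)) (ns ! (l - 1))
     else if k \<le> l then F k l
     else eta_star \<eta> (F l k))" for k l
  define Mss where "Mss = map (\<lambda>k. map (\<lambda>l. blk k l) [1..<12]) [1..<12]"
  have form: "form_A \<eta> ns F \<Sigma> = block_mat Mss"
    unfolding form_A_def Mss_def blk_def ..
  have up: "[1..<12] ! k = Suc k" if "k < 11" for k using that by (subst nth_upt) simp_all
  have Mss: "Mss ! k ! l = blk (Suc k) (Suc l)" if "k < 11" "l < 11" for k l
    using that by (simp add: Mss_def up del: upt_Suc upt_conv_Cons_Cons upt_rec_numeral)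
  have Fc: "F k l \<in> carrier_mat (ns ! (k - 1)) (ns ! (l - 1))" for k l by (simp add: F)
  have car: "Mss ! k ! l \<in> carrier_mat (ns ! k) (ns ! l)" if "k < length ns" "l < length ns" for k l
    using that Fc[of "Suc k" "Suc l"] eta_star_carrier[OF Fc[of "Suc l" "Suc k"]]
    by (auto simp: Mss len blk_def \<Sigma>)
  have ne: "ns \<noteq> []" using len by auto
  have L: "length Mss = length ns" "\<And>k. k < length ns \<Longrightarrow> length (Mss ! k) = length ns"
    by (simp_all add: Mss_def len del: upt_Suc upt_conv_Cons_Cons upt_rec_numeral)
  have B: "block_mat Mss \<in> carrier_mat (sum_list ns) (sum_list ns)"
    "\<And>k l i j. k < length ns \<Longrightarrow> l < length ns \<Longrightarrow> i < ns ! k \<Longrightarrow> j < ns ! l \<Longrightarrow>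
      block_mat Mss $$ (offset ns k + i, offset ns l + j) = (Mss ! k ! l) $$ (i, j)"
    by (rule block_mat_block[OF ne ne L car]; assumption)+
  have sym: "S $$ (i, j) = eta_conj \<eta> (S $$ (j, i))" if "i < m" "j < m" for i j
    using eta_star_index[OF S(1) that] by (simp only: S(2))
  show ?thesis
  proof (rule eq_matI)
    fix I J assume "I < dim_row S" "J < dim_col S"
    then have IJ: "I < sum_list ns" "J < sum_list ns" using S m by auto
    obtain k i where k: "k < length ns" "i < ns ! k" "I = offset ns k + i" using IJ(1) by (rule offset_cases)
    obtain l j where l: "l < length ns" "j < ns ! l" "J = offset ns l + j" using IJ(2) by (rule offset_cases)
    have lt: "offset ns k + i < offset ns q" if "k < q" "q \<le> 11" for q
      using offset_less_offset[of k q ns i] that k len by simp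
    have lt': "offset ns l + j < offset ns q" if "l < q" "q \<le> 11" for q
      using offset_less_offset[of l q ns j] that l len by simp
    have "form_A \<eta> ns F \<Sigma> $$ (I, J) = blk (Suc k) (Suc l) $$ (i, j)"
      unfolding form using B(2)[of k l i j] k l len by (simp add: Mss)
    also have "\<dots> = S $$ (I, J)"
    proof -
      \<comment> \<open>Counted from 0, the cases are the last diagonal block, the two zero borders,
        the zero diagonal block before it, and the upper and lower parts of what remains.\<close>
      consider "k = 10" "l = 10" | "k < 10" "l = 10" | "k = 10" "l < 10" | "k = 9" "l = 9"
        | "k < 10" "l < 10" "k \<le> l" "\<not> (k = 9 \<and> l = 9)" | "k < 10" "l < 10" "l < k"
        using k(1) l(1) len by linarith
      then show ?thesis
      proof cases
        case 1
        then show ?thesis using k l by (simp add: blk_def \<Sigma>)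
      next
        case 2
        then have "S $$ (I, J) = 0" using lt[of 10] IJ(2) unfolding k(3) l(3) m by (intro z10) (auto simp: m)
        then show ?thesis using 2 k l by (simp add: blk_def)
      next
        case 3
        then have "S $$ (J, I) = 0" using lt'[of 10] IJ(1) unfolding k(3) l(3) m by (intro z10) (auto simp: m)
        then have "S $$ (I, J) = 0" using sym[of I J] IJ by (simp add: m)
        then show ?thesis using 3 k l by (simp add: blk_def)
      next
        case 4
        then have "S $$ (I, J) = 0" using lt[of 10] lt'[of 10] unfolding k(3) l(3) by (intro z9) auto
        then show ?thesis using 4 k l by (simp add: blk_def)
      next
        case 5
        then show ?thesis using k l by (auto simp: blk_def F)
      next
        case 6
        have "blk (Suc k) (Suc l) $$ (i, j) = eta_conj \<eta> (F (Suc l) (Suc k) $$ (j, i))"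
          using 6 k l eta_star_index[OF Fc[of "Suc l" "Suc k"], of i j] by (auto simp: blk_def)
        also have "\<dots> = eta_conj \<eta> (S $$ (J, I))" using k l by (simp add: F)
        also have "\<dots> = S $$ (I, J)" using sym[of I J] IJ by (simp add: m)
        finally show ?thesis .
      qed
    qed
    finally show "form_A \<eta> ns F \<Sigma> $$ (I, J) = S $$ (I, J)" .
  qed (use B(1) S m form in auto)
qed

end

theorem theorem2p3:
  fixes \<eta> :: quat and A B C D :: "quat mat" and m p1 p2 p3 :: nat
  assumes "\<eta> \<in> {quat_i, quat_j, quat_k}"
    and "A \<in> carrier_mat m m" and "A = eta_star \<eta> A"
    and "B \<in> carrier_mat m p1"
    and "C \<in> carrier_mat m p2"
    and "D \<in> carrier_mat m p3"
  shows "\<exists>(m1 :: nat) (m2 :: nat) (m3 :: nat) (m4 :: nat) (m5 :: nat) (m6 :: nat) (m7 :: nat)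
      (m8 :: nat) (t :: nat) (q1 :: nat) (q2 :: nat) (q3 :: nat) (P :: quat mat) (T1 :: quat mat)
      (T2 :: quat mat) (T3 :: quat mat) (F :: nat \<Rightarrow> nat \<Rightarrow> quat mat) (\<Sigma> :: quat mat)
      (S_A :: quat mat) (S_B :: quat mat) (S_C :: quat mat) (S_D :: quat mat) (ns :: nat list).
    int m1 = int (qrank D) + int (qrank B) + int (qrank C)
      - int (qrank (block_mat [[D, B, 0\<^sub>m m p2], [D, 0\<^sub>m m p1, C]])) \<and>
    int m2 = int (qrank (block_mat [[D, B, 0\<^sub>m m p2], [D, 0\<^sub>m m p1, C]]))
      - int (qrank (block_mat [[B, C]])) - int (qrank D) \<and>
    int m3 = int (qrank (block_mat [[D, B, 0\<^sub>m m p2], [D, 0\<^sub>m m p1, C]]))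
      - int (qrank (block_mat [[B, D]])) - int (qrank C) \<and>
    int m4 = int (qrank (block_mat [[B, C]])) + int (qrank (block_mat [[C, D]]))
      + int (qrank (block_mat [[B, D]])) - int (qrank (block_mat [[B, C, D]]))
      - int (qrank (block_mat [[D, B, 0\<^sub>m m p2], [D, 0\<^sub>m m p1, C]])) \<and>
    int m5 = int (qrank (block_mat [[B, C, D]])) - int (qrank (block_mat [[C, D]])) \<and>
    int m6 = int (qrank (block_mat [[D, B, 0\<^sub>m m p2], [D, 0\<^sub>m m p1, C]]))
      - int (qrank (block_mat [[C, D]])) - int (qrank B) \<and>
    int m7 = int (qrank (block_mat [[B, C, D]])) - int (qrank (block_mat [[B, D]])) \<and>
    int m8 = int (qrank (block_mat [[B, C, D]])) - int (qrank (block_mat [[B, C]])) \<and>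
    int t = int m - int (qrank (block_mat [[B, C, D]])) - int (qrank \<Sigma>) \<and>
    int q1 = int p1 - int (qrank B) \<and>
    int q2 = int p2 - int (qrank C) \<and>
    int q3 = int p3 - int (qrank D) \<and>
    int (qrank \<Sigma>) = int (qrank (block_mat
        [[A, B, C, D],
         [eta_star \<eta> B, 0\<^sub>m p1 p1, 0\<^sub>m p1 p2, 0\<^sub>m p1 p3],
         [eta_star \<eta> C, 0\<^sub>m p2 p1, 0\<^sub>m p2 p2, 0\<^sub>m p2 p3],
         [eta_star \<eta> D, 0\<^sub>m p3 p1, 0\<^sub>m p3 p2, 0\<^sub>m p3 p3]]))
      - 2 * int (qrank (block_mat [[B, C, D]])) \<and>
    \<Sigma> \<in> carrier_mat (qrank \<Sigma>) (qrank \<Sigma>) \<and> diagonal_mat \<Sigma> \<and> invertible_mat \<Sigma> \<and>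
    ns = [m1, m2, m3, m4, m5, m4, m6, m7, m8, t, qrank \<Sigma>] \<and>
    (\<forall>k \<in> {1..10}. \<forall>l \<in> {k..10}. F k l \<in> carrier_mat (ns ! (k - 1)) (ns ! (l - 1))) \<and>
    S_A = form_A \<eta> ns F \<Sigma> \<and> S_A = eta_star \<eta> S_A \<and>
    S_B = form_B ns [m1, m2, m3, m4, m5, q1] \<and>
    S_C = form_C ns [m4, m6, m7, m1, m2, q2] \<and>
    S_D = form_D ns [m8, m4, m6, m3, m1, q3] \<and>
    P \<in> GL m \<and> T1 \<in> GL p1 \<and> T2 \<in> GL p2 \<and> T3 \<in> GL p3 \<and>
    P * A * eta_star \<eta> P = S_A \<and>
    P * B * T1 = S_B \<and>
    P * C * T2 = S_C \<and>
    P * D * T3 = S_D"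
proof -
  note \<eta> = assms(1) and A = assms(2) and A_star = assms(3) and B = assms(4) and C = assms(5) and D = assms(6)
  interpret quat_unit \<eta> by unfold_locales (rule \<eta>)
  let ?U = "col_space B" and ?V = "col_space C" and ?W = "col_space D"
  let ?E = "coord_space m :: (nat \<Rightarrow> quat) set"
  let ?R = "block_mat [[D, B, 0\<^sub>m m p2], [D, 0\<^sub>m m p1, C]]"
  let ?G = "block_mat [[A, B, C, D],
         [eta_star \<eta> B, 0\<^sub>m p1 p1, 0\<^sub>m p1 p2, 0\<^sub>m p1 p3],
         [eta_star \<eta> C, 0\<^sub>m p2 p1, 0\<^sub>m p2 p2, 0\<^sub>m p2 p3],
         [eta_star \<eta> D, 0\<^sub>m p3 p1, 0\<^sub>m p3 p2, 0\<^sub>m p3 p3]]"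
  note sub = rsubspace_col_space[of B] rsubspace_col_space[of C] rsubspace_col_space[of D]
  obtain n b where n46: "n 6 = n 4"
    and bU: "rel_basis {0} ?U (block_index n {1, 2, 3, 4, 5}) b"
    and bV: "rel_basis {0} ?V (block_index n {6, 7, 8, 1, 2}) b"
    and bW: "rel_basis {0} ?W (block_index n {9, 4, 7, 3, 1}) (diag_family b)"
    and bUV: "rel_basis ?U (?U + ?V) (block_index n {6, 7, 8}) b"
    and bUW: "rel_basis ?U (?U + ?W) (block_index n {4, 7, 9}) (diag_family b)"
    and bVW: "rel_basis ?V (?V + ?W) (block_index n {3, 4, 9}) (diag_family b)"
    and b9: "rel_basis (?U + ?V) (?U + ?V + ?W) (block_index n {9}) b"
    and b10: "rel_basis (?U + ?V + ?W) ?E (block_index n {10}) b"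
    and bT: "rel_basis (?U \<inter> ?V \<inter> ?W) ?W (block_index n {3, 4, 7, 9}) (diag_family b)"
    by (rule three_subspaces_basis[OF sub(1) col_space_subset[OF B] sub(2) col_space_subset[OF C]
      sub(3) col_space_subset[OF D]])
  \<comment> \<open>This is the rank of (B, C, D): the nine blocks together form a basis of the sum
    of the column spaces.\<close>
  define r where "r = n 1 + n 2 + n 3 + n 4 + n 5 + n 6 + n 7 + n 8 + n 9"
  have sUV: "rsubspace (?U + ?V)" and sUVW: "rsubspace (?U + ?V + ?W)" by (intro rsubspace_plus sub)+
  have inc: "?U \<subseteq> ?U + ?V" "?U + ?V \<subseteq> ?U + ?V + ?W" "?U + ?V + ?W \<subseteq> ?E"
    using subset_plus_left[OF sub(2)] subset_plus_left[OF sub(3)]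
      plus_subset[OF rsubspace_coord_space plus_subset[OF rsubspace_coord_space
        col_space_subset[OF B] col_space_subset[OF C]] col_space_subset[OF D]] by auto
  let ?K = "[1, 2, 3, 4, 5, 6, 7, 8, 9 :: nat]"
  have "rel_basis {0} (?U + ?V) (block_index n ({1, 2, 3, 4, 5} \<union> {6, 7, 8})) b"
    by (rule rel_basis_block_trans[OF bU bUV _ sub(1)]) (use rsubspace_0[OF sub(1)] inc in auto)
  then have "rel_basis {0} (?U + ?V + ?W) (block_index n (({1, 2, 3, 4, 5} \<union> {6, 7, 8}) \<union> {9})) b"
    by (rule rel_basis_block_trans[OF _ b9 _ sUV]) (use rsubspace_0[OF sUV] inc in auto)
  then have b1_9: "rel_basis {0} (?U + ?V + ?W) (block_index n (set ?K)) b"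
    by (simp add: Un_commute insert_commute)
  have "rel_basis {0} ?E (block_index n (set ?K \<union> {10})) b"
    by (rule rel_basis_block_trans[OF b1_9 b10 _ sUVW]) (use rsubspace_0[OF sUVW] inc in auto)
  then have b1_10: "rel_basis {0} ?E (block_index n (set (?K @ [10]))) b"
    by (simp add: insert_commute)
  have m: "m = r + n 10"
    using basis_coord_space_card[OF b1_10] by (simp add: card_block_index r_def)

  \<comment> \<open>The basis in the order of the block rows. The inverse of its matrix sends each
    vector to the unit vector of its position.\<close>
  define q where "q = b \<circ> block_enum n (?K @ [10])"
  have "rel_basis {0} ?E {..<sum_list (map n (?K @ [10]))} q"
    unfolding q_def by (rule rel_basis_block_enum[OF b1_10]) simp
  then have q: "rel_basis {0} ?E {..<m} q" by (simp add: m r_def add.assoc)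
  obtain P0 where P0: "P0 \<in> carrier_mat m m" "mat_of_family m m q \<in> carrier_mat m m"
    "P0 * mat_of_family m m q = 1\<^sub>m m" "mat_of_family m m q * P0 = 1\<^sub>m m"
    using GL_inverse[OF basis_matrix_invertible[OF q]] by metis
  have P0_GL: "P0 \<in> GL m" by (rule GL_intro[OF P0(1,2,3,4)])
  have P0q: "mat_app P0 (q j) = unit_fun j" if "j < m" for j
  proof -
    have "mat_app P0 (q j) = mat_app P0 (column (mat_of_family m m q) j)"
      using that rel_basis_mem[OF q, of j] by (simp add: column_mat_of_family)
    also have "\<dots> = column (1\<^sub>m m) j"
      by (simp only: column_mult[OF P0(1,2) that, symmetric] P0(3))
    also have "\<dots> = unit_fun j" using that by (auto simp: column_def unit_fun_def fun_eq_iff)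
    finally show ?thesis .
  qed

  have eP0: "eta_star \<eta> P0 \<in> carrier_mat m m" by (rule eta_star_carrier[OF P0(1)])
  have PA: "P0 * A \<in> carrier_mat m m" by (rule mult_carrier_mat[OF P0(1) A])
  have A0: "P0 * A * eta_star \<eta> P0 \<in> carrier_mat m m" by (rule mult_carrier_mat[OF PA eP0])
  have A0_star: "eta_star \<eta> (P0 * A * eta_star \<eta> P0) = P0 * A * eta_star \<eta> P0"
    by (rule eta_star_congruence[OF P0(1) A A_star[symmetric]])
  \<comment> \<open>The form is reduced after the change of coordinates by \<open>P0\<close>, hence
    the interpretation for the transformed matrix; the one for \<open>A\<close> itself serves the
    rank of the bordered matrix.\<close>
  interpret A: eta_hermitian \<eta> A m by unfold_locales (rule A, rule A_star[symmetric])
  interpret A0: eta_hermitian \<eta> "P0 * A * eta_star \<eta> P0" m by unfold_locales (rule A0, rule A0_star)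
  have "r \<le> m" by (simp add: m)
  obtain P1 s where P1: "P1 \<in> GL m" and s: "s \<le> m - r"
    and P1_id: "\<And>i j. i < m \<Longrightarrow> j < r \<Longrightarrow> P1 $$ (i, j) = (if i = j then 1 else 0)"
    and z: "\<And>i j. r \<le> i \<Longrightarrow> i < m \<Longrightarrow> r \<le> j \<Longrightarrow> j < m \<Longrightarrow> i \<noteq> j \<or> i < m - s \<Longrightarrow>
      (P1 * (P0 * A * eta_star \<eta> P0) * eta_star \<eta> P1) $$ (i, j) = 0"
    and nz: "\<And>i. m - s \<le> i \<Longrightarrow> i < m \<Longrightarrow> (P1 * (P0 * A * eta_star \<eta> P0) * eta_star \<eta> P1) $$ (i, i) \<noteq> 0"
    and z': "\<And>i j. i < r \<Longrightarrow> m - s \<le> j \<Longrightarrow> j < m \<Longrightarrow>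
      (P1 * (P0 * A * eta_star \<eta> P0) * eta_star \<eta> P1) $$ (i, j) = 0"
    using A0.congruence_reduction[OF \<open>r \<le> m\<close>] by blast
  have P1c: "P1 \<in> carrier_mat m m" using P1 by (simp add: GL_def)
  define P where "P = P1 * P0"
  have P: "P \<in> GL m" unfolding P_def by (rule GL_mult[OF P1 P0_GL])
  have Pc: "P \<in> carrier_mat m m" using P by (simp add: GL_def)
  define S where "S = P * A * eta_star \<eta> P"
  have eP1: "eta_star \<eta> P1 \<in> carrier_mat m m" by (rule eta_star_carrier[OF P1c])
  have "P1 * (P0 * A * eta_star \<eta> P0) * eta_star \<eta> P1 = P1 * (P0 * A) * (eta_star \<eta> P0 * eta_star \<eta> P1)"
    using assoc_mult_mat[OF P1c PA eP0] assoc_mult_mat[OF mult_carrier_mat[OF P1c PA] eP0 eP1] by simp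
  also have "\<dots> = S"
    by (simp only: S_def P_def eta_star_mult[OF P1c P0(1)] assoc_mult_mat[OF P1c P0(1) A])
  finally have S_eq: "P1 * (P0 * A * eta_star \<eta> P0) * eta_star \<eta> P1 = S" .
  note z = z[unfolded S_eq] and nz = nz[unfolded S_eq] and z' = z'[unfolded S_eq]
  have Sc: "S \<in> carrier_mat m m"
    unfolding S_def by (rule mult_carrier_mat[OF mult_carrier_mat[OF Pc A] eta_star_carrier[OF Pc]])
  have S_star: "eta_star \<eta> S = S"
    unfolding S_def by (rule eta_star_congruence[OF Pc A A_star[symmetric]])

  \<comment> \<open>\<open>P1\<close> fixes the leading \<open>r\<close> unit vectors, so reducing
    the form does not disturb the adapted basis of the column spaces.\<close>
  have Pq: "mat_app P (q j) = unit_fun j" if "j < r" for j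
  proof -
    have j: "j < m" using that m by simp
    have "mat_app P (q j) = mat_app P1 (unit_fun j)"
      by (simp only: P_def mat_app_mult[OF P1c P0(1)] P0q[OF j])
    also have "\<dots> = column P1 j" using P1c j by (intro mat_app_unit_fun) simp
    also have "\<dots> = unit_fun j" using P1c P1_id that j by (auto simp: column_def unit_fun_def fun_eq_iff)
    finally show ?thesis .
  qed
  \<comment> \<open>The tenth block of the basis splits into \<open>t\<close> directions on whose
    span the form is zero and \<open>s\<close> directions carrying \<open>\<Sigma>\<close>.\<close>
  define t where "t = n 10 - s"
  define \<Sigma> where "\<Sigma> = mat s s (\<lambda>(i, j). S $$ (r + t + i, r + t + j))"
  \<comment> \<open>Blocks 4 and 6 share one size, so the numbering of sizes lags behind that of the
    blocks: m6, m7, m8 are \<open>n 7\<close>, \<open>n 8\<close>, \<open>n 9\<close>.\<close>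
  define ns where "ns = [n 1, n 2, n 3, n 4, n 5, n 4, n 7, n 8, n 9, t, s]"
  have rts: "m - s = r + t" "r + t + s = m" "t + s = n 10" using s by (simp_all add: t_def m)
  have len: "length ns = 11" by (simp add: ns_def)
  have off9: "offset ns 9 = r" and off10: "offset ns 10 = r + t" and sum: "m = sum_list ns" and ns10: "ns ! 10 = s"
    using rts by (simp_all add: ns_def offset_def r_def n46)

  \<comment> \<open>Block rows in \<open>ns\<close> are counted from 0 and blocks from 1, hence
    \<open>Suc k\<close>. Only the nine blocks inside the column spaces are covered; the images of
    block 10 under \<open>P\<close> are not prescribed.\<close>
  have Pb: "mat_app P (b (Suc k, i)) = unit_fun (offset ns k + i)" if "k < 9" "i < n (Suc k)" for k i
  proof -
    have K: "(?K @ [10]) ! k = Suc k" "map n (?K @ [10]) ! k = n (Suc k)"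
      using that(1) by (auto simp: less_Suc_eq numeral_eq_Suc)
    have off: "offset (map n (?K @ [10])) k = offset ns k"
      using that(1) n46 by (auto simp: less_Suc_eq numeral_eq_Suc ns_def offset_def)
    have "ns ! k = n (Suc k)"
      using that(1) n46 by (auto simp: less_Suc_eq numeral_eq_Suc ns_def)
    then have "offset ns k + i < offset ns 9"
      using offset_less_offset[of k 9 ns i] that len by simp
    then have lt: "offset ns k + i < r" by (simp only: off9)
    have "q (offset ns k + i) = b (Suc k, i)"
      using block_enum_offset[of k "?K @ [10]" i n] that K unfolding q_def off[symmetric] by simp
    then show ?thesis using Pq[OF lt] by simp
  qed

  obtain T1 q1 where T1: "T1 \<in> GL p1" "p1 = sum_list (map n [1, 2, 3, 4, 5] @ [q1])"
    "\<And>l j. l < length [1, 2, 3, 4, 5 :: nat] \<Longrightarrow> j < n ([1, 2, 3, 4, 5] ! l) \<Longrightarrow>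
      column (B * T1) (offset (map n [1, 2, 3, 4, 5] @ [q1]) l + j) = b ([1, 2, 3, 4, 5] ! l, j)"
    "\<And>j. j < q1 \<Longrightarrow> column (B * T1) (offset (map n [1, 2, 3, 4, 5] @ [q1]) (length [1, 2, 3, 4, 5 :: nat]) + j) = 0"
    using block_column_reduction[OF B, of n "[1, 2, 3, 4, 5]" b] bU by auto
  obtain T2 q2 where T2: "T2 \<in> GL p2" "p2 = sum_list (map n [6, 7, 8, 1, 2] @ [q2])"
    "\<And>l j. l < length [6, 7, 8, 1, 2 :: nat] \<Longrightarrow> j < n ([6, 7, 8, 1, 2] ! l) \<Longrightarrow>
      column (C * T2) (offset (map n [6, 7, 8, 1, 2] @ [q2]) l + j) = b ([6, 7, 8, 1, 2] ! l, j)"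
    "\<And>j. j < q2 \<Longrightarrow> column (C * T2) (offset (map n [6, 7, 8, 1, 2] @ [q2]) (length [6, 7, 8, 1, 2 :: nat]) + j) = 0"
    using block_column_reduction[OF C, of n "[6, 7, 8, 1, 2]" b] bV by auto
  obtain T3 q3 where T3: "T3 \<in> GL p3" "p3 = sum_list (map n [9, 4, 7, 3, 1] @ [q3])"
    "\<And>l j. l < length [9, 4, 7, 3, 1 :: nat] \<Longrightarrow> j < n ([9, 4, 7, 3, 1] ! l) \<Longrightarrow>
      column (D * T3) (offset (map n [9, 4, 7, 3, 1] @ [q3]) l + j) = diag_family b ([9, 4, 7, 3, 1] ! l, j)"
    "\<And>j. j < q3 \<Longrightarrow> column (D * T3) (offset (map n [9, 4, 7, 3, 1] @ [q3]) (length [9, 4, 7, 3, 1 :: nat]) + j) = 0"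
    using block_column_reduction[OF D, of n "[9, 4, 7, 3, 1]" "diag_family b"] bW by auto

  \<comment> \<open>It suffices to compare columns: after the column operations each one is a basis
    vector, a sum of two, or zero, and \<open>P\<close> turns these into unit vectors, their sums,
    or zero.\<close>
  have reduce: "P * X * T = S'"
    if X: "X \<in> carrier_mat m p" and T: "T \<in> GL p" and p: "p = sum_list cs"
      and S': "S' \<in> carrier_mat (sum_list ns) (sum_list cs)"
      and col: "\<And>l j. l < length cs \<Longrightarrow> j < cs ! l \<Longrightarrow>
        mat_app P (column (X * T) (offset cs l + j)) = column S' (offset cs l + j)"
    for X T p cs S'
  proof -
    have Tc: "T \<in> carrier_mat p p" using T by (simp add: GL_def)
    have XT: "X * T \<in> carrier_mat m p" by (rule mult_carrier_mat[OF X Tc])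
    have "P * X * T = P * (X * T)" by (rule assoc_mult_mat[OF Pc X Tc])
    also have "\<dots> = S'"
    proof (rule block_column_eqI[OF mult_carrier_mat[OF Pc XT] _ p])
      show "S' \<in> carrier_mat m p" using S' by (simp only: sum[symmetric] p[symmetric])
      show "column (P * (X * T)) (offset cs l + j) = column S' (offset cs l + j)"
        if "l < length cs" "j < cs ! l" for l j
        using column_mult[OF Pc XT, of "offset cs l + j"] col[OF that] offset_less[OF that] p by simp
    qed
    finally show ?thesis .
  qed

  let ?cB = "[n 1, n 2, n 3, n 4, n 5, q1]" and ?cC = "[n 4, n 7, n 8, n 1, n 2, q2]"
    and ?cD = "[n 9, n 4, n 7, n 3, n 1, q3]"
  note fB = form_B_columns[OF ns_def refl, where q = q1] and fC = form_C_columns[OF ns_def refl, where q = q2]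
    and fD = form_D_columns[OF ns_def refl, where q = q3]
  have PB: "P * B * T1 = form_B ns ?cB"
  proof (rule reduce[OF B T1(1) _ fB(1)])
    show "p1 = sum_list ?cB" using T1(2) by simp
    show "mat_app P (column (B * T1) (offset ?cB l + j)) = column (form_B ns ?cB) (offset ?cB l + j)"
      if l: "l < length ?cB" and j: "j < ?cB ! l" for l j
    proof -
      have l6: "l < 6" using l by simp
      have "mat_app P (column (B * T1) (offset ?cB l + j)) = (if l < 5 then unit_fun (offset ns l + j) else 0)"
        using less_6_cases[OF l6] j T1(3)[of l j] T1(4)[of j] Pb[of l j]
        by (elim disjE) (simp_all add: mat_app_zero offset_6_5 numeral_2_eq_2[symmetric])
      then show ?thesis using fB(2)[OF l6 j] by simp
    qed
  qed
  have PC: "P * C * T2 = form_C ns ?cC"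
  proof (rule reduce[OF C T2(1) _ fC(1)])
    show "p2 = sum_list ?cC" using T2(2) n46 by simp
    show "mat_app P (column (C * T2) (offset ?cC l + j)) = column (form_C ns ?cC) (offset ?cC l + j)"
      if l: "l < length ?cC" and j: "j < ?cC ! l" for l j
    proof -
      have l6: "l < 6" using l by simp
      have "mat_app P (column (C * T2) (offset ?cC l + j))
          = (if l < 5 then unit_fun (offset ns ([5, 6, 7, 0, 1] ! l) + j) else 0)"
        using less_6_cases[OF l6] j T2(3)[of l j] T2(4)[of j] Pb[of "[5, 6, 7, 0, 1] ! l" j] n46
        by (elim disjE) (simp_all add: mat_app_zero offset_6_5 numeral_2_eq_2[symmetric])
      then show ?thesis using fC(2)[OF l6 j] by simp
    qed
  qed
  have PD: "P * D * T3 = form_D ns ?cD"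
  proof (rule reduce[OF D T3(1) _ fD(1)])
    show "p3 = sum_list ?cD" using T3(2) by simp
    show "mat_app P (column (D * T3) (offset ?cD l + j)) = column (form_D ns ?cD) (offset ?cD l + j)"
      if l: "l < length ?cD" and j: "j < ?cD ! l" for l j
    proof -
      have l6: "l < 6" using l by simp
      \<comment> \<open>For \<open>l = 1\<close> the column is \<open>b (4, j) + b (6, j)\<close>,
        so its image has a 1 in block row 3 and another in block row 5, counted from 0.\<close>
      have "mat_app P (column (D * T3) (offset ?cD l + j))
          = (if l = 1 then unit_fun (offset ns 3 + j) + unit_fun (offset ns 5 + j)
            else if l < 5 then unit_fun (offset ns ([8, 3, 6, 2, 0] ! l) + j) else 0)"
        using less_6_cases[OF l6] j T3(3)[of l j] T3(4)[of j] Pb[of "[8, 3, 6, 2, 0] ! l" j]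
          Pb[of 3 j] Pb[of 5 j] n46
        by (elim disjE) (simp_all add: mat_app_zero offset_6_5 numeral_2_eq_2[symmetric] diag_family_def mat_app_add)
      then show ?thesis using fD(2)[OF l6 j] by simp
    qed
  qed

  define F where "F k l = mat (ns ! (k - 1)) (ns ! (l - 1))
      (\<lambda>(i, j). S $$ (offset ns (k - 1) + i, offset ns (l - 1) + j))" for k l
  have SA: "S = form_A \<eta> ns F \<Sigma>"
  proof (rule form_A_eq[OF Sc S_star sum len _ _ F_def, symmetric])
    \<comment> \<open>For \<open>i < r\<close> the entry vanishes because the leading vectors were
      made orthogonal to the diagonal part; otherwise it is an off-diagonal entry on the subspace
      where the form was split.\<close>
    show "S $$ (i, j) = 0" if "i < offset ns 10" "offset ns 10 \<le> j" "j < m" for i j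
      using that z[of i j] z'[of i j] rts unfolding off10 by (cases "i < r") auto
    show "S $$ (i, j) = 0" if "offset ns 9 \<le> i" "i < offset ns 10" "offset ns 9 \<le> j" "j < offset ns 10" for i j
      using that z[of i j] rts unfolding off10 off9 by auto
    show "\<Sigma> = mat (ns ! 10) (ns ! 10) (\<lambda>(i, j). S $$ (offset ns 10 + i, offset ns 10 + j))"
      by (simp only: \<Sigma>_def off10 ns10)
  qed
  have \<Sigma>_diag: "\<Sigma> = mat s s (\<lambda>(i, j). if i = j then S $$ (r + t + i, r + t + i) else 0)"
    using z rts by (intro eq_matI) (auto simp: \<Sigma>_def)
  have \<Sigma>_GL: "\<Sigma> \<in> GL s"
    unfolding \<Sigma>_diag by (rule diagonal_GL) (use nz rts in auto)
  have \<Sigma>_rank: "qrank \<Sigma> = s" by (rule qrank_GL[OF \<Sigma>_GL])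

  \<comment> \<open>All ranks become sums of block sizes, so that the required formulas reduce to
    linear arithmetic over the integers.\<close>
  note [simp] = card_block_index card_Plus finite_Plus block_index_def
  have rB: "qrank B = n 1 + n 2 + n 3 + n 4 + n 5"
    using qrank_eq_card[OF bU] by (simp add: add.assoc)
  have rC: "qrank C = n 4 + n 7 + n 8 + n 1 + n 2"
    using qrank_eq_card[OF bV] n46 by (simp add: add.assoc)
  have rD: "qrank D = n 9 + n 4 + n 7 + n 3 + n 1"
    using qrank_eq_card[OF bW] by (simp add: add.assoc)
  have rBC: "qrank (block_mat [[B, C]]) = qrank B + (n 4 + n 7 + n 8)"
    using qrank_eq_card[of "block_mat [[B, C]]", unfolded col_space_row2[OF B C],
      OF rel_basis_trans_Plus[OF bU bUV sub(1)]] rsubspace_0[OF sub(1)] inc n46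
    by (simp add: rB)
  have rBD: "qrank (block_mat [[B, D]]) = qrank B + (n 4 + n 7 + n 9)"
    using qrank_eq_card[of "block_mat [[B, D]]", unfolded col_space_row2[OF B D],
      OF rel_basis_trans_Plus[OF bU bUW sub(1)]] rsubspace_0[OF sub(1)] subset_plus_left[OF sub(3)]
    by (simp add: rB)
  have rCD: "qrank (block_mat [[C, D]]) = qrank C + (n 3 + n 4 + n 9)"
    using qrank_eq_card[of "block_mat [[C, D]]", unfolded col_space_row2[OF C D],
      OF rel_basis_trans_Plus[OF bV bVW sub(2)]] rsubspace_0[OF sub(2)] subset_plus_left[OF sub(3)] n46
    by (simp add: rC)
  have rBCD: "qrank (block_mat [[B, C, D]]) = r"
    using qrank_eq_card[of "block_mat [[B, C, D]]", unfolded col_space_row3[OF B C D], OF b1_9]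
    by (simp add: r_def)
  have rR: "qrank ?R = qrank B + qrank C + (n 3 + n 4 + n 7 + n 9)"
    using qrank_pair[OF B C D bU bV bT] n46 by (simp add: rB rC)
  have rG: "qrank ?G = 2 * r + s"
  proof (rule A.qrank_bordered[OF P _ B C D, of r s q])
    show "r + s \<le> m" using rts by simp
    have "rel_basis {0} (?U + ?V + ?W) {..<sum_list (map n ?K)} (b \<circ> block_enum n ?K)"
      by (rule rel_basis_block_enum[OF b1_9]) simp
    moreover have "sum_list (map n ?K) = r" by (simp add: r_def)
    \<comment> \<open>The basis of the sum of the column spaces is an initial segment of
      \<open>q\<close>, because appending block 10 leaves the earlier positions unchanged.\<close>
    moreover have "block_enum n ?K i = block_enum n (?K @ [10]) i" if "i < r" for i
      by (rule block_enum_append[symmetric]) (use that in \<open>simp add: r_def\<close>)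
    ultimately show "rel_basis {0} (?U + ?V + ?W) {..<r} q"
      by (auto simp: q_def intro: rel_basis_cong)
  qed (use Pq z nz in \<open>auto simp: S_def[symmetric]\<close>)

  show ?thesis
  proof (rule exI[of _ "n 1"], rule exI[of _ "n 2"], rule exI[of _ "n 3"], rule exI[of _ "n 4"],
      rule exI[of _ "n 5"], rule exI[of _ "n 7"], rule exI[of _ "n 8"], rule exI[of _ "n 9"],
      rule exI[of _ t], rule exI[of _ q1], rule exI[of _ q2], rule exI[of _ q3], rule exI[of _ P],
      rule exI[of _ T1], rule exI[of _ T2], rule exI[of _ T3], rule exI[of _ F], rule exI[of _ \<Sigma>],
      rule exI[of _ S], rule exI[of _ "form_B ns ?cB"], rule exI[of _ "form_C ns ?cC"],
      rule exI[of _ "form_D ns ?cD"], rule exI[of _ ns], intro conjI)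
    show "\<Sigma> \<in> carrier_mat (qrank \<Sigma>) (qrank \<Sigma>)" "invertible_mat \<Sigma>"
      using \<Sigma>_GL by (auto simp: GL_def \<Sigma>_rank)
    show "diagonal_mat \<Sigma>" unfolding \<Sigma>_diag by (simp add: diagonal_mat_def)
    show "\<forall>k\<in>{1..10}. \<forall>l\<in>{k..10}. F k l \<in> carrier_mat (ns ! (k - 1)) (ns ! (l - 1))"
      by (simp add: F_def)
    show "ns = [n 1, n 2, n 3, n 4, n 5, n 4, n 7, n 8, n 9, t, qrank \<Sigma>]" by (simp add: ns_def \<Sigma>_rank)
    show "S = form_A \<eta> ns F \<Sigma>" by (rule SA)
    show "S = eta_star \<eta> S" by (rule S_star[symmetric])
    show "P * A * eta_star \<eta> P = S" by (rule S_def[symmetric])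
    show "int t = int m - int (qrank (block_mat [[B, C, D]])) - int (qrank \<Sigma>)"
      using rts by (simp add: rBCD \<Sigma>_rank)
    show "int (qrank \<Sigma>) = int (qrank ?G) - 2 * int (qrank (block_mat [[B, C, D]]))"
      by (simp add: rG rBCD \<Sigma>_rank)
    show "int q1 = int p1 - int (qrank B)" using T1(2) by (simp add: rB)
    show "int q2 = int p2 - int (qrank C)" using T2(2) n46 by (simp add: rC)
    show "int q3 = int p3 - int (qrank D)" using T3(2) by (simp add: rD)
  qed (rule PB PC PD P T1(1) T2(1) T3(1) refl
    | simp add: rR rBC rBD rCD rBCD rB rC rD r_def n46)+
qed

end
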